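(* Let $\chi$ be a positive integer. The instanton corrected q-map metric $g_{\overline N}$ associated to the prepotential $\mathfrak F=-\frac16\frac{(Z^1)^3}{Z^0}+\chi\frac{(Z^0)^2\zeta(3)}{2(2\pi\mathrm i)^3}$, the BPS indices $\Omega(q_0\gamma^0)=-\chi$ for $q_0\in\mathbb Z\setminus\{0\}$ and $\Omega(\gamma)=0$ otherwise, and the 1-loop constant $c_\ell=\frac{\chi}{192\pi}$ is defined and positive definite on $$\widetilde N=\{(\tau_2,b+\mathrm it,\tau_1,\zeta^1,\tilde\zeta_0,\tilde\zeta_1,\sigma)\in\mathbb R_{>0}\times(\mathbb R+\mathrm i\mathbb R_{>0})\times\mathbb R^4\times\mathbb R\;:\;R_1(t,\tau)>0,\ R_2(t,\tau)>0\},$$ where $\tau=\tau_1+\mathrm i\tau_2$ and $$R_1(t,\tau)=\frac{t^3}3-\frac{\chi}{4(2\pi)^3}\sum_{(m,n)\in\mathbb Z^2\setminus(0,0)}\frac1{|m\tau+n|^3},$$ $$R_2(t,\tau)=\frac{t^3}3-\frac{3\chi}{4(2\pi)^3}\sum_{(m,n)\ne(0,0)}\frac1{|m\tau+n|^3}-\frac{(3\chi)^2}{(4\pi)^6}\Big(\sum_{(m,n)\neq(0,0)}\frac1{|m\tau+n|^3}\Big)^2R_1(t,\tau)^{-1}.$$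
   Context: Repeated indices $i,j\in\{0,1\}$ are summed. **The metric.** Let $M^{\mathrm{cl}}=\{(Z^0,Z^1)\in\mathbb C^2:Z^0\ne0,\ \mathrm{Im}(Z^1/Z^0)>0\}$, $z^0=1$, $z^1=Z^1/Z^0=b+\mathrm it$, $\tau_{ij}=\partial^2\mathfrak F/\partial Z^i\partial Z^j$. On $M^{\mathrm{cl}}\times\mathbb R^4\times\mathbb R$ use coordinates $(Z^0,Z^1,\zeta^0,\zeta^1,\tilde\zeta_0,\tilde\zeta_1,\sigma)$. With $K_\nu$ the modified Bessel functions of the second kind, for $q\in\mathbb Z\setminus\{0\}$ let $$V_q=\tfrac1{2\pi}\sum_{k>0}e^{-2\pi\mathrm ikq\zeta^0}K_0(2\pi k|qZ^0|),\quad A_q=-\tfrac1{4\pi}\sum_{k>0}e^{-2\pi\mathrm ikq\zeta^0}|qZ^0|K_1(2\pi k|qZ^0|)\Big(\tfrac{dZ^0}{Z^0}-\tfrac{d\overline Z^0}{\overline Z^0}\Big),$$ $$\eta_q=\tfrac{\mathrm i}{8\pi^2}\sum_{k>0}\tfrac{e^{-2\pi\mathrm ikq\zeta^0}}k|qZ^0|K_1(2\pi k|qZ^0|)\Big(\tfrac{dZ^0}{Z^0}-\tfrac{d\overline Z^0}{\overline Z^0}\Big).$$ Let $T_{ij}=-\mathrm{Im}\,\tau_{ij}+\chi\,\delta_{i0}\delta_{j0}\sum_{q\ne0}q^2V_q$ with inverse $T^{ij}$; $W_i=d\tilde\zeta_i-\tau_{ij}d\zeta^j$; $W_0^{\mathrm{inst}}=\chi\sum_{q\ne0}q(A_q+\mathrm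 iqV_qd\zeta^0)$, $W_1^{\mathrm{inst}}=0$; $$g_N=2\pi\big(T_{ij}dZ^id\overline Z^j+(W_i+W_i^{\mathrm{inst}})T^{ij}(\overline W_j+\overline W_j^{\mathrm{inst}})\big),\qquad\omega_1+\mathrm i\omega_2=2\pi dZ^i\wedge(W_i+W_i^{\mathrm{inst}}).$$ Let $V=2\mathrm i(Z^i\partial_{Z^i}-\overline Z^i\partial_{\overline Z^i})$, $r^2=-\mathrm{Im}(\tau_{ij})Z^i\overline Z^j$, $f=2\pi\big(r^2-8c_\ell+\chi\sum_{q\ne0}\eta_q(V)\big)$, $f_3=f-\frac12g_N(V,V)$, $d^c=\mathrm i(\overline\partial-\partial)$, $\theta_0=-\frac12df$, $\theta_1=\frac12\iota_V\omega_2$, $\theta_2=-\frac12\iota_V\omega_1$, $\theta_3=\pi(d\sigma+\tilde\zeta_id\zeta^i-\zeta^id\tilde\zeta_i)+\frac\pi2d^cr^2+2\pi\chi\sum_{q\ne0}\eta_q$, $\eta=\theta_3-\frac12\iota_Vg_N$. The instanton corrected q-map metric is the (pseudo-)quaternionic-Kähler metric $$g_{\overline N}=-\frac1f\Big(\frac2{f_3}\eta^2+g_N-\frac2f\sum_{k=0}^3\theta_k^2\Big)\Big|_{\{\mathrm{Arg}Z^0=0\}},$$ defined at the points with $r^2>0$, $\mathrm{Im}(\tau_{ij})$ of signature $(1,1)$, $\det(T_{ij})\neq0$, $f\ne0$, $f_3\ne0$, $g_N(V,V)\ne0$. The hypersurface $\{\mathrm{Arg}Z^0=0\}$ carries the coordinates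 $(\tau_2,b+\mathrm it,\tau_1,\zeta^1,\tilde\zeta_0,\tilde\zeta_1,\sigma)$ with $\tau_2=|Z^0|$ and $\tau_1=\zeta^0$. *)

theory Defs
  imports "HOL-Analysis.Analysis"
begin

text \<open>
  The indices 0, 1 are the two elements of the numeral type \<^typ>\<open>2\<close>.
  A point is \<open>(Z, \<zeta>, \<zeta>t, \<sigma>)\<close>, where \<open>\<zeta>t\<close> stands for the coordinates
  \<open>\<zeta>\<close> with a tilde. All coordinates are global and linear, so tangent vectors have the same
  type as points and \<open>dZ\<^sup>i\<close>, \<open>d\<zeta>\<^sup>i\<close>, ... read off the components of a tangent vector.
  Differential forms and symmetric tensors are complex-valued functions of a point and of tangent
  vectors (real tangent vectors; only real multilinearity is meant).
\<close>

type_synonym point = "(complex^2) \<times> (real^2) \<times> (real^2) \<times> real"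

definition crdZ :: "2 \<Rightarrow> point \<Rightarrow> complex" where
  "crdZ i p = fst p $ i"

definition crd\<zeta> :: "2 \<Rightarrow> point \<Rightarrow> real" where
  "crd\<zeta> i p = fst (snd p) $ i"

definition crd\<zeta>t :: "2 \<Rightarrow> point \<Rightarrow> real" where
  "crd\<zeta>t i p = fst (snd (snd p)) $ i"

definition crd\<sigma> :: "point \<Rightarrow> real" where
  "crd\<sigma> p = snd (snd (snd p))"

definition M_cl :: "(complex^2) set" where
  "M_cl = {Z. Z $ 0 \<noteq> 0 \<and> Im (Z $ 1 / Z $ 0) > 0}"


subsection \<open>Multilinear algebra\<close>

text \<open>Conventions: \<open>\<alpha>\<beta> = (\<alpha> \<otimes> \<beta> + \<beta> \<otimes> \<alpha>)/2\<close>, so that \<open>\<alpha>\<^sup>2 = \<alpha> \<otimes> \<alpha>\<close>, and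
  \<open>\<alpha> \<and> \<beta> = \<alpha> \<otimes> \<beta> - \<beta> \<otimes> \<alpha>\<close>.\<close>

definition sym_prod :: "('v \<Rightarrow> complex) \<Rightarrow> ('v \<Rightarrow> complex) \<Rightarrow> 'v \<Rightarrow> 'v \<Rightarrow> complex" where
  "sym_prod \<alpha> \<beta> u v = (\<alpha> u * \<beta> v + \<alpha> v * \<beta> u) / 2"

definition wedge :: "('v \<Rightarrow> complex) \<Rightarrow> ('v \<Rightarrow> complex) \<Rightarrow> 'v \<Rightarrow> 'v \<Rightarrow> complex" where
  "wedge \<alpha> \<beta> u v = \<alpha> u * \<beta> v - \<alpha> v * \<beta> u"

text \<open>\<open>p\<close> positive and \<open>q\<close> negative entries after diagonalisation by a congruence.\<close>

definition has_signature :: "real^'n^'n \<Rightarrow> nat \<Rightarrow> nat \<Rightarrow> bool" where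
  "has_signature A p q \<longleftrightarrow> transpose A = A \<and>
     (\<exists>(P::real^'n^'n) D. invertible P \<and> D = transpose P ** A ** P \<and> (\<forall>i j. i \<noteq> j \<longrightarrow> D $ i $ j = 0) \<and>
        card {i. D $ i $ i > 0} = p \<and> card {i. D $ i $ i < 0} = q)"

text \<open>The metric below is assembled from complex-valued expressions, so being real is part of
  being a positive definite (real) symmetric bilinear form.\<close>

definition positive_definite_form :: "('v::real_vector \<Rightarrow> 'v \<Rightarrow> complex) \<Rightarrow> bool" where
  "positive_definite_form B \<longleftrightarrow>
     bilinear B \<and> (\<forall>u v. B u v = B v u) \<and> (\<forall>u v. B u v \<in> \<real>) \<and> (\<forall>v. v \<noteq> 0 \<longrightarrow> Re (B v v) > 0)"


subsection \<open>Derivatives on \<open>\<complex>\<^sup>2\<close>\<close>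

definition partial :: "2 \<Rightarrow> (complex^2 \<Rightarrow> complex) \<Rightarrow> complex^2 \<Rightarrow> complex" where
  "partial i F Z = deriv (\<lambda>w. F (\<chi> k. if k = i then w else Z $ k)) (Z $ i)"

definition del :: "(complex^2 \<Rightarrow> complex) \<Rightarrow> complex^2 \<Rightarrow> complex^2 \<Rightarrow> complex" where
  "del h Z v = (\<Sum>i\<in>UNIV. (frechet_derivative h (at Z) (axis i 1)
      - \<i> * frechet_derivative h (at Z) (axis i \<i>)) / 2 * v $ i)"

definition delbar :: "(complex^2 \<Rightarrow> complex) \<Rightarrow> complex^2 \<Rightarrow> complex^2 \<Rightarrow> complex" where
  "delbar h Z v = (\<Sum>i\<in>UNIV. (frechet_derivative h (at Z) (axis i 1)
      + \<i> * frechet_derivative h (at Z) (axis i \<i>)) / 2 * cnj (v $ i))"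

definition dc :: "(complex^2 \<Rightarrow> complex) \<Rightarrow> complex^2 \<Rightarrow> complex^2 \<Rightarrow> complex" where
  "dc h Z v = \<i> * (delbar h Z v - del h Z v)"


subsection \<open>Special functions and instanton sums\<close>

text \<open>Modified Bessel function of the second kind, for \<open>x > 0\<close>.\<close>

definition Bessel_K :: "real \<Rightarrow> real \<Rightarrow> real" where
  "Bessel_K \<nu> x = integral {0..} (\<lambda>s. exp (- x * cosh s) * cosh (\<nu> * s))"

definition zeta3 :: real where
  "zeta3 = (\<Sum>n. 1 / real (Suc n) ^ 3)"

definition inst_phase :: "nat \<Rightarrow> int \<Rightarrow> point \<Rightarrow> complex" where
  "inst_phase k q p = exp (- 2 * pi * \<i> * of_nat k * of_int q * of_real (crd\<zeta> 0 p))"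

definition abs_qZ :: "int \<Rightarrow> point \<Rightarrow> real" where
  "abs_qZ q p = cmod (of_int q * crdZ 0 p)"

definition dlog_diff :: "point \<Rightarrow> point \<Rightarrow> complex" where
  "dlog_diff p v = crdZ 0 v / crdZ 0 p - cnj (crdZ 0 v) / cnj (crdZ 0 p)"

definition V_inst :: "int \<Rightarrow> point \<Rightarrow> complex" where
  "V_inst q p = 1 / (2 * pi) *
     (\<Sum>\<^sub>\<infinity>k\<in>{1::nat..}. inst_phase k q p * Bessel_K 0 (2 * pi * real k * abs_qZ q p))"

definition A_inst :: "int \<Rightarrow> point \<Rightarrow> point \<Rightarrow> complex" where
  "A_inst q p v = - 1 / (4 * pi) *
     (\<Sum>\<^sub>\<infinity>k\<in>{1::nat..}. inst_phase k q p * abs_qZ q p *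
        Bessel_K 1 (2 * pi * real k * abs_qZ q p) * dlog_diff p v)"

definition \<eta>_inst :: "int \<Rightarrow> point \<Rightarrow> point \<Rightarrow> complex" where
  "\<eta>_inst q p v = \<i> / (8 * pi\<^sup>2) *
     (\<Sum>\<^sub>\<infinity>k\<in>{1::nat..}. inst_phase k q p / of_nat k * abs_qZ q p *
        Bessel_K 1 (2 * pi * real k * abs_qZ q p) * dlog_diff p v)"


subsection \<open>The instanton corrected q-map metric\<close>

text \<open>
  Data: a prepotential \<open>F\<close>, the integer \<open>c\<chi>\<close> (the number \<open>\<chi>\<close>, whose symbol is
  taken by the vector binder) and the 1-loop constant \<open>c\<close>. The BPS indices
  \<open>\<Omega>(q\<gamma>\<^sup>0) = -\<chi>\<close> for \<open>q \<noteq> 0\<close>, and 0 otherwise, enter as the coefficient \<open>\<chi>\<close> of the sums over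
  \<open>q \<noteq> 0\<close>.
\<close>

definition tau :: "(complex^2 \<Rightarrow> complex) \<Rightarrow> complex^2 \<Rightarrow> complex^2^2" where
  "tau F Z = (\<chi> i j. partial i (partial j F) Z)"

definition Im_tau :: "(complex^2 \<Rightarrow> complex) \<Rightarrow> complex^2 \<Rightarrow> real^2^2" where
  "Im_tau F Z = (\<chi> i j. Im (tau F Z $ i $ j))"

definition T_mat :: "(complex^2 \<Rightarrow> complex) \<Rightarrow> int \<Rightarrow> point \<Rightarrow> complex^2^2" where
  "T_mat F c\<chi> p = (\<chi> i j. - of_real (Im_tau F (fst p) $ i $ j) +
     (if i = 0 \<and> j = 0 then of_int c\<chi> * (\<Sum>\<^sub>\<infinity>q\<in>-{0::int}. (of_int q)\<^sup>2 * V_inst q p) else 0))"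

definition W_form :: "(complex^2 \<Rightarrow> complex) \<Rightarrow> 2 \<Rightarrow> point \<Rightarrow> point \<Rightarrow> complex" where
  "W_form F i p v = of_real (crd\<zeta>t i v) - (\<Sum>j\<in>UNIV. tau F (fst p) $ i $ j * of_real (crd\<zeta> j v))"

definition W_inst :: "int \<Rightarrow> 2 \<Rightarrow> point \<Rightarrow> point \<Rightarrow> complex" where
  "W_inst c\<chi> i p v =
     (if i = 0
      then of_int c\<chi> * (\<Sum>\<^sub>\<infinity>q\<in>-{0::int}.
             of_int q * (A_inst q p v + \<i> * of_int q * V_inst q p * of_real (crd\<zeta> 0 v)))
      else 0)"

definition W_tot :: "(complex^2 \<Rightarrow> complex) \<Rightarrow> int \<Rightarrow> 2 \<Rightarrow> point \<Rightarrow> point \<Rightarrow> complex" where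
  "W_tot F c\<chi> i p v = W_form F i p v + W_inst c\<chi> i p v"

definition g_N :: "(complex^2 \<Rightarrow> complex) \<Rightarrow> int \<Rightarrow> point \<Rightarrow> point \<Rightarrow> point \<Rightarrow> complex" where
  "g_N F c\<chi> p u v = 2 * pi * (\<Sum>i\<in>UNIV. \<Sum>j\<in>UNIV.
       T_mat F c\<chi> p $ i $ j * sym_prod (crdZ i) (\<lambda>w. cnj (crdZ j w)) u v
     + matrix_inv (T_mat F c\<chi> p) $ i $ j *
         sym_prod (W_tot F c\<chi> i p) (\<lambda>w. cnj (W_tot F c\<chi> j p w)) u v)"

definition \<omega>12 :: "(complex^2 \<Rightarrow> complex) \<Rightarrow> int \<Rightarrow> point \<Rightarrow> point \<Rightarrow> point \<Rightarrow> complex" where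
  "\<omega>12 F c\<chi> p u v = 2 * pi * (\<Sum>i\<in>UNIV. wedge (crdZ i) (W_tot F c\<chi> i p) u v)"

definition \<omega>1 :: "(complex^2 \<Rightarrow> complex) \<Rightarrow> int \<Rightarrow> point \<Rightarrow> point \<Rightarrow> point \<Rightarrow> real" where
  "\<omega>1 F c\<chi> p u v = Re (\<omega>12 F c\<chi> p u v)"

definition \<omega>2 :: "(complex^2 \<Rightarrow> complex) \<Rightarrow> int \<Rightarrow> point \<Rightarrow> point \<Rightarrow> point \<Rightarrow> real" where
  "\<omega>2 F c\<chi> p u v = Im (\<omega>12 F c\<chi> p u v)"

text \<open>The real vector field \<open>V = 2\<i>(Z\<^sup>i \<partial>\<^sub>i - cnj Z\<^sup>i \<partial>bar\<^sub>i)\<close> is determined by \<open>dZ\<^sup>i(V) = 2\<i>Z\<^sup>i\<close>; its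
  remaining components vanish.\<close>

definition V_field :: "point \<Rightarrow> point" where
  "V_field p = (\<chi> i. 2 * \<i> * crdZ i p, 0, 0, 0)"

definition r_sq :: "(complex^2 \<Rightarrow> complex) \<Rightarrow> complex^2 \<Rightarrow> complex" where
  "r_sq F Z = - (\<Sum>i\<in>UNIV. \<Sum>j\<in>UNIV. of_real (Im_tau F Z $ i $ j) * Z $ i * cnj (Z $ j))"

definition f_fun :: "(complex^2 \<Rightarrow> complex) \<Rightarrow> int \<Rightarrow> real \<Rightarrow> point \<Rightarrow> complex" where
  "f_fun F c\<chi> c p = 2 * pi * (r_sq F (fst p) - 8 * of_real c
     + of_int c\<chi> * (\<Sum>\<^sub>\<infinity>q\<in>-{0::int}. \<eta>_inst q p (V_field p)))"

definition f3_fun :: "(complex^2 \<Rightarrow> complex) \<Rightarrow> int \<Rightarrow> real \<Rightarrow> point \<Rightarrow> complex" where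
  "f3_fun F c\<chi> c p = f_fun F c\<chi> c p - g_N F c\<chi> p (V_field p) (V_field p) / 2"

definition \<theta>0 :: "(complex^2 \<Rightarrow> complex) \<Rightarrow> int \<Rightarrow> real \<Rightarrow> point \<Rightarrow> point \<Rightarrow> complex" where
  "\<theta>0 F c\<chi> c p v = - frechet_derivative (f_fun F c\<chi> c) (at p) v / 2"

definition \<theta>1 :: "(complex^2 \<Rightarrow> complex) \<Rightarrow> int \<Rightarrow> point \<Rightarrow> point \<Rightarrow> complex" where
  "\<theta>1 F c\<chi> p v = of_real (\<omega>2 F c\<chi> p (V_field p) v) / 2"

definition \<theta>2 :: "(complex^2 \<Rightarrow> complex) \<Rightarrow> int \<Rightarrow> point \<Rightarrow> point \<Rightarrow> complex" where
  "\<theta>2 F c\<chi> p v = - of_real (\<omega>1 F c\<chi> p (V_field p) v) / 2"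

definition \<theta>3 :: "(complex^2 \<Rightarrow> complex) \<Rightarrow> int \<Rightarrow> point \<Rightarrow> point \<Rightarrow> complex" where
  "\<theta>3 F c\<chi> p v =
     of_real (pi * (crd\<sigma> v + (\<Sum>i\<in>UNIV. crd\<zeta>t i p * crd\<zeta> i v - crd\<zeta> i p * crd\<zeta>t i v)))
     + pi / 2 * dc (r_sq F) (fst p) (fst v)
     + 2 * pi * of_int c\<chi> * (\<Sum>\<^sub>\<infinity>q\<in>-{0::int}. \<eta>_inst q p v)"

definition \<eta>_form :: "(complex^2 \<Rightarrow> complex) \<Rightarrow> int \<Rightarrow> point \<Rightarrow> point \<Rightarrow> complex" where
  "\<eta>_form F c\<chi> p v = \<theta>3 F c\<chi> p v - g_N F c\<chi> p (V_field p) v / 2"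

definition ambient_tensor ::
    "(complex^2 \<Rightarrow> complex) \<Rightarrow> int \<Rightarrow> real \<Rightarrow> point \<Rightarrow> point \<Rightarrow> point \<Rightarrow> complex" where
  "ambient_tensor F c\<chi> c p u v =
     - 1 / f_fun F c\<chi> c p *
       (2 / f3_fun F c\<chi> c p * sym_prod (\<eta>_form F c\<chi> p) (\<eta>_form F c\<chi> p) u v
        + g_N F c\<chi> p u v
        - 2 / f_fun F c\<chi> c p *
            (sym_prod (\<theta>0 F c\<chi> c p) (\<theta>0 F c\<chi> c p) u v
             + sym_prod (\<theta>1 F c\<chi> p) (\<theta>1 F c\<chi> p) u v
             + sym_prod (\<theta>2 F c\<chi> p) (\<theta>2 F c\<chi> p) u v
             + sym_prod (\<theta>3 F c\<chi> p) (\<theta>3 F c\<chi> p) u v))"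

definition metric_defined_at ::
    "(complex^2 \<Rightarrow> complex) \<Rightarrow> int \<Rightarrow> real \<Rightarrow> point \<Rightarrow> bool" where
  "metric_defined_at F c\<chi> c p \<longleftrightarrow>
     fst p \<in> M_cl \<and>
     r_sq F (fst p) \<in> \<real> \<and> Re (r_sq F (fst p)) > 0 \<and>
     has_signature (Im_tau F (fst p)) 1 1 \<and>
     det (T_mat F c\<chi> p) \<noteq> 0 \<and>
     f_fun F c\<chi> c p \<noteq> 0 \<and>
     f3_fun F c\<chi> c p \<noteq> 0 \<and>
     g_N F c\<chi> p (V_field p) (V_field p) \<noteq> 0"

text \<open>Coordinates \<open>(\<tau>2, b + \<i>t, \<tau>1, \<zeta>1, \<zeta>t0, \<zeta>t1, \<sigma>)\<close> on the hypersurface \<open>Arg Z\<^sup>0 = 0\<close>, and its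
  inclusion; the restriction of a tensor to the hypersurface is the pullback along it.\<close>

type_synonym hpoint = "real \<times> complex \<times> real \<times> real \<times> real \<times> real \<times> real"

definition incl :: "hpoint \<Rightarrow> point" where
  "incl = (\<lambda>(\<tau>2, z, \<tau>1, \<zeta>1, \<zeta>t0, \<zeta>t1, \<sigma>).
     (\<chi> i. if i = 0 then of_real \<tau>2 else of_real \<tau>2 * z,
      \<chi> i. if i = 0 then \<tau>1 else \<zeta>1,
      \<chi> i. if i = 0 then \<zeta>t0 else \<zeta>t1,
      \<sigma>))"

definition qmap_metric ::
    "(complex^2 \<Rightarrow> complex) \<Rightarrow> int \<Rightarrow> real \<Rightarrow> hpoint \<Rightarrow> hpoint \<Rightarrow> hpoint \<Rightarrow> complex" where
  "qmap_metric F c\<chi> c x u v =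
     ambient_tensor F c\<chi> c (incl x)
       (frechet_derivative incl (at x) u) (frechet_derivative incl (at x) v)"


subsection \<open>The specific data\<close>

definition prepotential :: "int \<Rightarrow> complex^2 \<Rightarrow> complex" where
  "prepotential c\<chi> Z = - (1 / 6) * (Z $ 1) ^ 3 / Z $ 0
     + of_int c\<chi> * ((Z $ 0)\<^sup>2 * of_real zeta3 / (2 * (2 * pi * \<i>) ^ 3))"

definition lattice_sum :: "complex \<Rightarrow> real" where
  "lattice_sum \<tau> = (\<Sum>\<^sub>\<infinity>(m, n)\<in>-{(0::int, 0::int)}. 1 / cmod (of_int m * \<tau> + of_int n) ^ 3)"

definition R1 :: "int \<Rightarrow> real \<Rightarrow> complex \<Rightarrow> real" where
  "R1 c\<chi> t \<tau> = t ^ 3 / 3 - of_int c\<chi> / (4 * (2 * pi) ^ 3) * lattice_sum \<tau>"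

definition R2 :: "int \<Rightarrow> real \<Rightarrow> complex \<Rightarrow> real" where
  "R2 c\<chi> t \<tau> = t ^ 3 / 3 - 3 * of_int c\<chi> / (4 * (2 * pi) ^ 3) * lattice_sum \<tau>
     - (3 * of_int c\<chi>)\<^sup>2 / (4 * pi) ^ 6 * (lattice_sum \<tau>)\<^sup>2 * inverse (R1 c\<chi> t \<tau>)"

definition N_tilde :: "int \<Rightarrow> hpoint set" where
  "N_tilde c\<chi> = {(\<tau>2, z, \<tau>1, \<zeta>1, \<zeta>t0, \<zeta>t1, \<sigma>).
     \<tau>2 > 0 \<and> Im z > 0 \<and>
     R1 c\<chi> (Im z) (Complex \<tau>1 \<tau>2) > 0 \<and> R2 c\<chi> (Im z) (Complex \<tau>1 \<tau>2) > 0}"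

end

theory Submission
  imports Defs
begin

text \<open>
  Poisson summation turns the Bessel sums into the lattice sum \<open>S = \<Sum> |m\<tau> + n|\<^sup>-\<^sup>3\<close>: summing
  \<open>1/((n + x)\<^sup>2 + c\<^sup>2)\<^sup>2\<close> over \<open>n\<close> by partial fractions of the cotangent and integrating over
  \<open>c = a cosh s\<close> expands a row of the lattice into Bessel functions \<open>K\<^sub>1\<close>. This gives
  \<open>f = 4\<pi>\<tau>\<^sub>2\<^sup>2 R\<^sub>1\<close>, and the sums entering \<open>T\<close> and \<open>W\<close> become first derivatives of \<open>S\<close>. These
  derivatives are controlled by monotonicity of \<open>S\<close>, of \<open>\<tau>\<^sub>2\<^sup>3 S\<close> and of \<open>exp(\<plusminus>3\<tau>\<^sub>1/(2\<tau>\<^sub>2)) S\<close>, so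
  that \<open>R\<^sub>1, R\<^sub>2 > 0\<close> force \<open>det T < 0\<close>, \<open>f > 0\<close> and \<open>f\<^sub>3 < 0\<close>. Under these sign conditions the
  metric is positive definite: \<open>g\<^sub>N\<close> has one positive and one negative quaternionic direction, the
  positive one is spanned by \<open>V\<close>, and on it the terms \<open>\<theta>\<^sub>k\<close> and \<open>\<eta>\<close> reverse the sign.
\<close>

subsection \<open>Partial fractions\<close>

text \<open>The constants are tuned so that the pieces reassemble into \<open>S\<close>. With y =
  |Z^0|, the row m = 0 of \<open>S\<close> contributes 2 zeta(3), the zeroth Fourier modes of the
  other rows contribute 2 pi^2 / (3 y^2), and the nonzero modes form a Bessel series. When that
  series is eliminated from \<open>f\<close>, the zeta(3) term cancels the correction in the
  prepotential and the pi^2 term cancels 8 c_l = chi / (24 pi): this is what singles out the 1-loop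
  constant. \<open>S\<close> is never differentiated term by term. Differentiability comes from the
  Bessel series, and bounds on the derivatives come from comparing lattice norms at two values of
  \<tau>. The shear comparison yields y |S_x| \<le> 3/2 S; squaring it produces the coefficient (3
  chi)^2 / (4 pi)^6 in \<open>R2\<close>, and \<open>R1\<close> appears in the denominator because -
  det T / t \<ge> \<open>R1\<close>. Without the condition Arg Z^0 = 0 definiteness fails along one
  line, on which dZ^0 is imaginary. Tangent vectors of the hypersurface at Z^0 > 0 have real dZ^0,
  which excludes this line.\<close>

lemma nonreal_notin_nonpos_Ints: "Im z \<noteq> 0 \<Longrightarrow> z \<notin> \<int>\<^sub>\<le>\<^sub>0"
  by (auto elim!: nonpos_Ints_cases)

lemma sin_pi_nonreal_nonzero: "Im z \<noteq> 0 \<Longrightarrow> sin (of_real pi * z) \<noteq> (0::complex)"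
proof
  assume z: "Im z \<noteq> 0" "sin (of_real pi * z) = 0"
  then obtain n :: int where n: "of_real pi * z = of_real (of_int n * pi)"
    by (auto simp: sin_eq_0)
  have "z = of_real (of_int n)" using n by (simp add: field_simps)
  with z show False by simp
qed

text \<open>Logarithmic derivative of rGamma z * rGamma (1 - z) = sin (pi z) / pi. Working with the
  entire function \<open>rGamma\<close> avoids both poles and branches of a logarithm.\<close>

lemma Digamma_reflection:
  assumes z: "Im z \<noteq> 0"
  shows "Digamma (1 - z) - Digamma z = of_real pi * cot (of_real pi * z)"
proof -
  have z1: "z \<notin> \<int>\<^sub>\<le>\<^sub>0" "1 - z \<notin> \<int>\<^sub>\<le>\<^sub>0"
    using z by (auto intro!: nonreal_notin_nonpos_Ints)
  have "((\<lambda>z. rGamma z * rGamma (1 - z)) has_field_derivative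
      (rGamma z * rGamma (1 - z)) * (Digamma (1 - z) - Digamma z)) (at z)"
    using z1 by (auto intro!: derivative_eq_intros simp: algebra_simps)
  moreover have "((\<lambda>z. sin (of_real pi * z) / of_real pi) has_field_derivative
      cos (of_real pi * z)) (at z)"
    by (auto intro!: derivative_eq_intros)
  ultimately have "(rGamma z * rGamma (1 - z)) * (Digamma (1 - z) - Digamma z) = cos (of_real pi * z)"
    by (simp only: rGamma_reflection_complex) (rule DERIV_unique)
  thus ?thesis
    using sin_pi_nonreal_nonzero[OF z]
    by (simp add: rGamma_reflection_complex cot_def field_simps)
qed

text \<open>The harmonic parts of the two \<open>Digamma\<close> series cancel. Pairing n with -n-1
  makes a single series over the naturals run through z + n for all integers n; every sum over the
  integers below uses the same pairing.\<close>

lemma cot_partial_fractions: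
  assumes z: "Im z \<noteq> 0"
  shows "(\<lambda>n. inverse (z + of_nat n) - inverse (1 - z + of_nat n)) sums (of_real pi * cot (of_real pi * z))"
proof -
  have nz: "z \<noteq> 0" "1 - z \<noteq> 0" using z by (auto simp: complex_eq_iff)
  have "(\<lambda>n. (inverse (of_nat (Suc n)) - inverse (1 - z + of_nat n)) - (inverse (of_nat (Suc n)) - inverse (z + of_nat n)))
      sums (Digamma (1 - z) + euler_mascheroni - (Digamma z + euler_mascheroni))"
    by (intro sums_diff) (use summable_Digamma[OF nz(1)] summable_Digamma[OF nz(2)] in
        \<open>simp_all add: Digamma_def summable_sums\<close>)
  thus ?thesis by (simp add: Digamma_reflection[OF z])
qed

text \<open>No series is differentiated: the closed reflection identity is, and the two values of
  \<open>Polygamma 1\<close> that appear are then expanded.\<close>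

lemma inverse_sin_squared_partial_fractions:
  assumes z: "Im z \<noteq> 0"
  shows "(\<lambda>n. inverse ((z + of_nat n)^2) + inverse ((1 - z + of_nat n)^2)) sums
    (of_real pi ^ 2 / sin (of_real pi * z) ^ 2)"
proof -
  have z1: "z \<notin> \<int>\<^sub>\<le>\<^sub>0" "1 - z \<notin> \<int>\<^sub>\<le>\<^sub>0" "z \<noteq> 0" "1 - z \<noteq> 0"
    using z by (auto intro!: nonreal_notin_nonpos_Ints)
  have "((\<lambda>z. Digamma (1 - z) - Digamma z) has_field_derivative
      (Polygamma 1 (1 - z) * (-1) - Polygamma 1 z)) (at z)"
  proof (rule DERIV_diff)
    have "((\<lambda>z. Digamma z) has_field_derivative Polygamma 1 (1 - z)) (at (1 - z))"
      using has_field_derivative_Polygamma[OF z1(2), of 0] by simp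
    moreover have "((\<lambda>z. 1 - z) has_field_derivative (-1)) (at z)"
      by (auto intro!: derivative_eq_intros)
    ultimately show "((\<lambda>z. Digamma (1 - z)) has_field_derivative (Polygamma 1 (1 - z) * (-1))) (at z)"
      by (rule DERIV_chain2)
    show "(Digamma has_field_derivative Polygamma 1 z) (at z)"
      using has_field_derivative_Polygamma[OF z1(1), of 0] by simp
  qed
  \<comment> \<open>The identity is available off the real axis only, so it must first be known near
    z before both sides can be differentiated.\<close>
  moreover have "\<forall>\<^sub>F w in nhds z. Im w \<noteq> 0"
  proof -
    have "open {w. Im w \<noteq> 0}"
      by (intro open_Collect_neq continuous_intros)
    thus ?thesis using z by (auto simp: eventually_nhds)
  qed
  hence "\<forall>\<^sub>F w in nhds z. Digamma (1 - w) - Digamma w = of_real pi * cot (of_real pi * w)"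
    by eventually_elim (rule Digamma_reflection)
  ultimately have "((\<lambda>w. of_real pi * cot (of_real pi * w)) has_field_derivative
      (Polygamma 1 (1 - z) * (-1) - Polygamma 1 z)) (at z)"
    by (subst (asm) DERIV_cong_ev[OF refl _ refl]) auto
  moreover have "((\<lambda>w. of_real pi * cot (of_real pi * w)) has_field_derivative
      of_real pi * (- inverse (sin (of_real pi * z) ^ 2) * of_real pi)) (at z)"
  proof -
    have "(cot has_field_derivative - inverse (sin (of_real pi * z) ^ 2)) (at (of_real pi * z))"
      by (rule DERIV_cot) (rule sin_pi_nonreal_nonzero[OF z])
    moreover have "((\<lambda>w. of_real pi * w) has_field_derivative of_real pi) (at z)"
      by (auto intro!: derivative_eq_intros)
    ultimately show ?thesis
      by (intro DERIV_cmult) (rule DERIV_chain2)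
  qed
  ultimately have eq: "- Polygamma 1 (1 - z) - Polygamma 1 z =
      of_real pi * (- inverse (sin (of_real pi * z) ^ 2) * of_real pi)"
    using DERIV_unique by fastforce
  have "(\<lambda>n. inverse ((z + of_nat n)^Suc 1) + inverse ((1 - z + of_nat n)^Suc 1)) sums
     ((-1) ^ Suc 1 * Polygamma 1 z / fact 1 + (-1) ^ Suc 1 * Polygamma 1 (1 - z) / fact 1)"
    by (intro sums_add Polygamma_LIMSEQ z1) auto
  also have "((-1) ^ Suc 1 * Polygamma 1 z / fact 1 + (-1) ^ Suc 1 * Polygamma 1 (1 - z) / fact 1)
     = - (- Polygamma 1 (1 - z) - Polygamma 1 z)" by simp
  also have "\<dots> = of_real pi ^ 2 / sin (of_real pi * z) ^ 2"
    unfolding eq by (simp add: power2_eq_square field_simps)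
  finally show ?thesis by (simp add: power2_eq_square)
qed

section \<open>Lorentzian sums over the integers\<close>

lemma Re_complex_of_real_mult: "Re (of_real a * z) = a * Re z"
  by simp

lemma Re_exp_power:
  "Re (exp (- 2 * of_real pi * \<i> * Complex x (- c)) ^ k) = exp (- 2 * pi * c * real k) * cos (2 * pi * real k * x)"
proof -
  have "exp (- 2 * of_real pi * \<i> * Complex x (- c)) ^ k = exp (of_nat k * (- 2 * of_real pi * \<i> * Complex x (- c)))"
    by (rule exp_of_nat_mult[symmetric])
  also have "of_nat k * (- 2 * of_real pi * \<i> * Complex x (- c)) = Complex (- 2 * pi * c * real k) (- 2 * pi * real k * x)"
    by (simp add: complex_eq_iff)
  finally show ?thesis by (simp add: Re_exp)
qed

text \<open>Both formulas are read off at z = x - ic: the imaginary part of 1/(z + n) is c / ((x +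
  n)^2 + c^2). In the lower half plane Q = exp(-2 pi i z) has modulus exp(-2 pi c) < 1, so the
  cotangent and the inverse squared sine become power series in Q, a geometric one and its
  derivative.\<close>

lemma lorentzian_sum:
  assumes c: "(c::real) > 0"
  shows "(\<lambda>n. 1 / ((x + real n)^2 + c^2) + 1 / ((real n + 1 - x)^2 + c^2)) sums
    (pi / c * (1 + 2 * (\<Sum>k. exp (- 2 * pi * c * real (Suc k)) * cos (2 * pi * real (Suc k) * x))))"
    (is "_ sums (pi / c * (1 + 2 * suminf ?g))")
    and "(\<lambda>n. Re (inverse ((Complex x (- c) + of_nat n)^2)) + Re (inverse ((1 - Complex x (- c) + of_nat n)^2))) sums
    (- 4 * pi^2 * (\<Sum>k. real (Suc k) * exp (- 2 * pi * c * real (Suc k)) * cos (2 * pi * real (Suc k) * x)))"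
    (is "_ sums (- 4 * pi^2 * suminf ?h)")
    and "summable (\<lambda>k. exp (- 2 * pi * c * real (Suc k)) * cos (2 * pi * real (Suc k) * x))"
    and "summable (\<lambda>k. real (Suc k) * exp (- 2 * pi * c * real (Suc k)) * cos (2 * pi * real (Suc k) * x))"
proof -
  define z where "z = Complex x (- c)"
  define Q where "Q = exp (- 2 * of_real pi * \<i> * z)"
  have Q1: "norm Q < 1"
    using c by (simp add: Q_def z_def)
  hence Qne: "Q \<noteq> 1" by auto
  have z: "Im z \<noteq> 0" using c by (simp add: z_def)
  have g: "?g sums Re (Q / (1 - Q))"
  proof -
    have "(\<lambda>k. Q * Q ^ k) sums (Q * (1 / (1 - Q)))"
      by (intro sums_mult geometric_sums Q1)
    from sums_Re[OF this] have "(\<lambda>k. Re (Q ^ Suc k)) sums Re (Q / (1 - Q))" by simp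
    thus ?thesis unfolding Q_def z_def Re_exp_power .
  qed
  have h: "?h sums Re (Q / (1 - Q)^2)"
  proof -
    have "(\<lambda>k. Q * (of_nat (Suc k) * Q ^ k)) sums (Q * (1 / (1 - Q)^2))"
      by (intro sums_mult geometric_deriv_sums Q1)
    from sums_Re[OF this] have "(\<lambda>k. Re (of_nat (Suc k) * Q ^ Suc k)) sums Re (Q / (1 - Q)^2)"
      by (simp add: algebra_simps del: of_nat_Suc)
    also have "(\<lambda>k. Re (of_nat (Suc k) * Q ^ Suc k)) = (\<lambda>k. real (Suc k) * Re (Q ^ Suc k))"
      by (rule ext) (simp del: of_nat_Suc power_Suc)
    finally show ?thesis unfolding Q_def z_def Re_exp_power by (simp add: mult.assoc del: of_nat_Suc)
  qed
  show "summable ?g" "summable ?h" using g h by (auto simp: sums_iff)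
  define R where "R = exp (\<i> * (of_real pi * z))"
  have Rnz: "R \<noteq> 0" by (simp add: R_def)
  have QR: "Q = inverse (R ^ 2)"
    unfolding Q_def R_def by (simp add: exp_minus[symmetric] exp_double[symmetric] mult_ac)
  have R2: "R ^ 2 \<noteq> 1" using Qne QR by auto
  have sinR: "sin (of_real pi * z) = (R - inverse R) / (2 * \<i>)"
    unfolding sin_exp_eq R_def by (simp add: exp_minus)
  have cosR: "cos (of_real pi * z) = (R + inverse R) / 2"
    unfolding cos_exp_eq R_def by (simp add: exp_minus)
  have RR: "R - inverse R \<noteq> 0" using R2 Rnz by (simp add: field_simps power2_eq_square)
  have R3: "R * R \<noteq> 1" using R2 by (simp add: power2_eq_square)
  have cotQ: "cot (of_real pi * z) = \<i> * (1 + 2 * (Q / (1 - Q)))"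
  proof -
    have "(p / 2) / (q / (2 * \<i>)) = \<i> * (p / q)" for p q :: complex
      by (cases "q = 0") (auto simp: field_simps)
    hence "cot (of_real pi * z) = \<i> * ((R + inverse R) / (R - inverse R))"
      unfolding cot_def sinR cosR .
    also have "(R + inverse R) / (R - inverse R) = (R * R + 1) / (R * R - 1)"
      using Rnz R3 RR by (simp add: divide_simps)
    also have "\<dots> = 1 + 2 * (Q / (1 - Q))"
      unfolding QR using Rnz R3 by (simp add: divide_simps power2_eq_square)
    finally show ?thesis .
  qed
  have sin2: "of_real pi ^ 2 / sin (of_real pi * z) ^ 2 = of_real (-4 * pi^2) * (Q / (1 - Q)^2)"
  proof -
    have "1 / sin (of_real pi * z) ^ 2 = -4 * (1 / (R - inverse R) ^ 2)"
      unfolding sinR by (simp add: power_divide power_mult_distrib)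
    also have "1 / (R - inverse R) ^ 2 = (R * R) / (R * R - 1) ^ 2"
    proof -
      have "R - inverse R = (R * R - 1) / R" using Rnz by (simp add: field_simps)
      thus ?thesis using Rnz by (simp add: power_divide power2_eq_square)
    qed
    also have "\<dots> = Q / (1 - Q) ^ 2"
    proof -
      have "1 - Q = (R * R - 1) / (R * R)" using Rnz unfolding QR by (simp add: field_simps power2_eq_square)
      hence "Q / (1 - Q) ^ 2 = Q * (R * R) ^ 2 / (R * R - 1) ^ 2" by (simp add: power_divide)
      also have "Q * (R * R) ^ 2 = R * R" using Rnz unfolding QR by (simp add: field_simps power2_eq_square)
      finally show ?thesis by simp
    qed
    finally have "of_real pi ^ 2 * (1 / sin (of_real pi * z) ^ 2) = of_real pi ^ 2 * (-4 * (Q / (1 - Q) ^ 2))"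
      by (rule arg_cong)
    thus ?thesis by simp
  qed
  have "(\<lambda>n. Im (inverse (z + of_nat n) - inverse (1 - z + of_nat n))) sums (Im (of_real pi * cot (of_real pi * z)))"
    by (rule sums_Im[OF cot_partial_fractions[OF z]])
  also have "(\<lambda>n. Im (inverse (z + of_nat n) - inverse (1 - z + of_nat n))) =
     (\<lambda>n. c * (1 / ((x + real n)^2 + c^2) + 1 / ((real n + 1 - x)^2 + c^2)))"
  proof (rule ext, goal_cases)
    case (1 n)
    have e: "real n + 1 - x = 1 - x + real n" by simp
    show ?case by (simp add: z_def add_divide_distrib e algebra_simps)
  qed
  also have "Im (of_real pi * cot (of_real pi * z)) = pi * (1 + 2 * suminf ?g)"
    unfolding cotQ sums_unique[OF g, symmetric]
    using Re_complex_of_real_mult[of 2 "Q / (1 - Q)"] by simp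
  finally have "(\<lambda>n. 1/c * (c * (1 / ((x + real n)^2 + c^2) + 1 / ((real n + 1 - x)^2 + c^2)))) sums
     (1/c * (pi * (1 + 2 * suminf ?g)))" by (rule sums_mult)
  thus "(\<lambda>n. 1 / ((x + real n)^2 + c^2) + 1 / ((real n + 1 - x)^2 + c^2)) sums
     (pi / c * (1 + 2 * suminf ?g))" using c by simp
  have "(\<lambda>n. Re (inverse ((z + of_nat n)^2) + inverse ((1 - z + of_nat n)^2))) sums
    Re (of_real (-4 * pi^2) * (Q / (1 - Q)^2))"
    by (rule sums_Re[OF inverse_sin_squared_partial_fractions[OF z, unfolded sin2]])
  also have "Re (of_real (-4 * pi^2) * (Q / (1 - Q)^2)) = -4 * pi^2 * suminf ?h"
    unfolding sums_unique[OF h, symmetric] by (rule Re_complex_of_real_mult)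
  finally show "(\<lambda>n. Re (inverse ((Complex x (- c) + of_nat n)^2)) + Re (inverse ((1 - Complex x (- c) + of_nat n)^2))) sums
    (- 4 * pi^2 * suminf ?h)" by (simp add: z_def)
qed

text \<open>This combination of the two sums in \<open>lorentzian_sum\<close> yields squared
  Lorentzians without differentiating a series in c.\<close>

lemma Re_inverse_square:
  assumes "c > 0"
  shows "1 / (u^2 + c^2) - Re (inverse ((Complex u c)^2)) = 2 * c^2 * (1 / (u^2 + c^2)^2)"
proof -
  have pos: "u^2 + c^2 > 0" using assms by (simp add: add_nonneg_pos)
  have "Re (inverse ((Complex u c)^2)) = (u^2 - c\<^sup>2) / (u^2 + c^2)^2"
  proof -
    have "(u^2 - c\<^sup>2)^2 + (2 * u * c)^2 = (u^2 + c^2)^2" by (simp add: power2_eq_square algebra_simps)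
    thus ?thesis by (simp add: Re_power2 Im_power2)
  qed
  also have "1 / (u^2 + c^2) - \<dots> = 2 * c^2 * (1 / (u^2 + c^2)^2)"
  proof -
    have "1 / (u^2 + c^2) = (u^2 + c^2) / (u^2 + c^2)^2"
      using pos by (simp add: power2_eq_square)
    thus ?thesis by (simp add: diff_divide_distrib[symmetric])
  qed
  finally show ?thesis .
qed

lemma lorentzian_square_sum:
  assumes c: "(c::real) > 0"
  shows "(\<lambda>n. 1 / ((x + real n)^2 + c^2)^2 + 1 / ((real n + 1 - x)^2 + c^2)^2) sums
    (pi / (2 * c ^ 3) * (1 + 2 * (\<Sum>k. (1 + 2 * pi * c * real (Suc k)) * exp (- 2 * pi * c * real (Suc k)) * cos (2 * pi * real (Suc k) * x))))"
proof -
  let ?e = "\<lambda>k. exp (- 2 * pi * c * real (Suc k)) * cos (2 * pi * real (Suc k) * x)"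
  let ?h = "\<lambda>k. real (Suc k) * exp (- 2 * pi * c * real (Suc k)) * cos (2 * pi * real (Suc k) * x)"
  note L = lorentzian_sum[OF c, of x]
  have "(\<lambda>n. 1 / (2 * c^2) * ((1 / ((x + real n)^2 + c^2) + 1 / ((real n + 1 - x)^2 + c^2)) -
      (Re (inverse ((Complex x (- c) + of_nat n)^2)) + Re (inverse ((1 - Complex x (- c) + of_nat n)^2)))))
     sums (1 / (2 * c^2) * (pi / c * (1 + 2 * suminf ?e) - (- 4 * pi^2 * suminf ?h)))"
    by (intro sums_mult sums_diff L)
  also have "(\<lambda>n. 1 / (2 * c^2) * ((1 / ((x + real n)^2 + c^2) + 1 / ((real n + 1 - x)^2 + c^2)) -
      (Re (inverse ((Complex x (- c) + of_nat n)^2)) + Re (inverse ((1 - Complex x (- c) + of_nat n)^2)))))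
     = (\<lambda>n. 1 / ((x + real n)^2 + c^2)^2 + 1 / ((real n + 1 - x)^2 + c^2)^2)"
  proof (rule ext, goal_cases)
    case (1 n)
    \<comment> \<open>Conjugation leaves the real part unchanged and brings the point into the shape
      \<open>Complex u c\<close> of \<open>Re_inverse_square\<close>; the reflected term already has
      it.\<close>
    have "Re (inverse ((Complex x (- c) + of_nat n)^2)) = Re (cnj (inverse ((Complex x (- c) + of_nat n)^2)))"
      by (rule cnj.simps(1)[symmetric])
    also have "cnj (inverse ((Complex x (- c) + of_nat n)^2)) = inverse ((Complex (x + real n) c)^2)"
    proof -
      have "cnj (Complex x (- c)) + of_nat n = Complex (x + real n) c" by (simp add: complex_eq_iff)
      thus ?thesis by simp
    qed
    finally have a: "Re (inverse ((Complex x (- c) + of_nat n)^2)) = Re (inverse ((Complex (x + real n) c)^2))" .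
    have b: "1 - Complex x (- c) + of_nat n = Complex (real n + 1 - x) c"
      by (simp add: complex_eq_iff)
    have "1 / ((x + real n)^2 + c^2) + 1 / ((real n + 1 - x)^2 + c^2) -
      (Re (inverse ((Complex (x + real n) c)^2)) + Re (inverse ((Complex (real n + 1 - x) c)^2)))
      = 2 * c^2 * (1 / ((x + real n)^2 + c^2)^2 + 1 / ((real n + 1 - x)^2 + c^2)^2)"
      using Re_inverse_square[OF c, of "x + real n"] Re_inverse_square[OF c, of "real n + 1 - x"]
      unfolding distrib_left by linarith
    thus ?case unfolding a b using c by simp
  qed
  also have "1 / (2 * c^2) * (pi / c * (1 + 2 * suminf ?e) - (- 4 * pi^2 * suminf ?h)) =
     pi / (2 * c ^ 3) * (1 + 2 * (suminf ?e + 2 * pi * c * suminf ?h))"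
    using c by (simp add: field_simps power2_eq_square power3_eq_cube)
  also have "suminf ?e + 2 * pi * c * suminf ?h = (\<Sum>k. ?e k + 2 * pi * c * ?h k)"
    using L by (subst suminf_add[symmetric]) (auto intro!: summable_mult simp: suminf_mult)
  also have "(\<lambda>k. ?e k + 2 * pi * c * ?h k) =
      (\<lambda>k. (1 + 2 * pi * c * real (Suc k)) * exp (- 2 * pi * c * real (Suc k)) * cos (2 * pi * real (Suc k) * x))"
    by (simp add: algebra_simps)
  finally show ?thesis .
qed

subsection \<open>Bessel functions\<close>

lemma exp_minus_le_fact_div_power:
  assumes "(u::real) > 0"
  shows "exp (- u) \<le> fact n / u ^ n"
proof -
  have "u ^ n / fact n \<le> exp u"
  proof -
    have "(\<Sum>k\<in>{n}. u ^ k /\<^sub>R fact k) \<le> (\<Sum>k. u ^ k /\<^sub>R fact k)"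
      using assms by (intro sum_le_suminf summable_exp_generic) auto
    thus ?thesis by (simp add: exp_def divide_inverse mult.commute)
  qed
  thus ?thesis using assms by (simp add: exp_minus field_simps)
qed

lemma inverse_cosh_le: "1 / cosh s \<le> 2 * exp (- s :: real)"
proof -
  have "exp s / 2 \<le> cosh s" by (simp add: cosh_def)
  thus ?thesis by (simp add: exp_minus field_simps)
qed

section \<open>Integration over a half line\<close>

lemma set_integral_FTC_Ici:
  fixes f F :: "real \<Rightarrow> real"
  assumes int: "set_integrable lborel {a..} f"
    and F: "\<And>s. s \<ge> a \<Longrightarrow> (F has_real_derivative f s) (at s)"
    and cont: "continuous_on {a..} f"
    and lim: "(F \<longlongrightarrow> T) at_top"
  shows "(LINT s:{a..}|lborel. f s) = T - F a"
proof -
  have *: "((\<lambda>y. \<integral> s. indicator {..y} s *\<^sub>R (indicator {a..} s *\<^sub>R f s) \<partial>lborel) \<longlongrightarrow> (LINT s:{a..}|lborel. f s)) at_top"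
    unfolding set_lebesgue_integral_def
    by (rule tendsto_integral_at_top) (use int in \<open>auto simp: set_integrable_def\<close>)
  have "((\<lambda>y. F y - F a) \<longlongrightarrow> T - F a) at_top" by (intro tendsto_intros lim)
  moreover have "\<forall>\<^sub>F y in at_top. F y - F a = (\<integral> s. indicator {..y} s *\<^sub>R (indicator {a..} s *\<^sub>R f s) \<partial>lborel)"
    using eventually_ge_at_top[of a]
  proof eventually_elim
    case (elim y)
    have "F y - F a = integral\<^sup>L lborel (\<lambda>s. indicator {a..y} s *\<^sub>R f s)"
      using elim
      by (intro integral_FTC_atLeastAtMost[symmetric])
         (auto intro!: has_vector_derivative_at_within F[unfolded has_real_derivative_iff_has_vector_derivative]
            continuous_on_subset[OF cont])
    also have "\<dots> = (\<integral> s. indicator {..y} s *\<^sub>R (indicator {a..} s *\<^sub>R f s) \<partial>lborel)"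
      by (intro Bochner_Integration.integral_cong refl) (auto simp: indicator_def)
    finally show ?case .
  qed
  ultimately have "((\<lambda>y. \<integral> s. indicator {..y} s *\<^sub>R (indicator {a..} s *\<^sub>R f s) \<partial>lborel) \<longlongrightarrow> T - F a) at_top"
    by (elim Lim_transform_eventually)
  with * show ?thesis by (rule tendsto_unique[OF trivial_limit_at_top_linorder])
qed

lemma set_borel_measurable_continuous_Ici:
  fixes f :: "real \<Rightarrow> real"
  shows "continuous_on {a..} f \<Longrightarrow> set_borel_measurable lborel {a..} f"
  unfolding set_borel_measurable_def
  using borel_measurable_continuous_on_indicator[of "{a..}" f] by simp

lemma set_integrable_FTC_Ici_nonneg:
  fixes f F :: "real \<Rightarrow> real"
  assumes F: "\<And>s. s \<ge> a \<Longrightarrow> (F has_real_derivative f s) (at s)"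
    and cont: "continuous_on UNIV f"
    and nonneg: "\<And>s. s \<ge> a \<Longrightarrow> f s \<ge> 0"
    and lim: "(F \<longlongrightarrow> T) at_top"
  shows "set_integrable lborel {a..} f"
proof -
  have m: "f \<in> borel_measurable borel" using cont by (simp add: borel_measurable_continuous_onI)
  have "(\<integral>\<^sup>+s. ennreal (f s) * indicator {a ..} s \<partial>lborel) = T - F a"
    by (rule nn_integral_FTC_atLeast[OF m F nonneg lim])
  hence "(\<integral>\<^sup>+s. ennreal (norm (indicator {a..} s *\<^sub>R f s)) \<partial>lborel) < \<infinity>"
    using nonneg by (subst nn_integral_cong[where v="\<lambda>s. ennreal (f s) * indicator {a ..} s"])
       (auto simp: indicator_def)
  thus ?thesis unfolding set_integrable_def using m
    by (intro integrableI_bounded) auto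
qed

lemma set_integrable_exp_minus: "set_integrable lborel {0..} (\<lambda>s::real. exp (- s))" (is ?th1)
  and set_integral_exp_minus: "(LINT s:{0..}|lborel. exp (- s :: real)) = 1" (is ?th2)
proof -
  have lim: "((\<lambda>s::real. - exp (- s)) \<longlongrightarrow> -0) at_top"
    by (intro tendsto_minus filterlim_compose[OF exp_at_bot] filterlim_uminus_at_bot_at_top)
  have F: "((\<lambda>s::real. - exp (- s)) has_real_derivative exp (- s)) (at s)" for s
    by (auto intro!: derivative_eq_intros)
  show *: ?th1
    by (rule set_integrable_FTC_Ici_nonneg[OF F _ _ lim]) (auto intro!: continuous_intros)
  show ?th2
    by (subst set_integral_FTC_Ici[OF * F _ lim]) (auto intro!: continuous_intros)
qed

lemma set_integrable_bound_exp:
  fixes f :: "real \<Rightarrow> real"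
  assumes "continuous_on {0..} f" and "\<And>s. s \<ge> 0 \<Longrightarrow> \<bar>f s\<bar> \<le> C * exp (- s)"
  shows "set_integrable lborel {0..} f" and "\<bar>LINT s:{0..}|lborel. f s\<bar> \<le> C" (is ?th1)
proof -
  have i: "set_integrable lborel {0..} (\<lambda>s::real. C * exp (- s))"
    by (intro set_integrable_mult_right set_integrable_exp_minus)
  show f: "set_integrable lborel {0..} f"
  proof (rule set_integrable_bound[OF i])
    show "set_borel_measurable lborel {0..} f" by (rule set_borel_measurable_continuous_Ici[OF assms(1)])
    have "norm (f s) \<le> norm (C * exp (- s))" if "s \<in> {0..}" for s
      using assms(2)[of s] that by simp
    thus "AE s in lborel. s \<in> {0..} \<longrightarrow> norm (f s) \<le> norm (C * exp (- s))" by simp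
  qed
  have "\<bar>LINT s:{0..}|lborel. f s\<bar> \<le> (LINT s:{0..}|lborel. norm (f s))"
    using set_integral_norm_bound[OF f] by simp
  also have "\<dots> \<le> (LINT s:{0..}|lborel. C * exp (- s))"
    using assms(2) by (intro set_integral_mono set_integrable_norm f i) auto
  also have "\<dots> = C" by (simp add: set_integral_exp_minus)
  finally show ?th1 .
qed

section \<open>Integral representations and decay of K_0 and K_1\<close>

lemma exp_minus_mult_cosh_le:
  assumes "X > 0"
  shows "exp (- (X * cosh (s::real))) \<le> fact n / X ^ n * (1 / cosh s ^ n)"
  using exp_minus_le_fact_div_power[of "X * cosh s" n] assms cosh_real_pos[of s]
  by (simp add: power_mult_distrib)

lemma inverse_cosh_power_le: "n > 0 \<Longrightarrow> 1 / cosh s ^ n \<le> 2 * exp (- s :: real)"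
proof -
  assume "n > 0"
  hence "1 / cosh s ^ n \<le> 1 / cosh s"
    using cosh_real_ge_1[of s] power_increasing[of 1 n "cosh s"] by (intro divide_left_mono) auto
  thus ?thesis using inverse_cosh_le[of s] by linarith
qed

text \<open>One power of 1/cosh is kept for integrability, with 1/cosh s \<le> 2 exp(-s), whence 48
  = 2 * 4!. The rate X^-4 is chosen for the double series over charges: at X proportional to k q it
  absorbs a weight q^2 and still leaves 1/(q^2 k^2).\<close>

lemma Bessel_integrand_bound:
  assumes "X > 0" and "j < 4"
  shows "\<bar>cosh s ^ j * exp (- X * cosh (s::real))\<bar> \<le> 48 / X ^ 4 * exp (- s)"
proof -
  have c: "cosh s > 0" by simp
  have "\<bar>cosh s ^ j * exp (- X * cosh s)\<bar> = cosh s ^ j * exp (- (X * cosh s))"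
    using c by (simp add: abs_mult)
  also have "\<dots> \<le> cosh s ^ j * (fact 4 / X ^ 4 * (1 / cosh s ^ 4))"
    using exp_minus_mult_cosh_le[OF assms(1), of s 4] c by (intro mult_left_mono) auto
  also have "\<dots> = 24 / X ^ 4 * (cosh s ^ j / cosh s ^ 4)" by (simp add: fact_numeral)
  also have "cosh s ^ j / cosh s ^ 4 = 1 / cosh s ^ (4 - j)"
  proof -
    have "cosh s ^ 4 = cosh s ^ j * cosh s ^ (4 - j)" using assms(2) by (simp flip: power_add)
    thus ?thesis using c by simp
  qed
  also have "24 / X ^ 4 * \<dots> \<le> 24 / X ^ 4 * (2 * exp (- s))"
    using assms by (intro mult_left_mono inverse_cosh_power_le) auto
  finally show ?thesis by simp
qed

lemma Bessel_integrable:
  fixes X :: real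
  assumes "X > 0"
  shows "set_integrable lborel {0..} (\<lambda>s::real. exp (- X * cosh s))" (is ?th1)
    and "set_integrable lborel {0..} (\<lambda>s::real. cosh s * exp (- X * cosh s))" (is ?th2)
proof -
  show ?th1
    by (rule set_integrable_bound_exp(1)[where C="48 / X ^ 4"])
       (use Bessel_integrand_bound[OF assms, of 0] in \<open>auto intro!: continuous_intros\<close>)
  show ?th2
    by (rule set_integrable_bound_exp(1)[where C="48 / X ^ 4"])
       (use Bessel_integrand_bound[OF assms, of 1] in \<open>auto intro!: continuous_intros\<close>)
qed

lemma Bessel_K_0:
  assumes "X > 0"
  shows "Bessel_K 0 X = (LINT s:{0..}|lborel. exp (- X * cosh s))"
  unfolding Bessel_K_def using set_borel_integral_eq_integral(2)[OF Bessel_integrable(1)[OF assms]] by simp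

lemma Bessel_K_1:
  assumes "X > 0"
  shows "Bessel_K 1 X = (LINT s:{0..}|lborel. cosh s * exp (- X * cosh s))"
  unfolding Bessel_K_def using set_borel_integral_eq_integral(2)[OF Bessel_integrable(2)[OF assms]]
  by (simp add: mult.commute)

lemma Bessel_K_0_bounds:
  assumes "X > 0" shows "0 \<le> Bessel_K 0 X" "Bessel_K 0 X \<le> 48 / X ^ 4"
proof -
  show "0 \<le> Bessel_K 0 X" unfolding Bessel_K_0[OF assms] set_lebesgue_integral_def
    by (intro integral_nonneg_AE) auto
  have "\<bar>LINT s:{0..}|lborel. exp (- X * cosh s)\<bar> \<le> 48 / X ^ 4"
    using Bessel_integrand_bound[OF assms, of 0]
    by (intro set_integrable_bound_exp) (auto intro!: continuous_intros)
  thus "Bessel_K 0 X \<le> 48 / X ^ 4" unfolding Bessel_K_0[OF assms] by linarith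
qed

lemma Bessel_K_1_bounds:
  assumes "X > 0" shows "0 \<le> Bessel_K 1 X" "Bessel_K 1 X \<le> 48 / X ^ 4"
proof -
  show "0 \<le> Bessel_K 1 X" unfolding Bessel_K_1[OF assms] set_lebesgue_integral_def
    by (intro integral_nonneg_AE) (auto simp: less_imp_le)
  have "\<bar>LINT s:{0..}|lborel. cosh s * exp (- X * cosh s)\<bar> \<le> 48 / X ^ 4"
    using Bessel_integrand_bound[OF assms, of 1]
    by (intro set_integrable_bound_exp) (auto intro!: continuous_intros)
  thus "Bessel_K 1 X \<le> 48 / X ^ 4" unfolding Bessel_K_1[OF assms] by linarith
qed

text \<open>A second integrand for X K_1(X), obtained by parts. It is the form in which the k-th
  Fourier mode of \<open>lorentzian_square_sum\<close> appears after setting c = a cosh s, and its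
  extra factor 1/cosh^2 leaves room for differentiation in X.\<close>

definition sech2_exp :: "real \<Rightarrow> real \<Rightarrow> real" where
  "sech2_exp X s = (1 + X * cosh s) * exp (- X * cosh s) / (cosh s)^2"

lemma continuous_on_sech2_exp [continuous_intros]: "continuous_on A (sech2_exp X)"
  unfolding sech2_exp_def [abs_def] by (auto intro!: continuous_intros)

lemma sech2_exp_nonneg: "X > 0 \<Longrightarrow> sech2_exp X s \<ge> 0"
  unfolding sech2_exp_def using cosh_real_pos[of s]
  by (intro divide_nonneg_nonneg mult_nonneg_nonneg add_nonneg_nonneg) auto

lemma sech2_exp_bound:
  assumes "X > 0" shows "\<bar>sech2_exp X s\<bar> \<le> (48 / X ^ 4 + X * (48 / X ^ 4)) * exp (- s)"
proof -
  have "\<bar>sech2_exp X s\<bar> = sech2_exp X s" by (rule abs_of_nonneg[OF sech2_exp_nonneg[OF assms]])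
  also have "\<dots> \<le> (1 + X * cosh s) * exp (- X * cosh s)"
  proof -
    have "1 \<le> (cosh s)\<^sup>2" using cosh_real_ge_1[of s] by (simp add: one_le_power)
    moreover have "0 \<le> (1 + X * cosh s) * exp (- X * cosh s)"
      using assms cosh_real_pos[of s] by (intro mult_nonneg_nonneg add_nonneg_nonneg) auto
    ultimately have "(1 + X * cosh s) * exp (- X * cosh s) / (cosh s)^2 \<le> (1 + X * cosh s) * exp (- X * cosh s) / 1"
      by (intro divide_left_mono) auto
    thus ?thesis by (simp add: sech2_exp_def)
  qed
  also have "\<dots> = cosh s ^ 0 * exp (- X * cosh s) + X * (cosh s ^ 1 * exp (- X * cosh s))"
    by (simp add: algebra_simps)
  also have "\<dots> \<le> 48 / X ^ 4 * exp (- s) + X * (48 / X ^ 4 * exp (- s))"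
    using assms by (intro add_mono mult_left_mono abs_le_D1[OF Bessel_integrand_bound]) auto
  also have "\<dots> = (48 / X ^ 4 + X * (48 / X ^ 4)) * exp (- s)"
    by (simp add: distrib_right mult.assoc)
  finally show ?thesis .
qed

lemma sech2_exp_integrable: "X > 0 \<Longrightarrow> set_integrable lborel {0..} (sech2_exp X)"
  by (rule set_integrable_bound_exp(1)[OF continuous_on_sech2_exp sech2_exp_bound])

text \<open>The boundary term of the integration by parts: it vanishes at 0 through tanh and at
  infinity through the exponential, and its derivative is the difference of the two integrands for X
  K_1(X).\<close>

lemma tanh_exp_has_derivative:
  fixes X s :: real
  shows "((\<lambda>s::real. tanh s * exp (- X * cosh s)) has_real_derivative
    sech2_exp X s - X * (cosh s * exp (- X * cosh s))) (at s)"
proof -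
  have ct: "1 - (tanh s)\<^sup>2 = 1 / (cosh s)^2"
  proof -
    have "1 - (tanh s)\<^sup>2 = ((cosh s)^2 - (sinh s)\<^sup>2) / (cosh s)^2"
      by (simp add: tanh_def power_divide diff_divide_distrib)
    thus ?thesis by (simp only: hyperbolic_pythagoras)
  qed
  have st: "tanh s * sinh s = cosh s - 1 / cosh s"
  proof -
    have "cosh s * cosh s - 1 = sinh s * sinh s"
      using hyperbolic_pythagoras[of s] unfolding power2_eq_square by linarith
    hence "tanh s * sinh s = (cosh s * cosh s - 1) / cosh s" by (simp add: tanh_def)
    thus ?thesis by (simp add: diff_divide_distrib)
  qed
  have "((\<lambda>s::real. tanh s * exp (- X * cosh s)) has_real_derivative ((1 - (tanh s)\<^sup>2) * exp (- X * cosh s) + tanh s * (exp (- X * cosh s) * (- X * sinh s)))) (at s)"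
    by (rule derivative_eq_intros refl | simp)+
  also have "(1 - (tanh s)\<^sup>2) * exp (- X * cosh s) + tanh s * (exp (- X * cosh s) * (- X * sinh s))
      = exp (- X * cosh s) * (1 / (cosh s)^2 - X * (tanh s * sinh s))"
    unfolding ct by (simp add: algebra_simps)
  also have "\<dots> = sech2_exp X s - X * (cosh s * exp (- X * cosh s))"
  proof -
    have "E * (1 / c^2 - X * (c - 1 / c)) = (1 + X * c) * E / c^2 - X * (c * E)" if "c \<noteq> 0" for c E :: real
    proof -
      have "X * c * E / c^2 = X * E / c" using that by (simp add: power2_eq_square)
      thus ?thesis by (simp add: algebra_simps add_divide_distrib)
    qed
    thus ?thesis unfolding st sech2_exp_def by simp
  qed
  finally show ?thesis .
qed

lemma mult_Bessel_K_1:
  assumes X: "X > 0"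
  shows "X * Bessel_K 1 X = (LINT s:{0..}|lborel. sech2_exp X s)"
proof -
  let ?F = "\<lambda>s::real. tanh s * exp (- X * cosh s)"
  let ?f = "\<lambda>s. sech2_exp X s - X * (cosh s * exp (- X * cosh s))"
  have int: "set_integrable lborel {0..} ?f"
    by (intro set_integral_diff sech2_exp_integrable X set_integrable_mult_right Bessel_integrable)
  have lim: "(?F \<longlongrightarrow> 1 * 0) at_top"
  proof (intro tendsto_mult tanh_real_at_top filterlim_compose[OF exp_at_bot])
    have "LIM s at_top. X * cosh s :> at_top"
      by (intro filterlim_tendsto_pos_mult_at_top[OF tendsto_const X] cosh_real_at_top)
    thus "LIM s at_top. - X * cosh s :> at_bot"
      by (simp add: filterlim_uminus_at_bot)
  qed
  have "(LINT s:{0..}|lborel. ?f s) = 1 * 0 - ?F 0"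
    by (rule set_integral_FTC_Ici[OF int tanh_exp_has_derivative _ lim]) (intro continuous_intros)
  moreover have "(LINT s:{0..}|lborel. ?f s) = (LINT s:{0..}|lborel. sech2_exp X s) - X * Bessel_K 1 X"
    unfolding Bessel_K_1[OF X]
    using Bessel_integrable(2)[OF X] sech2_exp_integrable[OF X] by (subst set_integral_diff(2)) auto
  ultimately show ?thesis by simp
qed

text \<open>Uniform second-order remainder for differentiating \<open>sech2_exp\<close> in X. The
  first derivative of (1 + u) exp(-u) is -u exp(-u); the second, (u - 1) exp(-u), is at most 3/u in
  modulus, hence at most 6/a for u \<ge> a/2.\<close>

lemma one_plus_exp_taylor:
  fixes a b :: real
  assumes "a > 0" "b \<ge> a / 2"
  shows "\<bar>(1 + b) * exp (- b) - (1 + a) * exp (- a) + a * exp (- a) * (b - a)\<bar> \<le> 6 / a * (b - a)^2"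
proof (cases "b = a")
  case False
  define diff :: "nat \<Rightarrow> real \<Rightarrow> real" where
    "diff m = (if m = 0 then (\<lambda>u. (1 + u) * exp (- u)) else if m = 1 then (\<lambda>u. - u * exp (- u)) else (\<lambda>u. (u - 1) * exp (- u)))" for m
  have D: "DERIV (diff m) t :> diff (Suc m) t" if "m < 2" for m t
    using that unfolding less_2_cases_iff
    by (auto simp: diff_def algebra_simps intro!: derivative_eq_intros)
  have "\<exists>t. (if b < a then b < t \<and> t < a else a < t \<and> t < b) \<and>
     diff 0 b = (\<Sum>m<2. diff m a / fact m * (b - a) ^ m) + diff 2 t / fact 2 * (b - a) ^ 2"
    by (rule Taylor[where a = "min a b" and b = "max a b"]) (use D False in auto)
  then obtain t where t: "if b < a then b < t \<and> t < a else a < t \<and> t < b"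
    and eq: "diff 0 b = (\<Sum>m<2. diff m a / fact m * (b - a) ^ m) + diff 2 t / fact 2 * (b - a) ^ 2" by blast
  from t assms have ta: "t \<ge> a / 2" "t > 0" by (auto split: if_splits)
  have "\<bar>diff 2 t\<bar> \<le> (t + 1) * exp (- t)"
    using ta by (simp add: diff_def abs_mult)
  also have "\<dots> = t * exp (- t) + exp (- t)" by (simp add: algebra_simps)
  also have "\<dots> \<le> t * (fact 2 / t ^ 2) + fact 1 / t ^ 1"
    using ta by (intro add_mono mult_left_mono exp_minus_le_fact_div_power) auto
  also have "\<dots> = 3 / t" using ta by (simp add: power2_eq_square add_divide_distrib[symmetric])
  also have "\<dots> \<le> 3 / (a / 2)" using ta assms by (intro divide_left_mono) auto
  finally have d2: "\<bar>diff 2 t\<bar> \<le> 6 / a" by simp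
  have "(1 + b) * exp (- b) - (1 + a) * exp (- a) + a * exp (- a) * (b - a) = diff 2 t / 2 * (b - a)^2"
    using eq by (simp add: diff_def numeral_2_eq_2)
  also have "\<bar>\<dots>\<bar> = \<bar>diff 2 t\<bar> / 2 * (b - a)^2" by (simp add: abs_mult)
  also have "\<dots> \<le> 6 / a * (b - a)^2"
    using d2 by (intro mult_right_mono) auto
  finally show ?thesis .
qed (use assms in simp)

text \<open>Differentiation under the integral with an explicit remainder. The Taylor estimate at a
  = X cosh s, b = (X + h) cosh s costs 6/X * h^2 * cosh s; dividing by cosh^2 leaves one integrable
  factor 1/cosh s, so the remainder of the integral is at most 12/X * h^2.\<close>

lemma mult_Bessel_K_1_has_derivative:
  assumes X: "X > 0"
  shows "((\<lambda>X. X * Bessel_K 1 X) has_real_derivative (- X * Bessel_K 0 X)) (at X)"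
proof -
  have bound: "\<bar>(X + h) * Bessel_K 1 (X + h) - X * Bessel_K 1 X + h * (X * Bessel_K 0 X)\<bar> \<le> 12 / X * h^2"
    if h: "\<bar>h\<bar> < X / 2" for h
  proof -
    have Xh: "X + h > 0" using h X by linarith
    let ?g = "\<lambda>s. sech2_exp (X + h) s - sech2_exp X s + h * X * exp (- X * cosh s)"
    have "\<bar>LINT s:{0..}|lborel. ?g s\<bar> \<le> 12 / X * h^2"
    proof (rule set_integrable_bound_exp(2))
      show "continuous_on {0..} ?g" by (intro continuous_intros)
      fix s :: real
      let ?c = "cosh s"
      have c: "?c > 0" by simp
      have eq: "?g s = ((1 + (X + h) * ?c) * exp (- ((X + h) * ?c)) - (1 + X * ?c) * exp (- (X * ?c)) +
          (X * ?c) * exp (- (X * ?c)) * ((X + h) * ?c - X * ?c)) / ?c^2"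
        using c by (simp add: sech2_exp_def add_divide_distrib diff_divide_distrib) (simp add: power2_eq_square algebra_simps)
      \<comment> \<open>From |h| < X/2: this is the condition b \<ge> a/2 of the Taylor
        estimate.\<close>
      have "h * cosh s \<ge> - (X / 2) * cosh s"
        using h c by (intro mult_right_mono) auto
      hence "\<bar>?g s\<bar> \<le> (6 / (X * ?c) * ((X + h) * ?c - X * ?c)^2) / ?c^2"
        unfolding eq abs_divide using X h c
        by (simp only: abs_power2, intro divide_right_mono one_plus_exp_taylor)
           (auto simp: algebra_simps)
      also have "(X + h) * ?c - X * ?c = h * ?c" by (simp add: algebra_simps)
      also have "(6 / (X * ?c) * (h * ?c)^2) / ?c^2 = 6 / X * h^2 * (1 / ?c)"
        using c by (simp add: power_mult_distrib)
      also have "\<dots> \<le> 6 / X * h^2 * (2 * exp (- s))"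
        using X by (intro mult_left_mono inverse_cosh_le) auto
      finally show "\<bar>?g s\<bar> \<le> 12 / X * h^2 * exp (- s)" by simp
    qed
    also have "(LINT s:{0..}|lborel. ?g s) = (X + h) * Bessel_K 1 (X + h) - X * Bessel_K 1 X + h * (X * Bessel_K 0 X)"
      unfolding mult_Bessel_K_1[OF Xh] mult_Bessel_K_1[OF X] Bessel_K_0[OF X]
      using sech2_exp_integrable[OF X] sech2_exp_integrable[OF Xh] Bessel_integrable(1)[OF X]
      by (subst set_integral_add(2) set_integral_diff(2) | auto intro!: set_integral_diff(1) simp: mult.assoc)+
    finally show ?thesis .
  qed
  have "(\<lambda>h. ((X + h) * Bessel_K 1 (X + h) - X * Bessel_K 1 X) / h - (- X * Bessel_K 0 X)) \<midarrow>0\<rightarrow> 0"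
  proof (rule Lim_null_comparison)
    have "\<forall>\<^sub>F h in at 0. h \<noteq> 0 \<and> \<bar>h\<bar> < X / 2"
      using X by (auto simp: eventually_at intro!: exI[of _ "X / 2"])
    thus "\<forall>\<^sub>F h in at 0. norm (((X + h) * Bessel_K 1 (X + h) - X * Bessel_K 1 X) / h - (- X * Bessel_K 0 X)) \<le> 12 / X * \<bar>h\<bar>"
    proof eventually_elim
      case (elim h)
      have "((X + h) * Bessel_K 1 (X + h) - X * Bessel_K 1 X) / h - (- X * Bessel_K 0 X)
         = ((X + h) * Bessel_K 1 (X + h) - X * Bessel_K 1 X + h * (X * Bessel_K 0 X)) / h"
        using elim by (simp add: add_divide_distrib diff_divide_distrib)
      hence "norm (((X + h) * Bessel_K 1 (X + h) - X * Bessel_K 1 X) / h - (- X * Bessel_K 0 X)) \<le> 12 / X * h^2 / \<bar>h\<bar>"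
        using bound[of h] elim by (simp only: real_norm_def abs_divide, intro divide_right_mono) auto
      also have "\<dots> = 12 / X * \<bar>h\<bar>"
      proof -
        have "h^2 / \<bar>h\<bar> = \<bar>h\<bar>"
          using elim by (cases "h > 0") (auto simp: power2_eq_square field_simps)
        thus ?thesis by (metis times_divide_eq_right)
      qed
      finally show ?case .
    qed
    show "(\<lambda>h. 12 / X * \<bar>h\<bar>) \<midarrow>0\<rightarrow> 0"
      using X by (auto intro!: tendsto_eq_intros)
  qed
  thus ?thesis unfolding DERIV_def by (rule LIM_zero_cancel)
qed

section \<open>Poisson summation for the inverse cube\<close>

lemma lorentzian_cosh_integral:
  fixes u a :: real
  assumes a: "a > 0"
  defines "A \<equiv> sqrt (u^2 + a^2)"
  shows "set_integrable lborel {0..} (\<lambda>s. a * cosh s / (u^2 + (a * cosh s)^2)^2)" (is "set_integrable _ _ ?f")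
    and "(LINT s:{0..}|lborel. a * cosh s / (u^2 + (a * cosh s)^2)^2) = pi / (4 * A ^ 3)"
proof -
  have A: "A > 0" "A^2 = u^2 + a^2" using a by (auto simp: A_def add_nonneg_pos)
  \<comment> \<open>An antiderivative of 1/(A^2 + y^2)^2. The substitution y = a sinh s turns u^2 +
    (a cosh s)^2 into A^2 + y^2 and a cosh s ds into dy.\<close>
  define H where "H = (\<lambda>y. y / (2 * A^2 * (A^2 + y^2)) + arctan (y / A) / (2 * A ^ 3))"
  have H: "(H has_real_derivative 1 / (A^2 + y^2)^2) (at y)" for y
  proof -
    have p: "A^2 + y^2 > 0" using A(1) by (simp add: add_pos_nonneg)
    have "(H has_real_derivative ((1 * (2 * A^2 * (A^2 + y^2)) - y * (2 * A^2 * (2 * y))) / (2 * A^2 * (A^2 + y^2))^2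
       + inverse (1 + (y / A)^2) * (1 / A) / (2 * A ^ 3))) (at y)"
    proof -
      have "((\<lambda>y. 2 * A^2 * (A^2 + y^2)) has_real_derivative 2 * A^2 * (2 * y)) (at y)"
        by (auto intro!: derivative_eq_intros)
      hence 1: "((\<lambda>y. y / (2 * A^2 * (A^2 + y^2))) has_real_derivative
          (1 * (2 * A^2 * (A^2 + y^2)) - y * (2 * A^2 * (2 * y))) / (2 * A^2 * (A^2 + y^2))^2) (at y)"
        unfolding power2_eq_square[of "2 * A^2 * (A^2 + y^2)"]
        using A(1) p by (intro DERIV_divide DERIV_ident) auto
      have "((\<lambda>y. y / A) has_real_derivative 1 / A) (at y)"
        by (rule DERIV_cdivide[OF DERIV_ident])
      hence "((\<lambda>y. arctan (y / A)) has_real_derivative inverse (1 + (y / A)^2) * (1 / A)) (at y)"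
        by (rule DERIV_chain2[OF DERIV_arctan])
      thus ?thesis unfolding H_def by (intro DERIV_add DERIV_cdivide 1)
    qed
    also have "(1 * (2 * A^2 * (A^2 + y^2)) - y * (2 * A^2 * (2 * y))) / (2 * A^2 * (A^2 + y^2))^2
        = (A^2 - y\<^sup>2) / (2 * A^2 * (A^2 + y^2)^2)"
    proof -
      have e1: "1 * (2 * A^2 * (A^2 + y^2)) - y * (2 * A^2 * (2 * y)) = (2 * A^2) * (A^2 - y\<^sup>2)"
        by (simp add: algebra_simps power2_eq_square)
      have e2: "(2 * A^2 * (A^2 + y^2))^2 = (2 * A^2) * (2 * A^2 * (A^2 + y^2)^2)"
        by (simp add: power2_eq_square)
      have "2 * A^2 \<noteq> 0" using A(1) by simp
      thus ?thesis unfolding e1 e2 by (rule nonzero_mult_divide_mult_cancel_left)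
    qed
    also have "inverse (1 + (y / A)^2) * (1 / A) / (2 * A ^ 3) = (A^2 + y^2) / (2 * A^2 * (A^2 + y^2)^2)"
    proof -
      have e: "1 + (y / A)^2 = (A^2 + y^2) / A^2" using A(1) by (simp add: field_simps)
      show ?thesis unfolding e using A(1) p by (simp add: power2_eq_square power3_eq_cube)
    qed
    also have "(A^2 - y\<^sup>2) / (2 * A^2 * (A^2 + y^2)^2) + (A^2 + y^2) / (2 * A^2 * (A^2 + y^2)^2) = 1 / (A^2 + y^2)^2"
      using A(1) p by (simp add: add_divide_distrib[symmetric])
    finally show ?thesis .
  qed
  have F: "((\<lambda>s. H (a * sinh s)) has_real_derivative ?f s) (at s)" for s
  proof -
    have "((\<lambda>s. a * sinh s) has_real_derivative (a * cosh s)) (at s)"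
      by (auto intro!: derivative_eq_intros)
    from DERIV_chain2[OF H this]
    have "((\<lambda>s. H (a * sinh s)) has_real_derivative 1 / (A^2 + (a * sinh s)^2)^2 * (a * cosh s)) (at s)" .
    also have "A^2 + (a * sinh s)^2 = u^2 + (a * cosh s)^2"
      unfolding A power_mult_distrib cosh_square_eq by (simp add: algebra_simps)
    finally show ?thesis by simp
  qed
  have ylim: "filterlim (\<lambda>s. a * sinh s) at_top at_top"
    by (intro filterlim_tendsto_pos_mult_at_top[OF tendsto_const a] sinh_real_at_top)
  have "(H \<longlongrightarrow> 0 / (2 * A^2) + (pi / 2) / (2 * A ^ 3)) at_top"
  proof -
    have 1: "((\<lambda>y. y / (A^2 + y^2)) \<longlongrightarrow> 0) at_top"
    proof (rule Lim_null_comparison[where g="\<lambda>y. 1 / y"])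
      show "\<forall>\<^sub>F y in at_top. norm (y / (A^2 + y^2)) \<le> 1 / y"
        using eventually_gt_at_top[of 0]
      proof eventually_elim
        case (elim y)
        hence "A^2 + y^2 > 0" by (simp add: add_nonneg_pos)
        thus ?case using elim by (simp add: abs_mult field_simps power2_eq_square)
      qed
      show "((\<lambda>y::real. 1 / y) \<longlongrightarrow> 0) at_top"
        by (intro tendsto_divide_0[OF tendsto_const] filterlim_at_top_imp_at_infinity filterlim_ident)
    qed
    have 2: "((\<lambda>y. arctan (y / A)) \<longlongrightarrow> pi / 2) at_top"
    proof (rule filterlim_compose[OF tendsto_arctan_at_top])
      show "filterlim (\<lambda>y. y / A) at_top at_top"
        using A filterlim_tendsto_pos_mult_at_top[OF tendsto_const, of "1 / A" "\<lambda>y::real. y" at_top]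
        by (simp add: filterlim_ident)
    qed
    have "((\<lambda>y. (y / (A^2 + y^2)) / (2 * A^2) + arctan (y / A) / (2 * A ^ 3)) \<longlongrightarrow> 0 / (2 * A^2) + (pi / 2) / (2 * A ^ 3)) at_top"
      using A(1) by (intro tendsto_intros 1 2) auto
    thus ?thesis unfolding H_def by (simp add: mult.commute)
  qed
  hence lim: "((\<lambda>s. H (a * sinh s)) \<longlongrightarrow> pi / (4 * A ^ 3)) at_top"
    using filterlim_compose[OF _ ylim] by fastforce
  have nz: "u^2 + (a * cosh s)^2 \<noteq> 0" for s
    using a by (simp add: sum_power2_eq_zero_iff)
  have cont: "continuous_on UNIV ?f"
    using nz by (intro continuous_intros) auto
  show i: "set_integrable lborel {0..} ?f"
    by (rule set_integrable_FTC_Ici_nonneg[OF F cont _ lim]) (use a in auto)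
  show "(LINT s:{0..}|lborel. ?f s) = pi / (4 * A ^ 3)"
    using set_integral_FTC_Ici[OF i F continuous_on_subset[OF cont] lim] by (simp add: H_def)
qed

lemma sech2_integral:
  "set_integrable lborel {0..} (\<lambda>s::real. 1 / (cosh s)^2)" (is ?th1)
  "(LINT s:{0..}|lborel. 1 / (cosh s :: real)^2) = 1" (is ?th2)
proof -
  have F: "(tanh has_real_derivative 1 / (cosh s)^2) (at s)" for s :: real
  proof -
    have "1 - (tanh s)\<^sup>2 = ((cosh s)^2 - (sinh s)\<^sup>2) / (cosh s)^2"
      by (simp add: tanh_def power_divide diff_divide_distrib)
    hence "1 - (tanh s)\<^sup>2 = 1 / (cosh s)^2" by (simp only: hyperbolic_pythagoras)
    moreover have "(tanh has_real_derivative 1 - (tanh s)\<^sup>2) (at s)"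
      by (auto intro!: derivative_eq_intros)
    ultimately show ?thesis by simp
  qed
  have cont: "continuous_on UNIV (\<lambda>s::real. 1 / (cosh s)^2)"
    by (intro continuous_intros) auto
  show i: ?th1
    by (rule set_integrable_FTC_Ici_nonneg[OF F cont _ tanh_real_at_top]) auto
  show ?th2
    using set_integral_FTC_Ici[OF i F continuous_on_subset[OF cont] tanh_real_at_top] by simp
qed

lemma one_plus_mult_exp_minus_le: "u > 0 \<Longrightarrow> (1 + u) * exp (- u) \<le> 8 / (u::real)^2"
proof -
  assume u: "u > 0"
  have "(1 + u) * exp (- u) = exp (- u) + u * exp (- u)" by (simp add: algebra_simps)
  also have "\<dots> \<le> fact 2 / u ^ 2 + u * (fact 3 / u ^ 3)"
    using u by (intro add_mono mult_left_mono exp_minus_le_fact_div_power) auto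
  also have "u * (fact 3 / u ^ 3) = 6 / u^2"
    using u by (simp add: power2_eq_square power3_eq_cube fact_numeral)
  finally show ?thesis by (simp add: add_divide_distrib[symmetric])
qed

lemma sech2_exp_le:
  assumes "X > 0" shows "sech2_exp X s \<le> 8 / X^2"
proof -
  have c: "cosh s \<ge> 1" by (rule cosh_real_ge_1)
  have u: "X * cosh s \<ge> X" "X * cosh s > 0" using c assms by auto
  have "sech2_exp X s \<le> (1 + X * cosh s) * exp (- (X * cosh s)) / 1"
    unfolding sech2_exp_def mult_minus_left
    using u c by (intro divide_left_mono) (auto simp: one_le_power)
  also have "\<dots> \<le> 8 / (X * cosh s)^2" using one_plus_mult_exp_minus_le[OF u(2)] by simp
  also have "\<dots> \<le> 8 / X^2" using u assms by (intro divide_left_mono power_mono) auto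
  finally show ?thesis .
qed

lemma summable_inverse_Suc_power: "n \<ge> 2 \<Longrightarrow> summable (\<lambda>k. 1 / real (Suc k) ^ n)"
  using inverse_power_summable[of n, where 'a=real] summable_Suc_iff[of "\<lambda>k. inverse (real k ^ n)"]
  by (simp add: inverse_eq_divide)

abbreviation bessel_row :: "real \<Rightarrow> real \<Rightarrow> real" where
  "bessel_row a x \<equiv> (\<Sum>k. (2 * pi * a * real (Suc k)) *
     Bessel_K 1 (2 * pi * a * real (Suc k)) * cos (2 * pi * real (Suc k) * x))"

text \<open>Multiply \<open>lorentzian_square_sum\<close> at c = a cosh s by a cosh s and integrate
  over s \<ge> 0. Each Lorentzian gives pi/4 times an inverse cube, the constant mode gives the
  integral of 1/cosh^2, and the mode with index k gives X K_1(X) at X = 2 pi a k.\<close>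

lemma poisson_summation_inverse_cube:
  fixes a x :: real
  assumes a: "a > 0"
  shows "summable (\<lambda>k. (2 * pi * a * real (Suc k)) * Bessel_K 1 (2 * pi * a * real (Suc k)) * cos (2 * pi * real (Suc k) * x))" (is ?th1)
    and "(\<lambda>n. 1 / sqrt ((x + real n)^2 + a^2) ^ 3 + 1 / sqrt ((real n + 1 - x)^2 + a^2) ^ 3) sums
      (2 / a^2 + 4 / a^2 * bessel_row a x)" (is ?th2)
proof -
  define X where "X k = 2 * pi * a * real (Suc k)" for k
  define C where "C k = cos (2 * pi * real (Suc k) * x)" for k
  define \<phi> where "\<phi> k = X k * Bessel_K 1 (X k)" for k
  define r where "r k s = indicator {0..} s *\<^sub>R (sech2_exp (X k) s * C k)" for k s
  have Xpos: "X k > 0" for k using a by (simp add: X_def)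
  have C1: "\<bar>C k\<bar> \<le> 1" for k by (simp add: C_def)
  have \<phi>: "\<phi> k = (LINT s:{0..}|lborel. sech2_exp (X k) s)" for k
    unfolding \<phi>_def by (rule mult_Bessel_K_1[OF Xpos])
  have int_r: "integrable lborel (r k)" for k
  proof -
    have "set_integrable lborel {0..} (\<lambda>s. sech2_exp (X k) s * C k)"
      by (intro set_integrable_mult_left sech2_exp_integrable Xpos)
    thus ?thesis unfolding set_integrable_def r_def[abs_def] .
  qed
  have int_r': "integral\<^sup>L lborel (r k) = \<phi> k * C k" for k
  proof -
    have "(LINT s:{0..}|lborel. sech2_exp (X k) s * C k) = \<phi> k * C k" by (simp add: \<phi>)
    thus ?thesis by (simp only: set_lebesgue_integral_def r_def[abs_def])
  qed
  have "(\<integral>s. norm (r k s) \<partial>lborel) \<le> \<phi> k" for k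
    unfolding \<phi> set_lebesgue_integral_def
  proof (rule integral_mono)
    show "integrable lborel (\<lambda>s. norm (r k s))" using int_r by simp
    show "integrable lborel (\<lambda>s. indicat_real {0..} s *\<^sub>R sech2_exp (X k) s)"
      using sech2_exp_integrable[OF Xpos] by (simp add: set_integrable_def)
    show "norm (r k s) \<le> indicat_real {0..} s *\<^sub>R sech2_exp (X k) s" for s
      using C1[of k] sech2_exp_nonneg[OF Xpos[of k], of s]
      by (auto simp: r_def abs_mult mult_left_le indicator_def)
  qed
  moreover have "\<phi> k \<le> 48 / (2 * pi * a) ^ 3 * (1 / real (Suc k) ^ 3)" for k
  proof -
    have "\<phi> k \<le> X k * (48 / X k ^ 4)"
      unfolding \<phi>_def using Xpos[of k] Bessel_K_1_bounds[OF Xpos[of k]] by (intro mult_left_mono) auto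
    also have "\<dots> = 48 / X k ^ 3" using Xpos[of k] by (simp add: power4_eq_xxxx power3_eq_cube)
    finally show ?thesis by (simp add: X_def power_mult_distrib)
  qed
  ultimately have bnd: "(\<integral>s. norm (r k s) \<partial>lborel) \<le> 48 / (2 * pi * a) ^ 3 * (1 / real (Suc k) ^ 3)" for k
    by (rule order_trans)
  have s3: "summable (\<lambda>k. 1 / real (Suc k) ^ 3)" and s2: "summable (\<lambda>k. 1 / real (Suc k) ^ 2)"
    by (rule summable_inverse_Suc_power; simp)+
  \<comment> \<open>Interchange on the Fourier side: the L^1 norms decay like 1/k^3 by the bound on
    K_1, while pointwise \<open>sech2_exp\<close> only needs the cruder decay 1/k^2.\<close>
  have sum1: "summable (\<lambda>k. \<integral>s. norm (r k s) \<partial>lborel)"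
  proof (rule summable_comparison_test[OF _ summable_mult[OF s3]], intro exI allI impI)
    fix k
    show "norm (\<integral>s. norm (r k s) \<partial>lborel) \<le> 48 / (2 * pi * a) ^ 3 * (1 / real (Suc k) ^ 3)"
      using bnd[of k] by (simp only: real_norm_def abs_of_nonneg Bochner_Integration.integral_nonneg norm_ge_zero abs_ge_zero)
  qed
  have sum2: "summable (\<lambda>k. norm (r k s))" for s
  proof (rule summable_comparison_test[OF _ summable_mult[OF s2]], intro exI allI impI)
    fix k
    have "\<bar>r k s\<bar> \<le> sech2_exp (X k) s"
      using C1[of k] sech2_exp_nonneg[OF Xpos[of k], of s]
      by (auto simp: r_def abs_mult mult_left_le indicator_def)
    also have "\<dots> \<le> 8 / X k ^ 2" by (rule sech2_exp_le[OF Xpos])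
    finally show "norm (norm (r k s)) \<le> 8 / (2 * pi * a) ^ 2 * (1 / real (Suc k) ^ 2)"
      by (simp add: X_def power_mult_distrib)
  qed
  have AE: "AE s in lborel. summable (\<lambda>k. norm (r k s))" using sum2 by simp
  note I = integrable_suminf[OF int_r AE sum1] sums_integral[OF int_r AE sum1, unfolded int_r']
  \<comment> \<open>The pointwise sum of the weighted Lorentzians, written in its Fourier
    form.\<close>
  define R where "R s = indicator {0..} s *\<^sub>R (pi / (2 * a^2) * (1 / (cosh s)^2)) + pi / a^2 * (\<Sum>k. r k s)" for s :: real
  have int0: "integrable lborel (\<lambda>s. indicator {0..} s *\<^sub>R (pi / (2 * a^2) * (1 / (cosh s)^2)) :: real)"
  proof -
    have "set_integrable lborel {0..} (\<lambda>s::real. pi / (2 * a^2) * (1 / (cosh s)^2))"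
      by (intro set_integrable_mult_right sech2_integral)
    thus ?thesis unfolding set_integrable_def .
  qed
  have intR: "integrable lborel R"
    unfolding R_def[abs_def] by (intro Bochner_Integration.integrable_add int0 integrable_mult_right I)
  have int0': "(\<integral>s. indicator {0..} s *\<^sub>R (pi / (2 * a^2) * (1 / (cosh s)^2)) \<partial>lborel) = pi / (2 * a^2)"
  proof -
    have "(LINT s:{0..}|lborel. pi / (2 * a^2) * (1 / (cosh s :: real)^2)) = pi / (2 * a^2)"
      by (subst set_integral_mult_right) (simp only: sech2_integral(2) mult_1_right)
    thus ?thesis unfolding set_lebesgue_integral_def .
  qed
  have intR': "integral\<^sup>L lborel R = pi / (2 * a^2) + pi / a^2 * (\<Sum>k. \<phi> k * C k)"
    unfolding R_def[abs_def] using I int0 int0'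
    by (subst Bochner_Integration.integral_add) (auto simp: sums_iff)
  define L where "L n s = indicator {0..} s *\<^sub>R (a * cosh s / ((x + real n)^2 + (a * cosh s)^2)^2
      + a * cosh s / ((real n + 1 - x)^2 + (a * cosh s)^2)^2)" for n and s :: real
  have L_sums: "(\<lambda>n. L n s) sums R s" for s
  proof (cases "s \<ge> 0")
    case False
    thus ?thesis by (simp add: L_def R_def r_def)
  next
    case True
    have c: "a * cosh s > 0" using a by simp
    have ks: "(1 + 2 * pi * (a * cosh s) * real (Suc k)) * exp (- 2 * pi * (a * cosh s) * real (Suc k)) * cos (2 * pi * real (Suc k) * x)
        = (cosh s)^2 * r k s" for k
      using True by (simp add: r_def sech2_exp_def X_def C_def mult_ac del: of_nat_Suc)
    have "(\<lambda>n. a * cosh s * (1 / ((x + real n)^2 + (a * cosh s)^2)^2 + 1 / ((real n + 1 - x)^2 + (a * cosh s)^2)^2)) sums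
      (a * cosh s * (pi / (2 * (a * cosh s) ^ 3) * (1 + 2 * (\<Sum>k. (cosh s)^2 * r k s))))"
      using lorentzian_square_sum[OF c, of x] unfolding ks by (rule sums_mult)
    also have "(\<Sum>k. (cosh s)^2 * r k s) = (cosh s)^2 * (\<Sum>k. r k s)"
      using sum2[of s] by (intro suminf_mult) (auto intro: summable_norm_cancel)
    also have "a * cosh s * (pi / (2 * (a * cosh s) ^ 3) * (1 + 2 * ((cosh s)^2 * (\<Sum>k. r k s)))) = R s"
      using True a by (simp add: R_def power3_eq_cube power2_eq_square distrib_left add_divide_distrib)
    finally show ?thesis using True by (simp add: L_def distrib_left)
  qed
  have L_nonneg: "L n s \<ge> 0" for n s using a by (auto simp: L_def indicator_def)
  have intL: "integrable lborel (L n)" for n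
    using set_integral_add(1)[OF lorentzian_cosh_integral(1)[OF a, of "x + real n"] lorentzian_cosh_integral(1)[OF a, of "real n + 1 - x"]]
    unfolding set_integrable_def L_def[abs_def] by simp
  have intL': "integral\<^sup>L lborel (L n) = pi / 4 * (1 / sqrt ((x + real n)^2 + a^2) ^ 3 + 1 / sqrt ((real n + 1 - x)^2 + a^2) ^ 3)" for n
  proof -
    have "(LINT s:{0..}|lborel. a * cosh s / ((x + real n)^2 + (a * cosh s)^2)^2
      + a * cosh s / ((real n + 1 - x)^2 + (a * cosh s)^2)^2) =
      pi / 4 * (1 / sqrt ((x + real n)^2 + a^2) ^ 3 + 1 / sqrt ((real n + 1 - x)^2 + a^2) ^ 3)"
      by (subst set_integral_add(2)) (simp_all only: lorentzian_cosh_integral[OF a] distrib_left, simp)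
    thus ?thesis by (simp only: set_lebesgue_integral_def L_def[abs_def])
  qed
  \<comment> \<open>Interchange on the lattice side: all terms are nonnegative, so their limit
    \<open>R\<close>, already known to be integrable, dominates every partial sum.\<close>
  have "(\<lambda>N. \<integral>s. (\<Sum>n<N. L n s) \<partial>lborel) \<longlonglongrightarrow> integral\<^sup>L lborel R"
  proof (rule integral_dominated_convergence[where w = R])
    show "R \<in> borel_measurable lborel" "integrable lborel R" using intR by auto
    show "(\<lambda>s. \<Sum>n<N. L n s) \<in> borel_measurable lborel" for N
      using intL by (intro borel_measurable_sum) auto
    show "AE s in lborel. (\<lambda>N. \<Sum>n<N. L n s) \<longlonglongrightarrow> R s"
      using L_sums by (simp add: sums_def)
    show "AE s in lborel. norm (\<Sum>n<N. L n s) \<le> R s" for N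
    proof (rule AE_I2)
      fix s
      have "norm (\<Sum>n<N. L n s) = (\<Sum>n<N. L n s)" using L_nonneg by (simp add: sum_nonneg)
      also have "\<dots> \<le> suminf (\<lambda>n. L n s)"
        using L_sums L_nonneg by (intro sum_le_suminf) (auto simp: sums_iff)
      finally show "norm (\<Sum>n<N. L n s) \<le> R s" using L_sums[of s] by (simp add: sums_iff)
    qed
  qed
  hence "(\<lambda>n. integral\<^sup>L lborel (L n)) sums (pi / (2 * a^2) + pi / a^2 * (\<Sum>k. \<phi> k * C k))"
    unfolding sums_def intR' using intL by (subst (asm) Bochner_Integration.integral_sum) auto
  hence "(\<lambda>n. 4 / pi * (pi / 4 * (1 / sqrt ((x + real n)^2 + a^2) ^ 3 + 1 / sqrt ((real n + 1 - x)^2 + a^2) ^ 3)))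
      sums (4 / pi * (pi / (2 * a^2) + pi / a^2 * (\<Sum>k. \<phi> k * C k)))"
    unfolding intL' by (rule sums_mult)
  also have "4 / pi * (pi / (2 * a^2) + pi / a^2 * (\<Sum>k. \<phi> k * C k)) = 2 / a^2 + 4 / a^2 * (\<Sum>k. \<phi> k * C k)"
    by (simp add: distrib_left)
  finally show ?th2
    by (simp add: \<phi>_def X_def C_def add_divide_distrib)
  show ?th1
    using I(2) by (simp add: sums_iff \<phi>_def X_def C_def)
qed

subsection \<open>The instanton sums\<close>

text \<open>Weierstrass criterion for unordered sums: an enumeration of the index set transports
  \<open>has_derivative_series\<close>, and the tails of the majorant \<open>B\<close> supply the
  required uniform convergence of the derivatives.\<close>

lemma has_derivative_infsum:
  fixes f :: "'i \<Rightarrow> 'a::real_normed_vector \<Rightarrow> real" and e :: "nat \<Rightarrow> 'i"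
  assumes e: "bij_betw e UNIV I"
    and S: "open S" "convex S" "x0 \<in> S"
    and der: "\<And>i x. i \<in> I \<Longrightarrow> x \<in> S \<Longrightarrow> (f i has_derivative f' i x) (at x)"
    and bound: "\<And>i x h. i \<in> I \<Longrightarrow> x \<in> S \<Longrightarrow> \<bar>f' i x h\<bar> \<le> B i * norm h"
    and B: "B summable_on I"
    and f: "\<And>x. x \<in> S \<Longrightarrow> (\<lambda>i. f i x) summable_on I"
  shows "((\<lambda>x. \<Sum>\<^sub>\<infinity>i\<in>I. f i x) has_derivative (\<lambda>h. \<Sum>\<^sub>\<infinity>i\<in>I. f' i x0 h)) (at x0)"
proof -
  have eI: "e n \<in> I" for n using e by (auto simp: bij_betw_def)
  have tr: "(\<lambda>n. g (e n)) sums (\<Sum>\<^sub>\<infinity>i\<in>I. g i)" if "g summable_on I" for g :: "'i \<Rightarrow> real"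
    using that has_sum_reindex_bij_betw[OF e, of g "infsum g I"]
    by (intro has_sum_imp_sums) auto
  have f'_sum: "(\<lambda>i. f' i x h) summable_on I" if "x \<in> S" for x h
  proof -
    have "(\<lambda>i. B i * norm h) summable_on I" by (intro summable_on_cmult_left B)
    hence "(\<lambda>i. norm (f' i x h)) summable_on I"
      by (rule Infinite_Sum.abs_summable_on_comparison_test') (use bound[OF _ that, of _ h] in simp)
    thus ?thesis by (rule abs_summable_summable)
  qed
  have Bs: "summable (\<lambda>n. B (e n))" using tr[OF B] by (simp add: sums_iff)
  have "\<exists>g. \<forall>x\<in>S. (\<lambda>n. f (e n) x) sums g x \<and> (g has_derivative (\<lambda>h. \<Sum>\<^sub>\<infinity>i\<in>I. f' i x h)) (at x within S)"
  proof (rule has_derivative_series[where f = "\<lambda>n. f (e n)" and f' = "\<lambda>n. f' (e n)" and l = "\<Sum>\<^sub>\<infinity>i\<in>I. f i x0"])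
    show "convex S" "x0 \<in> S" "(\<lambda>n. f (e n) x0) sums (\<Sum>\<^sub>\<infinity>i\<in>I. f i x0)"
      using S tr[OF f[OF S(3)]] by auto
    show "(f (e n) has_derivative f' (e n) x) (at x within S)" if "x \<in> S" for n x
      using der[OF eI that] by (rule has_derivative_at_withinI)
    fix \<epsilon> :: real assume \<epsilon>: "\<epsilon> > 0"
    have "\<forall>\<^sub>F n in sequentially. (\<Sum>i. B (e (i + n))) < \<epsilon>"
      using suminf_exist_split2[OF Bs] \<epsilon> by (rule order_tendstoD(2))
    thus "\<forall>\<^sub>F n in sequentially. \<forall>x\<in>S. \<forall>h. norm ((\<Sum>i<n. f' (e i) x h) - (\<Sum>\<^sub>\<infinity>i\<in>I. f' i x h)) \<le> \<epsilon> * norm h"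
    proof eventually_elim
      case (elim n)
      show ?case
      proof (intro ballI allI)
        fix x h :: 'a assume x: "x \<in> S"
        note s = tr[OF f'_sum[OF x, of h]]
        have sB: "summable (\<lambda>i. B (e (i + n)))" using Bs by (rule summable_ignore_initial_segment)
        have sB': "summable (\<lambda>i. B (e (i + n)) * norm h)" using sB by (rule summable_mult2)
        have le: "\<bar>f' (e (i + n)) x h\<bar> \<le> B (e (i + n)) * norm h" for i by (rule bound[OF eI x])
        have "(\<Sum>\<^sub>\<infinity>i\<in>I. f' i x h) - (\<Sum>i<n. f' (e i) x h) = (\<Sum>i. f' (e (i + n)) x h)"
          using suminf_minus_initial_segment[of "\<lambda>n. f' (e n) x h" n] s by (simp add: sums_iff)
        hence "norm ((\<Sum>i<n. f' (e i) x h) - (\<Sum>\<^sub>\<infinity>i\<in>I. f' i x h)) = norm (\<Sum>i. f' (e (i + n)) x h)"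
          by (metis norm_minus_commute)
        also have "\<dots> \<le> (\<Sum>i. B (e (i + n)) * norm h)"
          by (rule norm_suminf_le[OF _ sB']) (use le in simp)
        also have "\<dots> = (\<Sum>i. B (e (i + n))) * norm h" by (rule suminf_mult2[OF sB, symmetric])
        also have "\<dots> \<le> \<epsilon> * norm h" using elim by (intro mult_right_mono) auto
        finally show "norm ((\<Sum>i<n. f' (e i) x h) - (\<Sum>\<^sub>\<infinity>i\<in>I. f' i x h)) \<le> \<epsilon> * norm h" .
      qed
    qed
  qed
  then obtain g where g: "\<And>x. x \<in> S \<Longrightarrow> (\<lambda>n. f (e n) x) sums g x"
    "\<And>x. x \<in> S \<Longrightarrow> (g has_derivative (\<lambda>h. \<Sum>\<^sub>\<infinity>i\<in>I. f' i x h)) (at x within S)" by blast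
  have eq: "g x = (\<Sum>\<^sub>\<infinity>i\<in>I. f i x)" if "x \<in> S" for x
    using g(1)[OF that] tr[OF f[OF that]] by (rule sums_unique2)
  have "(g has_derivative (\<lambda>h. \<Sum>\<^sub>\<infinity>i\<in>I. f' i x0 h)) (at x0)"
    using g(2)[OF S(3)] by (simp only: at_within_open[OF S(3) S(1)])
  thus ?thesis
    by (rule has_derivative_transform_within_open[OF _ S(1) S(3)]) (rule eq)
qed

section \<open>Double series over pairs of positive integers\<close>

definition pos_pairs :: "(nat \<times> nat) set" where "pos_pairs = {1..} \<times> {1..}"

lemma pos_pairs_enum: "bij_betw (\<lambda>n. map_prod Suc Suc (prod_decode n)) UNIV pos_pairs"
proof -
  have "bij_betw (map_prod Suc Suc) UNIV pos_pairs"
    by (rule bij_betwI[where g = "\<lambda>(a, b). (a - 1, b - 1)"]) (auto simp: pos_pairs_def)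
  from bij_betw_trans[OF bij_prod_decode this] show ?thesis by (simp add: o_def)
qed

lemma has_sum_Suc_iff: "((\<lambda>n. f (Suc n)) has_sum s) UNIV \<longleftrightarrow> (f has_sum s) {1..}"
  by (rule has_sum_reindex_bij_witness[of _ "\<lambda>n. n - 1" Suc]) auto

lemma inverse_square_summable_on: "(\<lambda>n. 1 / (real n)^2) summable_on {1..}"
proof -
  have "((\<lambda>n. 1 / (real (Suc n))^2) has_sum (\<Sum>n. 1 / (real (Suc n))^2)) UNIV"
    using summable_inverse_Suc_power[of 2] by (intro sums_nonneg_imp_has_sum summable_sums) auto
  hence "((\<lambda>n. 1 / (real n)^2) has_sum (\<Sum>n. 1 / (real (Suc n))^2)) {1..}"
    using has_sum_Suc_iff[of "\<lambda>n. 1 / (real n)^2"] by simp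
  thus ?thesis by (rule has_sum_imp_summable)
qed

abbreviation inv_sq :: "nat \<Rightarrow> nat \<Rightarrow> real" where
  "inv_sq q k \<equiv> 1 / (real q)^2 * (1 / (real k)^2)"

lemma inverse_squares_summable_on_pos_pairs:
  "(\<lambda>(q, k). inv_sq q k) summable_on pos_pairs"
  unfolding pos_pairs_def
proof (rule summable_on_SigmaI[where g="\<lambda>q. 1 / (real q)^2 * (\<Sum>\<^sub>\<infinity>k\<in>{1..}. 1 / (real k)^2)"])
  show "((\<lambda>k. case (q, k) of (q, k) \<Rightarrow> inv_sq q k) has_sum
      1 / (real q)^2 * (\<Sum>\<^sub>\<infinity>k\<in>{1..}. 1 / (real k)^2)) {1..}" for q
    unfolding prod.case by (intro has_sum_cmult_right has_sum_infsum inverse_square_summable_on)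
  show "(\<lambda>q. 1 / (real q)^2 * (\<Sum>\<^sub>\<infinity>k\<in>{1..}. 1 / (real k)^2)) summable_on {1..}"
    by (intro summable_on_cmult_left inverse_square_summable_on)
qed auto

lemma summable_on_pos_pairs_bound:
  fixes c :: "nat \<Rightarrow> nat \<Rightarrow> 'a :: banach"
  assumes "\<And>q k. q \<ge> 1 \<Longrightarrow> k \<ge> 1 \<Longrightarrow> norm (c q k) \<le> C * (inv_sq q k)"
  shows "(\<lambda>p. norm (case p of (q, k) \<Rightarrow> c q k)) summable_on pos_pairs" (is ?th1) "(\<lambda>(q, k). c q k) summable_on pos_pairs" (is ?th2)
proof -
  have "(\<lambda>p. C * (case p of (q, k) \<Rightarrow> inv_sq q k)) summable_on pos_pairs"
    by (intro summable_on_cmult_right inverse_squares_summable_on_pos_pairs)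
  thus ?th1
    by (rule Infinite_Sum.abs_summable_on_comparison_test') (use assms in \<open>auto simp: pos_pairs_def\<close>)
  thus ?th2 by (rule abs_summable_summable)
qed

section \<open>The Bessel series and its gradient\<close>

abbreviation freq :: "nat \<Rightarrow> nat \<Rightarrow> real" where
  "freq q k \<equiv> 2 * pi * real k * real q"

abbreviation phase :: "real \<Rightarrow> int \<Rightarrow> nat \<Rightarrow> complex" where
  "phase x q k \<equiv> exp (- 2 * of_real pi * \<i> * of_nat k * of_int q * of_real x)"

abbreviation G_coeff :: "real \<Rightarrow> nat \<Rightarrow> nat \<Rightarrow> real" where
  "G_coeff y q k \<equiv> 1 / (pi * (real k)^2) * (freq q k * y * Bessel_K 1 (freq q k * y))"

text \<open>A common potential for all instanton sums, with x = zeta^0 and y = |Z^0|. Multiplied by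
  8 pi / y^2 it is the part of the lattice sum formed by the nonzero Fourier modes of the rows m
  \<noteq> 0. The two definitions that follow are its partial derivatives: (X K_1)' = -X K_0, and
  the squared frequency cancels 1/k^2 up to the factor 4 pi^2 q^2.\<close>

definition inst_G :: "real \<Rightarrow> real \<Rightarrow> real" where
  "inst_G x y = (\<Sum>\<^sub>\<infinity>(q, k)\<in>pos_pairs. 1 / (pi * (real k)^2) *
     (freq q k * y * Bessel_K 1 (freq q k * y)) * cos (freq q k * x))"

definition inst_Gx :: "real \<Rightarrow> real \<Rightarrow> real" where
  "inst_Gx x y = (\<Sum>\<^sub>\<infinity>(q, k)\<in>pos_pairs. - 4 * pi * (real q)^2 * y *
     Bessel_K 1 (freq q k * y) * sin (freq q k * x))"

definition inst_Gy :: "real \<Rightarrow> real \<Rightarrow> real" where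
  "inst_Gy x y = (\<Sum>\<^sub>\<infinity>(q, k)\<in>pos_pairs. - 4 * pi * (real q)^2 * y *
     Bessel_K 0 (freq q k * y) * cos (freq q k * x))"

text \<open>Stated for all y \<ge> y0 with a bound depending only on y0, so that it can act as a
  majorant on a whole neighbourhood.\<close>

lemma inst_arg_power_bound:
  assumes y: "y0 > 0" "y \<ge> y0" and qk: "q \<ge> 1" "k \<ge> 1"
  shows "(real q)^2 * (48 / (freq q k * y) ^ 4) \<le> 48 / (2 * pi * y0) ^ 4 * (inv_sq q k)"
proof -
  have q: "real q > 0" "real k \<ge> 1" using qk by auto
  have "(real q)^2 * (48 / (freq q k * y) ^ 4) \<le> (real q)\<^sup>2 * (48 / (freq q k * y0) ^ 4)"
    using y q by (intro mult_left_mono divide_left_mono power_mono) auto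
  also have "\<dots> = 48 / (2 * pi * y0) ^ 4 * (1 / (real q)^2 * (1 / (real k) ^ 4))"
    using q by (simp add: power_mult_distrib power4_eq_xxxx power2_eq_square)
  also have "\<dots> \<le> 48 / (2 * pi * y0) ^ 4 * (1 / (real q)^2 * (1 / (real k) ^ 2))"
    using y q by (intro mult_left_mono divide_left_mono power_increasing) auto
  finally show ?thesis .
qed

lemma inst_K_bound:
  assumes y: "y0 > 0" "y \<ge> y0" and qk: "q \<ge> 1" "k \<ge> 1"
  shows "(real q)^2 * Bessel_K 0 (freq q k * y) \<le> 48 / (2 * pi * y0) ^ 4 * (inv_sq q k)" (is ?th1)
    and "(real q)^2 * Bessel_K 1 (freq q k * y) \<le> 48 / (2 * pi * y0) ^ 4 * (inv_sq q k)" (is ?th2)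
    and "0 \<le> Bessel_K 0 (freq q k * y)" "0 \<le> Bessel_K 1 (freq q k * y)"
proof -
  have pos: "freq q k * y > 0" using y qk by auto
  show ?th1
    by (rule order_trans[OF mult_left_mono[OF Bessel_K_0_bounds(2)[OF pos]] inst_arg_power_bound[OF assms]]) simp
  show ?th2
    by (rule order_trans[OF mult_left_mono[OF Bessel_K_1_bounds(2)[OF pos]] inst_arg_power_bound[OF assms]]) simp
  show "0 \<le> Bessel_K 0 (freq q k * y)" "0 \<le> Bessel_K 1 (freq q k * y)"
    using Bessel_K_0_bounds(1)[OF pos] Bessel_K_1_bounds(1)[OF pos] by auto
qed

lemma inst_coeff_abs_summable:
  assumes y: "y > 0"
  shows "(\<lambda>p. norm (case p of (q, k) \<Rightarrow> (real q)\<^sup>2 * Bessel_K 0 (freq q k * y))) summable_on pos_pairs" (is ?th1)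
    and "(\<lambda>p. norm (case p of (q, k) \<Rightarrow> (real q)\<^sup>2 * Bessel_K 1 (freq q k * y))) summable_on pos_pairs" (is ?th2)
    and "(\<lambda>p. norm (case p of (q, k) \<Rightarrow> G_coeff y q k)) summable_on pos_pairs" (is ?th3)
proof -
  show ?th1
    by (rule summable_on_pos_pairs_bound(1)[where C="48 / (2 * pi * y) ^ 4"]) (use inst_K_bound[OF y order_refl] in \<open>auto simp: abs_mult\<close>)
  show ?th2
    by (rule summable_on_pos_pairs_bound(1)[where C="48 / (2 * pi * y) ^ 4"]) (use inst_K_bound[OF y order_refl] in \<open>auto simp: abs_mult\<close>)
  show ?th3
  proof (rule summable_on_pos_pairs_bound(1)[where C="2 * y * (48 / (2 * pi * y) ^ 4)"])
    fix q k :: nat assume qk: "q \<ge> 1" "k \<ge> 1"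
    note K = inst_K_bound[OF y order_refl qk]
    have "norm (G_coeff y q k)
        = 2 * y * (1 / real k) * (real q * Bessel_K 1 (freq q k * y))"
      using y K qk by (simp add: abs_mult power2_eq_square)
    also have "\<dots> \<le> 2 * y * 1 * ((real q)^2 * Bessel_K 1 (freq q k * y))"
      using y K qk by (intro mult_mono) (auto simp: power2_eq_square mult_le_cancel_right1)
    also have "\<dots> \<le> 2 * y * (48 / (2 * pi * y) ^ 4 * (inv_sq q k))"
      using y K by (simp only: mult_1_right, intro mult_left_mono) auto
    finally show "norm (G_coeff y q k) \<le>
       2 * y * (48 / (2 * pi * y) ^ 4) * (inv_sq q k)" by (simp only: mult.assoc)
  qed
qed

lemma summable_on_mult_bounded:
  fixes c :: "'i \<Rightarrow> 'a :: {real_normed_algebra, banach}"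
  assumes "(\<lambda>i. norm (c i)) summable_on I" "\<And>i. i \<in> I \<Longrightarrow> norm (b i) \<le> M"
  shows "(\<lambda>i. c i * b i) summable_on I"
proof -
  have "(\<lambda>i. norm (c i) * M) summable_on I" by (intro summable_on_cmult_left assms)
  hence "(\<lambda>i. norm (c i * b i)) summable_on I"
    by (rule Infinite_Sum.abs_summable_on_comparison_test') (auto intro!: order_trans[OF norm_mult_ineq] mult_left_mono assms(2))
  thus ?thesis by (rule abs_summable_summable)
qed

lemma inst_G_has_derivative:
  assumes y0: "y0 > 0"
  shows "((\<lambda>(x, y). inst_G x y) has_derivative (\<lambda>(dx, dy). inst_Gx x0 y0 * dx + inst_Gy x0 y0 * dy)) (at (x0, y0))"
proof -
  define f where "f = (\<lambda>(q::nat, k::nat) (x::real, y::real). 1 / (pi * (real k)^2) *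
     (freq q k * y * Bessel_K 1 (freq q k * y)) * cos (freq q k * x))"
  define gx where "gx = (\<lambda>(q::nat, k::nat) (x::real, y::real). - 4 * pi * (real q)^2 * y *
     Bessel_K 1 (freq q k * y) * sin (freq q k * x))"
  define gy where "gy = (\<lambda>(q::nat, k::nat) (x::real, y::real). - 4 * pi * (real q)^2 * y *
     Bessel_K 0 (freq q k * y) * cos (freq q k * x))"
  define f' where "f' = (\<lambda>i p h. gx i p * fst h + gy i p * snd h)"
  \<comment> \<open>On this strip one majorant serves for all points: the lower edge controls the
    decay of the Bessel functions and the upper edge the factor y in front of them.\<close>
  define S where "S = (UNIV :: real set) \<times> {y0 / 2 <..< 2 * y0}"
  define C where "C = 8 * pi * y0 * (48 / (2 * pi * (y0 / 2)) ^ 4)"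
  define B where "B = (\<lambda>(q::nat, k::nat). 2 * C * (inv_sq q k))"
  have gbound: "\<bar>gx (q, k) p\<bar> \<le> C * (inv_sq q k) \<and> \<bar>gy (q, k) p\<bar> \<le> C * (inv_sq q k)"
    if p: "p \<in> S" and qk: "q \<ge> 1" "k \<ge> 1" for p q k
  proof -
    obtain x y where xy: "p = (x, y)" by (cases p)
    have y: "y0 / 2 \<le> y" "y \<le> 2 * y0" "y > 0" using p y0 by (auto simp: S_def xy)
    have y02: "y0 / 2 > 0" using y0 by simp
    note K = inst_K_bound[OF y02 y(1) qk]
    have *: "\<bar>- 4 * pi * (real q)^2 * y * K * s\<bar> \<le> C * (inv_sq q k)"
      if "K \<ge> 0" "(real q)^2 * K \<le> 48 / (2 * pi * (y0 / 2)) ^ 4 * (inv_sq q k)" "\<bar>s\<bar> \<le> 1" for K s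
    proof -
      have "\<bar>- 4 * pi * (real q)^2 * y * K * s\<bar> = (4 * pi * y) * ((real q)^2 * K) * \<bar>s\<bar>"
        using y that by (simp add: abs_mult)
      also have "\<dots> \<le> (4 * pi * (2 * y0)) * (48 / (2 * pi * (y0 / 2)) ^ 4 * (inv_sq q k)) * 1"
        by (rule mult_mono[OF mult_mono[OF _ that(2)] that(3)]) (use y that y0 in auto)
      finally show ?thesis by (simp add: C_def mult.assoc)
    qed
    show ?thesis unfolding gx_def gy_def xy prod.case
      by (intro conjI * K) auto
  qed
  have *: "((\<lambda>p. \<Sum>\<^sub>\<infinity>i\<in>pos_pairs. f i p) has_derivative (\<lambda>h. \<Sum>\<^sub>\<infinity>i\<in>pos_pairs. f' i (x0, y0) h)) (at (x0, y0))"
  proof (rule has_derivative_infsum[OF pos_pairs_enum])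
    show "open S" "convex S" "(x0, y0) \<in> S"
      using y0 by (auto simp: S_def intro!: open_Times convex_Times)
    show "B summable_on pos_pairs"
      using summable_on_cmult_right[OF inverse_squares_summable_on_pos_pairs, of "2 * C"]
      by (simp add: B_def case_prod_unfold)
  next
    fix i h and p :: "real \<times> real" assume i: "i \<in> pos_pairs" and p: "p \<in> S"
    obtain q k where qk: "i = (q, k)" "q \<ge> 1" "k \<ge> 1" using i by (auto simp: pos_pairs_def)
    note g = gbound[OF p qk(2,3)]
    have "\<bar>f' i p h\<bar> \<le> \<bar>gx i p\<bar> * \<bar>fst h\<bar> + \<bar>gy i p\<bar> * \<bar>snd h\<bar>"
      unfolding f'_def by (simp add: abs_mult[symmetric])
    also have "\<dots> \<le> (C * (inv_sq q k)) * norm h + (C * (inv_sq q k)) * norm h"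
      using g norm_fst_le[of "fst h" "snd h"] norm_snd_le[of "snd h" "fst h"] qk(1) by (intro add_mono mult_mono) (auto intro: order_trans[OF abs_ge_zero])
    also have "\<dots> = B i * norm h" by (simp add: B_def qk(1) algebra_simps)
    finally show "\<bar>f' i p h\<bar> \<le> B i * norm h" .
  next
    fix i and p :: "real \<times> real" assume i: "i \<in> pos_pairs" and p: "p \<in> S"
    obtain q k where qk: "i = (q, k)" "q \<ge> 1" "k \<ge> 1" using i by (auto simp: pos_pairs_def)
    obtain x y where xy: "p = (x, y)" by (cases p)
    have y: "y > 0" using p y0 by (auto simp: S_def xy)
    define N where "N = freq q k"
    have N: "N > 0" using qk by (simp add: N_def)
    let ?\<phi> = "\<lambda>X. X * Bessel_K 1 X"
    have "(?\<phi> has_derivative (\<lambda>h. - (N * y) * Bessel_K 0 (N * y) * h)) (at (N * snd p))"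
      using mult_Bessel_K_1_has_derivative[OF mult_pos_pos[OF N y]]
      by (simp only: has_field_derivative_def xy snd_conv)
    moreover have "((\<lambda>p. N * snd p) has_derivative (\<lambda>h. N * snd h)) (at p)"
      by (auto intro!: derivative_eq_intros)
    ultimately have 1: "((\<lambda>p. ?\<phi> (N * snd p)) has_derivative (\<lambda>h. - (N * y) * Bessel_K 0 (N * y) * (N * snd h))) (at p)"
      using diff_chain_at[of "\<lambda>p. N * snd p" "\<lambda>h. N * snd h" p ?\<phi>] by (simp add: o_def)
    have 2: "((\<lambda>p. cos (N * fst p)) has_derivative (\<lambda>h. - sin (N * x) * (N * fst h))) (at p)"
      by (auto intro!: derivative_eq_intros simp: xy)
    have "((\<lambda>p. 1 / (pi * (real k)^2) * (?\<phi> (N * snd p) * cos (N * fst p))) has_derivative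
      (\<lambda>h. 1 / (pi * (real k)^2) * (?\<phi> (N * snd p) * (- sin (N * x) * (N * fst h)) + (- (N * y) * Bessel_K 0 (N * y) * (N * snd h)) * cos (N * fst p)))) (at p)"
      by (intro has_derivative_mult_right has_derivative_mult 1 2)
    also have "(\<lambda>h. 1 / (pi * (real k)^2) * (?\<phi> (N * snd p) * (- sin (N * x) * (N * fst h)) + (- (N * y) * Bessel_K 0 (N * y) * (N * snd h)) * cos (N * fst p))) = f' i p"
    proof -
      \<comment> \<open>Both partial derivatives produce N twice, once from the argument of the
        differentiated factor and once from X = N y; this is the cancellation of k.\<close>
      have "1 / (pi * (real k)^2) * (N * N) = 4 * pi * (real q)^2"
        using qk by (simp add: N_def power2_eq_square)
      hence NN: "1 / (pi * (real k)^2) * (N * (N * r)) = 4 * pi * (real q)^2 * r" for r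
        by (metis mult.assoc)
      have e: "1 / (pi * (real k)^2) * (N * y * K1 * (- s * (N * a)) + (- (N * y) * K0 * (N * b)) * c) =
        1 / (pi * (real k)^2) * (N * (N * (- (y * K1 * s * a) - y * K0 * c * b)))" for K1 K0 a b s c
        by (simp add: algebra_simps)
      have "1 / (pi * (real k)^2) * (N * y * K1 * (- s * (N * a)) + (- (N * y) * K0 * (N * b)) * c) =
        - 4 * pi * (real q)^2 * y * K1 * s * a + - 4 * pi * (real q)^2 * y * K0 * c * b" for K1 K0 a b s c
        by (subst e, subst NN) (simp add: algebra_simps)
      thus ?thesis unfolding f'_def gx_def gy_def qk(1) xy prod.case N_def[symmetric] fst_conv snd_conv
        by (intro ext)
    qed
    also have "(\<lambda>p. 1 / (pi * (real k)^2) * (?\<phi> (N * snd p) * cos (N * fst p))) = f i"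
      by (auto simp: f_def qk(1) N_def fun_eq_iff)
    finally show "(f i has_derivative f' i p) (at p)" .
  next
    fix p :: "real \<times> real" assume p: "p \<in> S"
    obtain x y where xy: "p = (x, y)" by (cases p)
    have y: "y > 0" using p y0 by (auto simp: S_def xy)
    have "(\<lambda>i. (case i of (q, k) \<Rightarrow> G_coeff y q k)
        * (case i of (q, k) \<Rightarrow> cos (freq q k * x))) summable_on pos_pairs"
      by (rule summable_on_mult_bounded[OF inst_coeff_abs_summable(3)[OF y], where M=1]) auto
    thus "(\<lambda>i. f i p) summable_on pos_pairs"
      by (simp add: f_def xy case_prod_unfold)
  qed
  have bnd0: "(\<lambda>i. gx i (x0, y0)) summable_on pos_pairs" "(\<lambda>i. gy i (x0, y0)) summable_on pos_pairs"
  proof -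
    have S0: "(x0, y0) \<in> S" using y0 by (auto simp: S_def)
    show "(\<lambda>i. gx i (x0, y0)) summable_on pos_pairs"
      using summable_on_pos_pairs_bound(2)[of "\<lambda>q k. gx (q, k) (x0, y0)" C] gbound[OF S0] by (simp add: case_prod_unfold)
    show "(\<lambda>i. gy i (x0, y0)) summable_on pos_pairs"
      using summable_on_pos_pairs_bound(2)[of "\<lambda>q k. gy (q, k) (x0, y0)" C] gbound[OF S0] by (simp add: case_prod_unfold)
  qed
  have "(\<Sum>\<^sub>\<infinity>i\<in>pos_pairs. f' i (x0, y0) h) = inst_Gx x0 y0 * fst h + inst_Gy x0 y0 * snd h" for h
  proof -
    have "(\<Sum>\<^sub>\<infinity>i\<in>pos_pairs. f' i (x0, y0) h) = (\<Sum>\<^sub>\<infinity>i\<in>pos_pairs. gx i (x0, y0)) * fst h + (\<Sum>\<^sub>\<infinity>i\<in>pos_pairs. gy i (x0, y0)) * snd h"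
      unfolding f'_def by (subst infsum_add) (auto intro!: summable_on_cmult_left bnd0 simp: infsum_cmult_left')
    thus ?thesis by (simp add: gx_def gy_def inst_Gx_def inst_Gy_def case_prod_unfold)
  qed
  moreover have "(\<lambda>p. \<Sum>\<^sub>\<infinity>i\<in>pos_pairs. f i p) = (\<lambda>(x, y). inst_G x y)"
    by (auto simp: f_def inst_G_def fun_eq_iff case_prod_unfold)
  ultimately show ?thesis using * by (simp add: case_prod_unfold)
qed

section \<open>Sums over nonzero charges\<close>

lemma has_sum_int_nonzero:
  fixes f :: "int \<Rightarrow> 'a :: {topological_comm_monoid_add, t2_space}"
  assumes "((\<lambda>n. f (int n)) has_sum a) {1..}" "((\<lambda>n. f (- int n)) has_sum b) {1..}"
  shows "(f has_sum (a + b)) (- {0})"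
proof -
  have "(f has_sum a) (int ` {1..})" "(f has_sum b) ((\<lambda>n. - int n) ` {1..})"
    using assms by (subst has_sum_reindex; auto simp: inj_on_def o_def)+
  hence "(f has_sum (a + b)) (int ` {1..} \<union> (\<lambda>n. - int n) ` {1..})"
    by (rule has_sum_Un_disjoint) auto
  also have "int ` {1..} \<union> (\<lambda>n. - int n) ` {1..} = - {0}"
  proof (intro equalityI subsetI)
    fix z :: int assume "z \<in> - {0}"
    hence "z = int (nat z) \<and> nat z \<ge> 1 \<or> z = - int (nat (- z)) \<and> nat (- z) \<ge> 1" by auto
    thus "z \<in> int ` {1..} \<union> (\<lambda>n. - int n) ` {1..}" by blast
  qed auto
  finally show ?thesis .
qed

lemma has_sum_int_UNIV:
  fixes f :: "int \<Rightarrow> 'a :: {topological_comm_monoid_add, t2_space}"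
  assumes "((\<lambda>n. f (int n)) has_sum a) UNIV" "((\<lambda>n. f (- int n - 1)) has_sum b) UNIV"
  shows "(f has_sum (a + b)) UNIV"
proof -
  have "(f has_sum a) (range int)" "(f has_sum b) (range (\<lambda>n. - int n - 1))"
    using assms by (subst has_sum_reindex; auto simp: inj_on_def o_def)+
  hence "(f has_sum (a + b)) (range int \<union> range (\<lambda>n. - int n - 1))"
    by (rule has_sum_Un_disjoint) auto
  also have "range int \<union> range (\<lambda>n. - int n - 1) = UNIV"
  proof (intro equalityI subsetI)
    fix z :: int
    have "z = int (nat z) \<or> z = - int (nat (- z - 1)) - 1" by auto
    thus "z \<in> range int \<union> range (\<lambda>n. - int n - 1)" by blast
  qed auto
  finally show ?thesis .
qed

lemma has_sum_pos_pairs_iterated: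
  fixes T :: "nat \<Rightarrow> nat \<Rightarrow> 'a :: banach"
  assumes "(\<lambda>(q, k). T q k) summable_on pos_pairs"
  shows "((\<lambda>q. \<Sum>\<^sub>\<infinity>k\<in>{1..}. T q k) has_sum (\<Sum>\<^sub>\<infinity>(q, k)\<in>pos_pairs. T q k)) {1..}"
  using infsum_Sigma'_banach[of T "{1..}" "\<lambda>_. {1..}"] summable_on_Sigma_banach[of T "{1..}" "\<lambda>_. {1..}"] assms
  unfolding pos_pairs_def by (simp add: has_sum_iff)

text \<open>The charges q and -q carry conjugate phases, and \<open>e\<close> is the factor by which
  the coefficient changes under q -> -q. The value 1 leaves twice a cosine, the value -1 leaves -2i
  times a sine.\<close>

lemma inst_phase_has_sum:
  fixes c :: "nat \<Rightarrow> nat \<Rightarrow> real" and x e :: real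
  assumes c: "(\<lambda>p. norm (case p of (q, k) \<Rightarrow> c q k)) summable_on pos_pairs"
  shows "((\<lambda>q::int. \<Sum>\<^sub>\<infinity>k\<in>{1..}. phase x q k *
      of_real ((if q < 0 then e else 1) * c (nat \<bar>q\<bar>) k)) has_sum
    (\<Sum>\<^sub>\<infinity>(q, k)\<in>pos_pairs. of_real (c q k) * (cis (- (freq q k * x)) + of_real e * cis (freq q k * x)))) (- {0})"
proof -
  define T1 where "T1 q k = of_real (c q k) * cis (- (freq q k * x))" for q k
  define T2 where "T2 q k = of_real (c q k) * (of_real e * cis (freq q k * x))" for q k
  have c': "(\<lambda>p. norm (complex_of_real (case p of (q, k) \<Rightarrow> c q k))) summable_on pos_pairs"
    using c by simp
  have s1: "(\<lambda>(q, k). T1 q k) summable_on pos_pairs"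
    using summable_on_mult_bounded[OF c', of "\<lambda>(q, k). cis (- (freq q k * x))" 1]
    by (simp add: T1_def case_prod_unfold)
  have s2: "(\<lambda>(q, k). T2 q k) summable_on pos_pairs"
    using summable_on_mult_bounded[OF c', of "\<lambda>(q, k). of_real e * cis (freq q k * x)" "\<bar>e\<bar>"]
    by (simp add: T2_def case_prod_unfold norm_mult)
  let ?f = "\<lambda>q::int. \<Sum>\<^sub>\<infinity>k\<in>{1..}. phase x q k *
      complex_of_real ((if q < 0 then e else 1) * c (nat \<bar>q\<bar>) k)"
  have "(?f has_sum (\<Sum>\<^sub>\<infinity>(q, k)\<in>pos_pairs. T1 q k) + (\<Sum>\<^sub>\<infinity>(q, k)\<in>pos_pairs. T2 q k)) (- {0})"
  proof (rule has_sum_int_nonzero)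
    have "?f (int q) = (\<Sum>\<^sub>\<infinity>k\<in>{1..}. T1 q k)" for q
    proof (rule infsum_cong)
      fix k
      have "- 2 * of_real pi * \<i> * of_nat k * of_int (int q) * of_real x = \<i> * of_real (- (freq q k * x))"
        by simp
      hence "exp (- 2 * of_real pi * \<i> * of_nat k * of_int (int q) * of_real x) = cis (- (freq q k * x))"
        by (simp only: cis_conv_exp)
      thus "exp (- 2 * of_real pi * \<i> * of_nat k * of_int (int q) * of_real x) *
          complex_of_real ((if int q < 0 then e else 1) * c (nat \<bar>int q\<bar>) k) = T1 q k"
        by (simp add: T1_def mult.commute)
    qed
    thus "((\<lambda>q. ?f (int q)) has_sum (\<Sum>\<^sub>\<infinity>(q, k)\<in>pos_pairs. T1 q k)) {1..}"
      using has_sum_pos_pairs_iterated[OF s1] by simp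
    have "?f (- int q) = (\<Sum>\<^sub>\<infinity>k\<in>{1..}. T2 q k)" if "q \<in> {1..}" for q
    proof (rule infsum_cong)
      fix k
      have "- 2 * of_real pi * \<i> * of_nat k * of_int (- int q) * of_real x = \<i> * of_real (freq q k * x)"
        by simp
      hence "exp (- 2 * of_real pi * \<i> * of_nat k * of_int (- int q) * of_real x) = cis (freq q k * x)"
        by (simp only: cis_conv_exp)
      thus "exp (- 2 * of_real pi * \<i> * of_nat k * of_int (- int q) * of_real x) *
          complex_of_real ((if - int q < 0 then e else 1) * c (nat \<bar>- int q\<bar>) k) = T2 q k"
        using that by (simp add: T2_def mult_ac)
    qed
    thus "((\<lambda>q. ?f (- int q)) has_sum (\<Sum>\<^sub>\<infinity>(q, k)\<in>pos_pairs. T2 q k)) {1..}"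
      using has_sum_pos_pairs_iterated[OF s2] by (subst has_sum_cong) auto
  qed
  also have "(\<Sum>\<^sub>\<infinity>(q, k)\<in>pos_pairs. T1 q k) + (\<Sum>\<^sub>\<infinity>(q, k)\<in>pos_pairs. T2 q k) =
     (\<Sum>\<^sub>\<infinity>p\<in>pos_pairs. (case p of (q, k) \<Rightarrow> T1 q k) + (case p of (q, k) \<Rightarrow> T2 q k))"
    by (rule infsum_add[OF s1 s2, symmetric])
  also have "\<dots> = (\<Sum>\<^sub>\<infinity>(q, k)\<in>pos_pairs. of_real (c q k) * (cis (- (freq q k * x)) + of_real e * cis (freq q k * x)))"
    by (rule infsum_cong) (auto simp: T1_def T2_def algebra_simps)
  finally show ?thesis .
qed

lemma inst_phase_has_sum_even:
  fixes c :: "nat \<Rightarrow> nat \<Rightarrow> real" and x :: real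
  assumes c: "(\<lambda>p. norm (case p of (q, k) \<Rightarrow> c q k)) summable_on pos_pairs"
  shows "((\<lambda>q::int. \<Sum>\<^sub>\<infinity>k\<in>{1..}. phase x q k *
      of_real (c (nat \<bar>q\<bar>) k)) has_sum of_real (2 * (\<Sum>\<^sub>\<infinity>(q, k)\<in>pos_pairs. c q k * cos (freq q k * x)))) (- {0})"
proof -
  have s: "(\<lambda>p. (case p of (q, k) \<Rightarrow> c q k) * (case p of (q, k) \<Rightarrow> 2 * cos (freq q k * x))) summable_on pos_pairs"
    by (rule summable_on_mult_bounded[OF c, where M=2]) (auto simp: abs_mult)
  have "(\<Sum>\<^sub>\<infinity>(q, k)\<in>pos_pairs. complex_of_real (c q k) * (cis (- (freq q k * x)) + of_real 1 * cis (freq q k * x)))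
     = (\<Sum>\<^sub>\<infinity>p\<in>pos_pairs. complex_of_real ((case p of (q, k) \<Rightarrow> c q k) * (case p of (q, k) \<Rightarrow> 2 * cos (freq q k * x))))"
    by (rule infsum_cong) (auto simp: complex_eq_iff)
  also have "\<dots> = of_real (\<Sum>\<^sub>\<infinity>p\<in>pos_pairs. (case p of (q, k) \<Rightarrow> c q k) * (case p of (q, k) \<Rightarrow> 2 * cos (freq q k * x)))"
    using has_sum_of_real[OF has_sum_infsum[OF s]] by (rule infsumI)
  also have "(\<Sum>\<^sub>\<infinity>p\<in>pos_pairs. (case p of (q, k) \<Rightarrow> c q k) * (case p of (q, k) \<Rightarrow> 2 * cos (freq q k * x)))
     = 2 * (\<Sum>\<^sub>\<infinity>(q, k)\<in>pos_pairs. c q k * cos (freq q k * x))"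
    by (subst infsum_cmult_right'[symmetric]) (rule infsum_cong, auto)
  finally show ?thesis using inst_phase_has_sum[OF c, of x 1] by simp
qed

lemma inst_phase_has_sum_odd:
  fixes c :: "nat \<Rightarrow> nat \<Rightarrow> real" and x :: real
  assumes c: "(\<lambda>p. norm (case p of (q, k) \<Rightarrow> c q k)) summable_on pos_pairs"
  shows "((\<lambda>q::int. \<Sum>\<^sub>\<infinity>k\<in>{1..}. phase x q k *
      of_real ((if q < 0 then - 1 else 1) * c (nat \<bar>q\<bar>) k)) has_sum
      - 2 * \<i> * of_real (\<Sum>\<^sub>\<infinity>(q, k)\<in>pos_pairs. c q k * sin (freq q k * x))) (- {0})"
proof -
  have s: "(\<lambda>p. (case p of (q, k) \<Rightarrow> c q k) * (case p of (q, k) \<Rightarrow> sin (freq q k * x))) summable_on pos_pairs"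
    by (rule summable_on_mult_bounded[OF c, where M=1]) auto
  have "(\<Sum>\<^sub>\<infinity>(q, k)\<in>pos_pairs. complex_of_real (c q k) * (cis (- (freq q k * x)) + of_real (- 1) * cis (freq q k * x)))
     = (\<Sum>\<^sub>\<infinity>p\<in>pos_pairs. - 2 * \<i> * complex_of_real ((case p of (q, k) \<Rightarrow> c q k) * (case p of (q, k) \<Rightarrow> sin (freq q k * x))))"
    by (rule infsum_cong) (auto simp: complex_eq_iff)
  also have "\<dots> = - 2 * \<i> * (\<Sum>\<^sub>\<infinity>p\<in>pos_pairs. complex_of_real ((case p of (q, k) \<Rightarrow> c q k) * (case p of (q, k) \<Rightarrow> sin (freq q k * x))))"
    by (rule infsum_cmult_right')
  also have "(\<Sum>\<^sub>\<infinity>p\<in>pos_pairs. complex_of_real ((case p of (q, k) \<Rightarrow> c q k) * (case p of (q, k) \<Rightarrow> sin (freq q k * x)))) =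
      of_real (\<Sum>\<^sub>\<infinity>p\<in>pos_pairs. (case p of (q, k) \<Rightarrow> c q k) * (case p of (q, k) \<Rightarrow> sin (freq q k * x)))"
    using has_sum_of_real[OF has_sum_infsum[OF s]] by (rule infsumI)
  also have "(\<lambda>p. (case p of (q, k) \<Rightarrow> c q k) * (case p of (q, k) \<Rightarrow> sin (freq q k * x))) =
      (\<lambda>(q, k). c q k * sin (freq q k * x))" by auto
  finally show ?thesis using inst_phase_has_sum[OF c, of x "- 1"] by simp
qed

lemma abs_qZ_eq: "abs_qZ q p = real (nat \<bar>q\<bar>) * cmod (crdZ 0 p)"
  by (simp add: abs_qZ_def norm_mult)

text \<open>In this and the next two lemmas the charge sums of V, A and eta turn out to be multiples
  of the y-derivative, the x-derivative and the value of the single function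
  \<open>inst_G\<close>.\<close>

lemma sum_V_inst:
  assumes "crdZ 0 p \<noteq> 0"
  shows "((\<lambda>q. (of_int q)^2 * V_inst q p) has_sum
     of_real (- inst_Gy (crd\<zeta> 0 p) (cmod (crdZ 0 p)) / (4 * pi^2 * cmod (crdZ 0 p)))) (- {0})"
proof -
  define x where "x = crd\<zeta> 0 p"
  define y where "y = cmod (crdZ 0 p)"
  have y: "y > 0" using assms by (simp add: y_def)
  let ?c = "\<lambda>q k. (real q)^2 * Bessel_K 0 (freq q k * y)"
  let ?s = "\<Sum>\<^sub>\<infinity>(q, k)\<in>pos_pairs. ?c q k * cos (freq q k * x)"
  have "inst_Gy x y = (\<Sum>\<^sub>\<infinity>p\<in>pos_pairs. (- 4 * pi * y) * (case p of (q, k) \<Rightarrow> ?c q k * cos (freq q k * x)))"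
    unfolding inst_Gy_def by (rule infsum_cong) (auto simp: mult_ac)
  also have "\<dots> = (- 4 * pi * y) * ?s" by (rule infsum_cmult_right')
  finally have Gy: "inst_Gy x y = - 4 * pi * y * ?s" .
  have "((\<lambda>q::int. of_real (1 / (2 * pi)) * (\<Sum>\<^sub>\<infinity>k\<in>{1..}. phase x q k *
      of_real (?c (nat \<bar>q\<bar>) k))) has_sum of_real (1 / (2 * pi)) * of_real (2 * ?s)) (- {0})"
    by (intro has_sum_cmult_right inst_phase_has_sum_even inst_coeff_abs_summable(1)[OF y])
  also have "(\<lambda>q::int. of_real (1 / (2 * pi)) * (\<Sum>\<^sub>\<infinity>k\<in>{1..}. phase x q k *
      complex_of_real (?c (nat \<bar>q\<bar>) k))) = (\<lambda>q. (of_int q)^2 * V_inst q p)" (is "?l = _")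
  proof (rule ext)
    fix q :: int
    have q2: "complex_of_int q ^ 2 = of_real ((real (nat \<bar>q\<bar>))^2)" by (simp flip: of_int_power of_real_power)
    have "(of_int q)^2 * V_inst q p = of_real (1 / (2 * pi)) * ((of_int q)^2 *
        (\<Sum>\<^sub>\<infinity>k\<in>{1..}. inst_phase k q p * complex_of_real (Bessel_K 0 (2 * pi * real k * abs_qZ q p))))"
      by (simp add: V_inst_def)
    also have "(of_int q)^2 *
        (\<Sum>\<^sub>\<infinity>k\<in>{1..}. inst_phase k q p * complex_of_real (Bessel_K 0 (2 * pi * real k * abs_qZ q p))) =
       (\<Sum>\<^sub>\<infinity>k\<in>{1..}. (of_int q)^2 * (inst_phase k q p * complex_of_real (Bessel_K 0 (2 * pi * real k * abs_qZ q p))))"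
      by (rule infsum_cmult_right'[symmetric])
    also have "\<dots> = (\<Sum>\<^sub>\<infinity>k\<in>{1..}. phase x q k * complex_of_real (?c (nat \<bar>q\<bar>) k))"
      unfolding q2 abs_qZ_eq inst_phase_def x_def y_def by (rule infsum_cong) (simp add: mult_ac)
    finally show "?l q = (of_int q)^2 * V_inst q p" by simp
  qed
  also have "of_real (1 / (2 * pi)) * of_real (2 * ?s) = complex_of_real (- inst_Gy x y / (4 * pi^2 * y))"
    unfolding Gy using y by (simp add: power2_eq_square)
  finally show ?thesis by (simp add: x_def y_def)
qed

lemma sum_A_inst:
  assumes "crdZ 0 p \<noteq> 0"
  shows "((\<lambda>q. of_int q * A_inst q p v) has_sum
     - (\<i> / (8 * pi^2)) * of_real (inst_Gx (crd\<zeta> 0 p) (cmod (crdZ 0 p))) * dlog_diff p v) (- {0})"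
proof -
  define x where "x = crd\<zeta> 0 p"
  define y where "y = cmod (crdZ 0 p)"
  have y: "y > 0" using assms by (simp add: y_def)
  let ?c = "\<lambda>q k. (real q)^2 * Bessel_K 1 (freq q k * y)"
  let ?s = "\<Sum>\<^sub>\<infinity>(q, k)\<in>pos_pairs. ?c q k * sin (freq q k * x)"
  let ?C = "- 1 / (4 * pi) * y * dlog_diff p v"
  have "inst_Gx x y = (\<Sum>\<^sub>\<infinity>p\<in>pos_pairs. (- 4 * pi * y) * (case p of (q, k) \<Rightarrow> ?c q k * sin (freq q k * x)))"
    unfolding inst_Gx_def by (rule infsum_cong) (auto simp: mult_ac)
  also have "\<dots> = (- 4 * pi * y) * ?s" by (rule infsum_cmult_right')
  finally have Gx: "inst_Gx x y = - 4 * pi * y * ?s" .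
  have "((\<lambda>q::int. ?C * (\<Sum>\<^sub>\<infinity>k\<in>{1..}. phase x q k *
      of_real ((if q < 0 then - 1 else 1) * ?c (nat \<bar>q\<bar>) k))) has_sum ?C * (- 2 * \<i> * of_real ?s)) (- {0})"
    by (intro has_sum_cmult_right inst_phase_has_sum_odd inst_coeff_abs_summable(2)[OF y])
  also have "(\<lambda>q::int. ?C * (\<Sum>\<^sub>\<infinity>k\<in>{1..}. phase x q k *
      of_real ((if q < 0 then - 1 else 1) * ?c (nat \<bar>q\<bar>) k))) = (\<lambda>q. of_int q * A_inst q p v)" (is "?l = _")
  proof (rule ext)
    fix q :: int
    have q1: "complex_of_int q = of_real ((if q < 0 then - 1 else 1) * real (nat \<bar>q\<bar>))" by auto
    have "of_int q * A_inst q p v = (\<Sum>\<^sub>\<infinity>k\<in>{1..}. (of_int q * (- 1 / (4 * pi))) * (inst_phase k q p * abs_qZ q p *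
        Bessel_K 1 (2 * pi * real k * abs_qZ q p) * dlog_diff p v))"
      unfolding A_inst_def by (subst infsum_cmult_right') (simp add: mult.assoc)
    also have "\<dots> = (\<Sum>\<^sub>\<infinity>k\<in>{1..}. ?C * (phase x q k *
       complex_of_real ((if q < 0 then - 1 else 1) * ?c (nat \<bar>q\<bar>) k)))"
    proof (rule infsum_cong)
      fix k
      have ph: "inst_phase k q p = phase x q k"
        by (simp add: inst_phase_def x_def)
      have ar: "2 * pi * real k * abs_qZ q p = 2 * pi * real k * real (nat \<bar>q\<bar>) * y"
        by (simp add: abs_qZ_eq y_def)
      show "(of_int q * (- 1 / (4 * pi))) * (inst_phase k q p * abs_qZ q p *
        Bessel_K 1 (2 * pi * real k * abs_qZ q p) * dlog_diff p v) = ?C * (phase x q k *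
       complex_of_real ((if q < 0 then - 1 else 1) * ?c (nat \<bar>q\<bar>) k))"
        unfolding ar ph unfolding q1 abs_qZ_eq y_def[symmetric] by (simp add: power2_eq_square)
    qed
    also have "\<dots> = ?C * (\<Sum>\<^sub>\<infinity>k\<in>{1..}. phase x q k *
       complex_of_real ((if q < 0 then - 1 else 1) * ?c (nat \<bar>q\<bar>) k))"
      by (rule infsum_cmult_right')
    finally show "?l q = of_int q * A_inst q p v" by (rule sym)
  qed
  also have "?C * (- 2 * \<i> * of_real ?s) = - (\<i> / (8 * pi^2)) * of_real (inst_Gx x y) * dlog_diff p v"
    unfolding Gx by (simp add: power2_eq_square)
  finally show ?thesis by (simp only: x_def y_def)
qed

lemma sum_\<eta>_inst:
  assumes "crdZ 0 p \<noteq> 0"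
  shows "((\<lambda>q. \<eta>_inst q p v) has_sum
     \<i> / (8 * pi^2) * of_real (inst_G (crd\<zeta> 0 p) (cmod (crdZ 0 p))) * dlog_diff p v) (- {0})"
proof -
  define x where "x = crd\<zeta> 0 p"
  define y where "y = cmod (crdZ 0 p)"
  have y: "y > 0" using assms by (simp add: y_def)
  let ?c = "G_coeff y"
  let ?C = "\<i> / (16 * pi^2) * dlog_diff p v"
  have "((\<lambda>q::int. ?C * (\<Sum>\<^sub>\<infinity>k\<in>{1..}. phase x q k *
      of_real (?c (nat \<bar>q\<bar>) k))) has_sum ?C * of_real (2 * inst_G x y)) (- {0})"
    unfolding inst_G_def
    by (intro has_sum_cmult_right inst_phase_has_sum_even inst_coeff_abs_summable(3)[OF y])
  also have "(\<lambda>q::int. ?C * (\<Sum>\<^sub>\<infinity>k\<in>{1..}. phase x q k *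
      complex_of_real (?c (nat \<bar>q\<bar>) k))) = (\<lambda>q. \<eta>_inst q p v)" (is "?l = _")
  proof (rule ext)
    fix q :: int
    have "\<eta>_inst q p v = (\<Sum>\<^sub>\<infinity>k\<in>{1..}. \<i> / (8 * pi^2) * (inst_phase k q p / of_nat k * abs_qZ q p *
        Bessel_K 1 (2 * pi * real k * abs_qZ q p) * dlog_diff p v))"
      unfolding \<eta>_inst_def by (subst infsum_cmult_right') simp
    also have "\<dots> = (\<Sum>\<^sub>\<infinity>k\<in>{1..}. ?C * (phase x q k *
       complex_of_real (?c (nat \<bar>q\<bar>) k)))"
    proof (rule infsum_cong)
      fix k :: nat assume k: "k \<in> {1..}"
      have ph: "inst_phase k q p = phase x q k"
        by (simp add: inst_phase_def x_def)
      have ar: "2 * pi * real k * abs_qZ q p = 2 * pi * real k * real (nat \<bar>q\<bar>) * y"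
        by (simp add: abs_qZ_eq y_def)
      have cc: "?c (nat \<bar>q\<bar>) k = 2 * (real (nat \<bar>q\<bar>) * y) * Bessel_K 1 (2 * pi * real k * real (nat \<bar>q\<bar>) * y) / real k"
        using k by (simp add: power2_eq_square)
      show "\<i> / (8 * pi^2) * (inst_phase k q p / of_nat k * abs_qZ q p *
        Bessel_K 1 (2 * pi * real k * abs_qZ q p) * dlog_diff p v) = ?C * (phase x q k *
       complex_of_real (?c (nat \<bar>q\<bar>) k))"
        unfolding ar ph cc abs_qZ_eq y_def[symmetric] by (simp add: mult.assoc)
    qed
    also have "\<dots> = ?C * (\<Sum>\<^sub>\<infinity>k\<in>{1..}. phase x q k *
       complex_of_real (?c (nat \<bar>q\<bar>) k))"
      by (rule infsum_cmult_right')
    finally show "?l q = \<eta>_inst q p v" by (rule sym)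
  qed
  also have "?C * of_real (2 * inst_G x y) = \<i> / (8 * pi^2) * of_real (inst_G x y) * dlog_diff p v"
    by simp
  finally show ?thesis by (simp only: x_def y_def)
qed

subsection \<open>The lattice sum\<close>

abbreviation lat_norm :: "real \<Rightarrow> real \<Rightarrow> int \<Rightarrow> int \<Rightarrow> real" where
  "lat_norm x y m n \<equiv> cmod (of_int m * Complex x y + of_int n)"

abbreviation lat_sum :: "real \<Rightarrow> real \<Rightarrow> real" where
  "lat_sum x y \<equiv> lattice_sum (Complex x y)"

lemma cmod_lattice_point: "lat_norm x y m n = sqrt ((of_int m * x + of_int n)^2 + (of_int m * y)^2)"
  by (simp add: cmod_def)

text \<open>Poisson summation with a = |m| y and shift m x; the halves n \<ge> 0 and n \<le> -1 of
  the row are the two terms of the paired series there.\<close>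

lemma lattice_row_has_sum:
  fixes m :: int and x y :: real
  assumes y: "y > 0" and m: "m \<noteq> 0"
  shows "((\<lambda>n::int. 1 / lat_norm x y m n ^ 3) has_sum
    (2 / (of_int m * y)^2 + 4 / (of_int m * y)^2 * bessel_row (\<bar>of_int m\<bar> * y) (of_int m * x))) UNIV"
proof -
  let ?a = "\<bar>of_int m\<bar> * y"
  have a: "?a > 0" using y m by simp
  have a2: "?a^2 = (of_int m * y)^2" by (simp add: power_mult_distrib)
  note P = poisson_summation_inverse_cube(2)[OF a, of "of_int m * x", unfolded a2]
  define f where "f n = 1 / lat_norm x y m n ^ 3" for n :: int
  have f1: "f (int n) = 1 / sqrt ((of_int m * x + real n)^2 + (of_int m * y)^2) ^ 3" for n
    using cmod_lattice_point[of m x y "int n"] by (simp add: f_def)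
  have f2: "f (- int n - 1) = 1 / sqrt ((real n + 1 - of_int m * x)^2 + (of_int m * y)^2) ^ 3" for n
  proof -
    have "(of_int m * x + of_int (- int n - 1))^2 = (real n + 1 - of_int m * x)^2"
      by (simp add: power2_eq_square algebra_simps)
    thus ?thesis by (simp only: f_def cmod_lattice_point)
  qed
  have nn: "f n \<ge> 0" for n by (simp add: f_def)
  have S: "(\<lambda>n. f (int n) + f (- int n - 1)) sums (2 / (of_int m * y)^2 + 4 / (of_int m * y)^2 * bessel_row ?a (of_int m * x))"
    using P unfolding f1 f2 .
  have s1: "summable (\<lambda>n. f (int n))" and s2: "summable (\<lambda>n. f (- int n - 1))"
    using nn by (auto intro!: summable_comparison_test[OF _ sums_summable[OF S]] exI[of _ 0])
  have "(f has_sum ((\<Sum>n. f (int n)) + (\<Sum>n. f (- int n - 1)))) UNIV"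
    by (intro has_sum_int_UNIV sums_nonneg_imp_has_sum summable_sums s1 s2 nn)
  also have "(\<Sum>n. f (int n)) + (\<Sum>n. f (- int n - 1)) = (2 / (of_int m * y)^2 + 4 / (of_int m * y)^2 * bessel_row ?a (of_int m * x))"
    using suminf_add[OF s1 s2] S by (simp add: sums_iff)
  finally show ?thesis unfolding f_def .
qed

lemma zeta3_has_sum: "((\<lambda>n::int. 1 / cmod (of_int n) ^ 3) has_sum (2 * zeta3)) (- {0})"
proof -
  have "((\<lambda>n. 1 / real (Suc n) ^ 3) has_sum zeta3) UNIV"
    unfolding zeta3_def by (intro sums_nonneg_imp_has_sum summable_sums summable_inverse_Suc_power) auto
  hence "((\<lambda>n. 1 / real n ^ 3) has_sum zeta3) {1..}"
    using has_sum_Suc_iff[of "\<lambda>n. 1 / real n ^ 3"] by simp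
  hence "((\<lambda>n::int. 1 / cmod (of_int n) ^ 3) has_sum (zeta3 + zeta3)) (- {0})"
    by (intro has_sum_int_nonzero) simp_all
  thus ?thesis by simp
qed

lemma zeta3_nonneg: "zeta3 \<ge> 0"
  unfolding zeta3_def by (intro suminf_nonneg summable_inverse_Suc_power) auto

text \<open>The indices exchange roles: the \<open>k\<close> of \<open>inst_G\<close> numbers the
  lattice rows, whereas its \<open>q\<close> is the Fourier index within a row. Hence the swap of
  the pairs and the regrouping by rows.\<close>

lemma inst_G_row_has_sum:
  assumes y: "y > 0"
  shows "((\<lambda>m::nat. 1 / (pi * (real m)^2) * bessel_row (real m * y) (real m * x)) has_sum inst_G x y) {1..}"
proof -
  define T where "T m k = 1 / (pi * (real m)^2) *
     (2 * pi * real m * real k * y * Bessel_K 1 (2 * pi * real m * real k * y)) * cos (2 * pi * real m * real k * x)" for m k :: nat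
  have "(\<lambda>p. (case p of (q, k) \<Rightarrow> G_coeff y q k)
     * (case p of (q, k) \<Rightarrow> cos (freq q k * x))) summable_on pos_pairs"
    by (rule summable_on_mult_bounded[OF inst_coeff_abs_summable(3)[OF y], where M=1]) auto
  hence s: "(\<lambda>(q, k). T k q) summable_on pos_pairs"
    by (simp add: T_def case_prod_unfold)
  have G: "((\<lambda>(q, k). T k q) has_sum inst_G x y) pos_pairs"
    using has_sum_infsum[OF s] by (simp add: inst_G_def T_def)
  hence G': "((\<lambda>(m, k). T m k) has_sum inst_G x y) pos_pairs"
    unfolding pos_pairs_def by (subst has_sum_swap) simp
  have s': "(\<lambda>(m, k). T m k) summable_on pos_pairs" using G' by (rule has_sum_imp_summable)
  have "((\<lambda>m. \<Sum>\<^sub>\<infinity>k\<in>{1..}. T m k) has_sum inst_G x y) {1..}"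
    using has_sum_pos_pairs_iterated[OF s'] infsumI[OF G'] by simp
  moreover have "(\<Sum>\<^sub>\<infinity>k\<in>{1..}. T m k) = 1 / (pi * (real m)^2) * bessel_row (real m * y) (real m * x)" (is "_ = _ * suminf ?h")
    if m: "m \<in> {1..}" for m
  proof -
    have "T m summable_on {1..}"
      using s' m unfolding pos_pairs_def by (rule summable_on_SigmaD1)
    hence "(T m has_sum (\<Sum>\<^sub>\<infinity>k\<in>{1..}. T m k)) {1..}" by simp
    hence "(\<lambda>k. T m (Suc k)) sums (\<Sum>\<^sub>\<infinity>k\<in>{1..}. T m k)"
      by (intro has_sum_imp_sums) (simp add: has_sum_Suc_iff)
    moreover have "T m (Suc k) = 1 / (pi * (real m)^2) * ?h k" for k
      by (simp add: T_def mult_ac)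
    moreover have "summable ?h"
      using poisson_summation_inverse_cube(1)[of "real m * y" "real m * x"] y m by simp
    ultimately have "(\<Sum>\<^sub>\<infinity>k\<in>{1..}. T m k) = (\<Sum>k. 1 / (pi * (real m)^2) * ?h k)"
      by (simp add: sums_iff)
    also have "\<dots> = 1 / (pi * (real m)^2) * suminf ?h"
      by (rule suminf_mult) fact
    finally show ?thesis .
  qed
  ultimately show ?thesis by (subst has_sum_cong) auto
qed

text \<open>Rows m and -m agree. Their constant modes 2/(m y)^2 add up, by the Basel sum, to 2 pi^2
  / (3 y^2), their other modes to the Bessel series, and the row m = 0 is 2 zeta(3).\<close>

lemma lattice_has_sum:
  assumes y: "y > 0"
  shows "((\<lambda>(m, n). 1 / lat_norm x y m n ^ 3) has_sum
     (2 * zeta3 + 2 * pi^2 / (3 * y^2) + 8 * pi / y^2 * inst_G x y)) (- {(0::int, 0::int)})"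
proof -
  define row where "row m = 2 / (of_int m * y)^2 + 4 / (of_int m * y)^2 * bessel_row (\<bar>of_int m\<bar> * y) (of_int m * x)" for m :: int
  have even: "row (- m) = row m" for m by (simp add: row_def)
  have rowpos: "row (int m) = 2 / y^2 * (1 / (real m)^2) + 4 * pi / y^2 * (1 / (pi * (real m)^2) * bessel_row (real m * y) (real m * x))" for m
    by (simp add: row_def power_mult_distrib mult_ac)
  have sq: "((\<lambda>m. 1 / (real m)^2) has_sum (pi^2 / 6)) {1..}"
  proof -
    have "((\<lambda>n. 1 / (real (Suc n))^2) has_sum (pi^2 / 6)) UNIV"
      using inverse_squares_sums by (intro sums_nonneg_imp_has_sum) (auto simp: add_ac)
    thus ?thesis using has_sum_Suc_iff[of "\<lambda>n. 1 / (real n)^2"] by simp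
  qed
  have "((\<lambda>m. row (int m)) has_sum (2 / y^2 * (pi^2 / 6) + 4 * pi / y^2 * inst_G x y)) {1..}"
    unfolding rowpos by (intro has_sum_add has_sum_cmult_right sq inst_G_row_has_sum y)
  hence "(row has_sum ((2 / y^2 * (pi^2 / 6) + 4 * pi / y^2 * inst_G x y) + (2 / y^2 * (pi^2 / 6) + 4 * pi / y^2 * inst_G x y))) (- {0})"
    by (intro has_sum_int_nonzero) (simp_all add: even)
  also have "(2 / y^2 * (pi^2 / 6) + 4 * pi / y^2 * inst_G x y) + (2 / y^2 * (pi^2 / 6) + 4 * pi / y^2 * inst_G x y)
     = 2 * pi^2 / (3 * y^2) + 8 * pi / y^2 * inst_G x y"
    using y by (simp add: field_simps)
  finally have rows: "(row has_sum (2 * pi^2 / (3 * y^2) + 8 * pi / y^2 * inst_G x y)) (- {0})" .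
  define g where "g m = (if m = 0 then 2 * zeta3 else row m)" for m
  \<comment> \<open>Only the row m = 0 lacks a point, the origin, so the index set is a dependent
    sum rather than a product.\<close>
  define B where "B m = (if m = (0::int) then - {0::int} else UNIV)" for m
  have "(g has_sum (2 * pi^2 / (3 * y^2) + 8 * pi / y^2 * inst_G x y)) (- {0})"
    using rows by (subst has_sum_cong[of _ g row]) (auto simp: g_def)
  from has_sum_insert[OF _ this, of 0] have g: "(g has_sum (2 * zeta3 + 2 * pi^2 / (3 * y^2) + 8 * pi / y^2 * inst_G x y)) UNIV"
    by (simp add: g_def insert_UNIV Compl_eq_Diff_UNIV add_ac)
  have inner: "((\<lambda>n. (\<lambda>(m, n). 1 / lat_norm x y m n ^ 3) (m, n)) has_sum g m) (B m)" for m :: int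
    using lattice_row_has_sum[OF y, of m x] zeta3_has_sum by (auto simp: g_def B_def row_def)
  have "(\<lambda>(m::int, n::int). 1 / lat_norm x y m n ^ 3) summable_on Sigma UNIV B"
    by (rule summable_on_SigmaI[OF inner has_sum_imp_summable[OF g]]) auto
  from has_sum_SigmaI[OF inner g this]
  have "((\<lambda>(m, n). 1 / lat_norm x y m n ^ 3) has_sum
     (2 * zeta3 + 2 * pi^2 / (3 * y^2) + 8 * pi / y^2 * inst_G x y)) (Sigma UNIV B)" .
  also have "Sigma UNIV B = - {(0::int, 0::int)}" by (auto simp: B_def split: if_splits)
  finally show ?thesis .
qed

lemma lattice_sum_eq:
  "y > 0 \<Longrightarrow> lat_sum x y = 2 * zeta3 + 2 * pi^2 / (3 * y^2) + 8 * pi / y^2 * inst_G x y"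
  unfolding lattice_sum_def using lattice_has_sum by (rule infsumI)

lemma lattice_sum_has_sum:
  "y > 0 \<Longrightarrow> ((\<lambda>(m, n). 1 / lat_norm x y m n ^ 3) has_sum lat_sum x y) (- {(0::int, 0::int)})"
  using lattice_has_sum[of y x] by (simp only: lattice_sum_eq)

section \<open>Comparison of lattice sums at two points\<close>

lemma lattice_norm_pos:
  assumes "y > 0" "(m, n) \<noteq> (0::int, 0::int)"
  shows "lat_norm x y m n > 0"
proof (cases "m = 0")
  case False
  hence "Im (of_int m * Complex x y + of_int n) \<noteq> 0" using assms by simp
  thus ?thesis by (metis norm_eq_zero zero_complex.sel(2) zero_less_norm_iff)
qed (use assms in auto)

lemma lattice_sum_ge: 
  assumes y: "y > 0" shows "lat_sum x y \<ge> 2 * zeta3"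
proof -
  have "((\<lambda>(m, n). 1 / lat_norm x y m n ^ 3) has_sum (2 * zeta3)) (Pair 0 ` (- {0}))"
    using zeta3_has_sum by (subst has_sum_reindex) (auto simp: inj_on_def o_def)
  thus ?thesis by (rule has_sum_mono2[OF _ lattice_sum_has_sum[OF y]]) auto
qed

text \<open>Termwise comparison: if no lattice vector is stretched by more than C, no inverse cube
  shrinks by more than C^3. Each monotonicity property of the lattice sum below is an
  instance.\<close>

lemma lattice_sum_scaled_mono:
  assumes y: "y > 0" "y' > 0" and C: "C > 0"
    and le: "\<And>m n. (m, n) \<noteq> (0, 0) \<Longrightarrow> lat_norm x' y' m n \<le> C * lat_norm x y m n"
  shows "lat_sum x y \<le> C ^ 3 * lat_sum x' y'"
proof (rule has_sum_mono[OF lattice_sum_has_sum[OF y(1)] has_sum_cmult_right[OF lattice_sum_has_sum[OF y(2)]]])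
  fix p :: "int \<times> int" assume "p \<in> - {(0, 0)}"
  then obtain m n where p: "p = (m, n)" "(m, n) \<noteq> (0, 0)" by (cases p) auto
  let ?a = "lat_norm x y m n" and ?b = "lat_norm x' y' m n"
  have pos: "?a > 0" "?b > 0" using lattice_norm_pos[OF _ p(2)] y by auto
  have "?b ^ 3 \<le> (C * ?a) ^ 3" using le[OF p(2)] by (intro power_mono) auto
  hence "1 / ?a ^ 3 \<le> C ^ 3 * (1 / ?b ^ 3)"
    using pos by (simp add: power_mult_distrib field_simps)
  thus "(case p of (m, n) \<Rightarrow> 1 / lat_norm x y m n ^ 3) \<le>
      C ^ 3 * (case p of (m, n) \<Rightarrow> 1 / lat_norm x' y' m n ^ 3)"
    by (simp add: p)
qed

text \<open>The squared operator norm of the shear is exp (2 arsinh (\<epsilon>/2)), which is below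
  exp \<epsilon>. The exponent is exact to first order, and this is what gives the constant 3/2 in
  the later bound on the x-derivative.\<close>

lemma shear_norm_bound:
  fixes u v \<epsilon> :: real
  assumes "\<epsilon> \<ge> 0"
  shows "(u + \<epsilon> * v)^2 + v^2 \<le> exp \<epsilon> * (u^2 + v^2)"
proof (cases "\<epsilon> = 0")
  case False
  hence \<epsilon>: "\<epsilon> > 0" using assms by simp
  define A where "A = exp \<epsilon> - 1"
  \<comment> \<open>The cubic Taylor polynomial is needed: for the quadratic one a (a -
    \<epsilon>^2) is only \<epsilon>^2 - \<epsilon>^4/4, whereas the cubic term raises it above
    \<epsilon>^2.\<close>
  define a where "a = \<epsilon> + \<epsilon>^2 / 2 + \<epsilon> ^ 3 / 6"
  have "(\<Sum>k\<in>{0, 1, 2, 3}. \<epsilon> ^ k /\<^sub>R fact k) \<le> (\<Sum>k. \<epsilon> ^ k /\<^sub>R fact k)"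
    using \<epsilon> by (intro sum_le_suminf summable_exp_generic) auto
  moreover have "(\<Sum>k\<in>{0, 1, 2, 3}. \<epsilon> ^ k /\<^sub>R fact k) = 1 + a"
    by (simp add: a_def fact_numeral field_simps)
  ultimately have Aa: "A \<ge> a"
    unfolding A_def exp_def by linarith
  have a0: "a > 0" "a \<ge> \<epsilon>\<^sup>2 / 2" using \<epsilon> by (auto simp: a_def intro!: add_pos_pos)
  have "0 \<le> (A - a) * (A + a - \<epsilon>\<^sup>2)"
    using Aa a0 by (intro mult_nonneg_nonneg) auto
  hence "A * (A - \<epsilon>\<^sup>2) \<ge> a * (a - \<epsilon>\<^sup>2)" by (simp add: algebra_simps)
  also have "a * (a - \<epsilon>\<^sup>2) = \<epsilon>^2 + \<epsilon> ^ 4 / 12 + (\<epsilon> ^ 3)^2 / 36"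
    unfolding a_def power2_eq_square power3_eq_cube power4_eq_xxxx by (simp add: field_simps)
  finally have "\<epsilon>^2 + \<epsilon> ^ 4 / 12 + (\<epsilon> ^ 3)^2 / 36 \<le> A * (A - \<epsilon>\<^sup>2)" .
  moreover have "0 \<le> \<epsilon> ^ 4 / 12" "0 \<le> (\<epsilon> ^ 3)\<^sup>2 / 36" using \<epsilon> by auto
  ultimately have key: "A * (A - \<epsilon>\<^sup>2) - \<epsilon>\<^sup>2 \<ge> 0" by linarith
  \<comment> \<open>Completing the square in the quadratic form whose u^2 coefficient is A; its
    discriminant condition is the inequality \<open>key\<close>.\<close>
  have "A * (exp \<epsilon> * (u^2 + v^2) - ((u + \<epsilon> * v)^2 + v^2)) = (A * u - \<epsilon> * v)^2 + (A * (A - \<epsilon>\<^sup>2) - \<epsilon>\<^sup>2) * v^2"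
  proof -
    have e: "exp \<epsilon> = A + 1" by (simp add: A_def)
    show ?thesis unfolding e by (simp add: power2_eq_square algebra_simps)
  qed
  also have "\<dots> \<ge> 0" using key by (intro add_nonneg_nonneg mult_nonneg_nonneg) auto
  finally have "exp \<epsilon> * (u^2 + v^2) - ((u + \<epsilon> * v)^2 + v^2) \<ge> 0"
    using Aa a0(1) by (simp add: zero_le_mult_iff)
  thus ?thesis by simp
qed simp

lemma lattice_sum_shear_bound:
  assumes y: "y > 0"
  shows "lat_sum x y \<le> exp (3 / (2 * y) * \<bar>x' - x\<bar>) * lat_sum x' y"
proof -
  define \<epsilon> where "\<epsilon> = \<bar>x' - x\<bar> / y"
  have \<epsilon>: "\<epsilon> \<ge> 0" using y by (simp add: \<epsilon>_def)
  have "lat_sum x y \<le> exp (\<epsilon> / 2) ^ 3 * lat_sum x' y"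
  proof (rule lattice_sum_scaled_mono[OF y y])
    fix m n :: int
    define u where "u = of_int m * x + of_int n"
    define v where "v = of_int m * y"
    have "(of_int m * x' + of_int n)^2 + v^2 \<le> exp \<epsilon> * (u^2 + v^2)"
    proof (cases "x' \<ge> x")
      case True
      hence "of_int m * x' + of_int n = u + \<epsilon> * v"
        using y by (simp add: u_def v_def \<epsilon>_def field_simps)
      thus ?thesis using shear_norm_bound[OF \<epsilon>, of u v] by simp
    next
      case False
      hence "of_int m * x' + of_int n = u + \<epsilon> * (- v)"
        using y by (simp add: u_def v_def \<epsilon>_def field_simps)
      thus ?thesis using shear_norm_bound[OF \<epsilon>, of u "- v"] by simp
    qed
    hence "sqrt ((of_int m * x' + of_int n)^2 + v^2) \<le> sqrt (exp \<epsilon> * (u^2 + v^2))" by simp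
    also have "\<dots> = exp (\<epsilon> / 2) * sqrt (u^2 + v^2)"
    proof -
      have "exp \<epsilon> = (exp (\<epsilon> / 2))^2" by (simp flip: exp_double)
      thus ?thesis by (simp add: real_sqrt_mult)
    qed
    finally show "lat_norm x' y m n \<le> exp (\<epsilon> / 2) * lat_norm x y m n"
      by (simp only: cmod_lattice_point u_def v_def)
  qed simp
  also have "exp (\<epsilon> / 2) ^ 3 = exp (3 / (2 * y) * \<bar>x' - x\<bar>)"
    by (simp add: \<epsilon>_def flip: exp_of_nat_mult)
  finally show ?thesis .
qed

section \<open>First derivatives of the lattice sum\<close>

lemma inst_G_has_real_derivative_y:
  assumes "y > 0" shows "((\<lambda>y. inst_G x y) has_real_derivative inst_Gy x y) (at y)"
proof -
  have "((\<lambda>t::real. (x, t)) has_derivative (\<lambda>h. (0, h))) (at y)"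
    by (auto intro!: derivative_eq_intros)
  from has_derivative_compose[OF this inst_G_has_derivative[OF assms]]
  show ?thesis by (simp add: has_field_derivative_def mult.commute[of _ "inst_Gy x y"])
qed

lemma inst_G_has_real_derivative_x:
  assumes "y > 0" shows "((\<lambda>x. inst_G x y) has_real_derivative inst_Gx x y) (at x)"
proof -
  have "((\<lambda>t::real. (t, y)) has_derivative (\<lambda>h. (h, 0))) (at x)"
    by (auto intro!: derivative_eq_intros)
  from has_derivative_compose[OF this inst_G_has_derivative[OF assms]]
  show ?thesis by (simp add: has_field_derivative_def mult.commute[of _ "inst_Gx x y"])
qed

lemma inst_G_lattice_sum:
  assumes "y > 0"
  shows "8 * pi * inst_G x y = y^2 * lat_sum x y - 2 * zeta3 * y^2 - 2 * pi^2 / 3"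
  using assms by (simp add: lattice_sum_eq field_simps)

text \<open>\<open>Sx\<close> and \<open>Sy\<close> are the partial derivatives of S. They exist
  because S is expressed through \<open>inst_G\<close>, while the inequalities come from functions
  that are monotone by comparison of lattice norms, so no differentiated lattice series has to be
  summed.\<close>

lemma lattice_sum_derivative_bounds:
  fixes x y :: real
  assumes y: "y > 0"
  defines "S \<equiv> lat_sum x y"
  obtains Sx Sy where "8 * pi * inst_Gx x y = y^2 * Sx"
    and "8 * pi * inst_Gy x y = 2 * y * S + y^2 * Sy - 4 * zeta3 * y"
    and "Sy \<le> 0" and "y * Sy \<ge> - 3 * S" and "\<bar>y * Sx\<bar> \<le> 3 / 2 * S"
proof -
  define Sx where "Sx = 8 * pi / y^2 * inst_Gx x y"
  define Sy where "Sy = (8 * pi * inst_Gy x y + 4 * zeta3 * y - 2 * y * S) / y^2"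
  have dx: "((\<lambda>x. lat_sum x y) has_real_derivative Sx) (at x)"
    unfolding lattice_sum_eq[OF y] Sx_def
    using DERIV_add[OF DERIV_const[of "2 * zeta3 + 2 * pi^2 / (3 * y^2)"]
        DERIV_cmult[OF inst_G_has_real_derivative_x[OF y, of x], of "8 * pi / y^2"]] by simp
  have dy: "((\<lambda>y. lat_sum x y) has_real_derivative Sy) (at y)"
  proof (rule has_field_derivative_transform_within_open)
    have "((\<lambda>y. (8 * pi * inst_G x y + 2 * zeta3 * y^2 + 2 * pi^2 / 3) / y^2) has_real_derivative
      ((8 * pi * inst_Gy x y + 2 * zeta3 * (2 * y)) * y^2 - (8 * pi * inst_G x y + 2 * zeta3 * y^2 + 2 * pi^2 / 3) * (2 * y)) / (y^2 * y^2)) (at y)"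
      using y by (auto intro!: derivative_eq_intros inst_G_has_real_derivative_y[OF y])
    also have "8 * pi * inst_G x y + 2 * zeta3 * y^2 + 2 * pi^2 / 3 = y^2 * S"
      unfolding S_def using inst_G_lattice_sum[OF y, of x] by simp
    also have "((8 * pi * inst_Gy x y + 2 * zeta3 * (2 * y)) * y^2 - y\<^sup>2 * S * (2 * y)) / (y^2 * y^2) = Sy"
    proof -
      have e: "(8 * pi * inst_Gy x y + 2 * zeta3 * (2 * y)) * y^2 - y\<^sup>2 * S * (2 * y) =
         y^2 * (8 * pi * inst_Gy x y + 4 * zeta3 * y - 2 * y * S)" by (simp add: algebra_simps)
      have "y^2 \<noteq> 0" using y by simp
      thus ?thesis unfolding e Sy_def by (rule nonzero_mult_divide_mult_cancel_left)
    qed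
    finally show "((\<lambda>y. (8 * pi * inst_G x y + 2 * zeta3 * y^2 + 2 * pi^2 / 3) / y^2) has_real_derivative Sy) (at y)" .
    show "open {0::real<..}" "y \<in> {0<..}" using y by auto
    show "(8 * pi * inst_G x t + 2 * zeta3 * t^2 + 2 * pi^2 / 3) / t^2 = lat_sum x t" if "t \<in> {0<..}" for t
      using that inst_G_lattice_sum[of t x] by (simp add: field_simps)
  qed
  have int: "y \<in> interior {0<..}" using y by (simp add: interior_open)
  show thesis
  proof (rule that)
    show "8 * pi * inst_Gx x y = y^2 * Sx" using y by (simp add: Sx_def)
    show "8 * pi * inst_Gy x y = 2 * y * S + y^2 * Sy - 4 * zeta3 * y" using y by (simp add: Sy_def)
    have "mono_on {0<..} (\<lambda>y. - lat_sum x y)"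
    proof (rule mono_onI)
      fix r s :: real assume rs: "r \<in> {0<..}" "s \<in> {0<..}" "r \<le> s"
      have "lat_sum x s \<le> 1 ^ 3 * lat_sum x r"
      proof (rule lattice_sum_scaled_mono)
        show "lat_norm x r m n \<le> 1 * lat_norm x s m n" for m n :: int
          unfolding cmod_lattice_point mult_1 power_mult_distrib
          using rs by (intro real_sqrt_le_mono add_left_mono mult_left_mono power_mono) auto
      qed (use rs in auto)
      thus "- lat_sum x r \<le> - lat_sum x s" by simp
    qed
    from mono_on_imp_deriv_nonneg[OF this DERIV_minus[OF dy] int] show "Sy \<le> 0" by simp
    \<comment> \<open>Raising the height from r to s stretches each lattice vector by at most
      s/r.\<close>
    have "mono_on {0<..} (\<lambda>y. y ^ 3 * lat_sum x y)"
    proof (rule mono_onI)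
      fix r s :: real assume rs: "r \<in> {0<..}" "s \<in> {0<..}" "r \<le> s"
      have "lat_sum x r \<le> (s / r) ^ 3 * lat_sum x s"
      proof (rule lattice_sum_scaled_mono)
        fix m n :: int
        have sr: "s / r \<ge> 1" using rs by simp
        have "(of_int m * x + of_int n)^2 + (of_int m * s)^2 \<le> (s / r)\<^sup>2 * ((of_int m * x + of_int n)^2 + (of_int m * r)^2)"
        proof -
          have "1 * (of_int m * x + of_int n)^2 \<le> (s / r)\<^sup>2 * (of_int m * x + of_int n)^2"
            using sr by (intro mult_right_mono one_le_power) auto
          moreover have "(s / r)^2 * (of_int m * r)^2 = (of_int m * s)^2"
            using rs by (simp add: power_mult_distrib power_divide)
          ultimately show ?thesis by (simp add: distrib_left)
        qed
        hence "sqrt ((of_int m * x + of_int n)^2 + (of_int m * s)^2) \<le> sqrt ((s / r)^2 * ((of_int m * x + of_int n)^2 + (of_int m * r)^2))"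
          by simp
        also have "\<dots> = s / r * sqrt ((of_int m * x + of_int n)^2 + (of_int m * r)^2)"
          unfolding real_sqrt_mult real_sqrt_abs using rs by simp
        finally show "lat_norm x s m n \<le> s / r * lat_norm x r m n"
          by (simp only: cmod_lattice_point)
      qed (use rs in auto)
      thus "r ^ 3 * lat_sum x r \<le> s ^ 3 * lat_sum x s"
        using rs by (simp add: field_simps)
    qed
    moreover have "((\<lambda>y. y ^ 3 * lat_sum x y) has_real_derivative y\<^sup>2 * (3 * S + y * Sy)) (at y)"
      by (auto intro!: derivative_eq_intros dy simp: S_def algebra_simps power2_eq_square power3_eq_cube)
    ultimately have "y^2 * (3 * S + y * Sy) \<ge> 0"
      using int by (rule mono_on_imp_deriv_nonneg)
    thus "y * Sy \<ge> - 3 * S" using y by (simp add: zero_le_mult_iff)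
    \<comment> \<open>The shear bound makes log S Lipschitz in x with constant 3/(2 y); the two
      exponential weights, here and with the opposite sign below, express the two one-sided
      estimates as monotonicity.\<close>
    have "mono (\<lambda>x. exp (3 / (2 * y) * x) * lat_sum x y)"
    proof (rule monoI)
      fix r s :: real assume rs: "r \<le> s"
      have "exp (3 / (2 * y) * r) * lat_sum r y \<le> exp (3 / (2 * y) * r) * (exp (3 / (2 * y) * \<bar>s - r\<bar>) * lat_sum s y)"
        by (intro mult_left_mono lattice_sum_shear_bound y) auto
      also have "\<dots> = exp (3 / (2 * y) * r + 3 / (2 * y) * \<bar>s - r\<bar>) * lat_sum s y"
        by (simp only: exp_add mult.assoc)
      also have "3 / (2 * y) * r + 3 / (2 * y) * \<bar>s - r\<bar> = 3 / (2 * y) * s"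
        unfolding distrib_left[symmetric] using rs by simp
      finally show "exp (3 / (2 * y) * r) * lat_sum r y \<le> exp (3 / (2 * y) * s) * lat_sum s y" .
    qed
    moreover have "((\<lambda>x. exp (3 / (2 * y) * x) * lat_sum x y) has_real_derivative
        exp (3 / (2 * y) * x) * (3 / (2 * y) * S + Sx)) (at x)"
      by (rule derivative_eq_intros dx refl | simp add: S_def algebra_simps)+
    ultimately have "exp (3 / (2 * y) * x) * (3 / (2 * y) * S + Sx) \<ge> 0"
      by (rule mono_on_imp_deriv_nonneg) simp
    hence 1: "3 / (2 * y) * S + Sx \<ge> 0" by (simp add: zero_le_mult_iff)
    have "mono (\<lambda>x. - (exp (- (3 / (2 * y)) * x) * lat_sum x y))"
    proof (rule monoI)
      fix r s :: real assume rs: "r \<le> s"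
      have "exp (- (3 / (2 * y)) * s) * lat_sum s y \<le> exp (- (3 / (2 * y)) * s) * (exp (3 / (2 * y) * \<bar>r - s\<bar>) * lat_sum r y)"
        by (intro mult_left_mono lattice_sum_shear_bound y) auto
      also have "\<dots> = exp (- (3 / (2 * y)) * s + 3 / (2 * y) * \<bar>r - s\<bar>) * lat_sum r y"
        by (simp only: exp_add mult.assoc)
      also have "- (3 / (2 * y)) * s + 3 / (2 * y) * \<bar>r - s\<bar> = - (3 / (2 * y)) * r"
        using rs by (simp add: diff_divide_distrib[symmetric] algebra_simps)
      finally show "- (exp (- (3 / (2 * y)) * r) * lat_sum r y) \<le> - (exp (- (3 / (2 * y)) * s) * lat_sum s y)"
        by simp
    qed
    moreover have "((\<lambda>x. - (exp (- (3 / (2 * y)) * x) * lat_sum x y)) has_real_derivative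
        exp (- (3 / (2 * y)) * x) * (3 / (2 * y) * S - Sx)) (at x)"
      by (rule derivative_eq_intros dx refl | simp add: S_def algebra_simps)+
    ultimately have "exp (- (3 / (2 * y)) * x) * (3 / (2 * y) * S - Sx) \<ge> 0"
      by (rule mono_on_imp_deriv_nonneg) simp
    hence 2: "3 / (2 * y) * S - Sx \<ge> 0" by (simp add: zero_le_mult_iff)
    have "\<bar>Sx\<bar> \<le> 3 / (2 * y) * S" using 1 2 by linarith
    hence "y * \<bar>Sx\<bar> \<le> y * (3 / (2 * y) * S)" using y by (intro mult_left_mono) auto
    thus "\<bar>y * Sx\<bar> \<le> 3 / 2 * S" using y by (simp add: abs_mult)
  qed
qed

subsection \<open>Positivity\<close>

text \<open>The defect in the Cauchy-Schwarz inequality |a + b|^2 / (C + N) \<le> |a|^2 / C + |b|^2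
  / N. The next lemma is the real case with a = -T and b = T + e.\<close>

lemma weighted_square_gap:
  fixes a b :: complex and C N :: real
  assumes "C > 0" "N > 0"
  shows "(cmod a)^2 / C + (cmod b)^2 / N - (cmod (a + b))\<^sup>2 / (C + N) = (cmod (of_real N * a - of_real C * b))^2 / (C * N * (C + N))"
proof -
  have nz: "C \<noteq> 0" "N \<noteq> 0" "C + N \<noteq> 0" using assms by auto
  show ?thesis
    unfolding cmod_power2 using nz by (simp add: divide_simps) (simp add: power2_eq_square algebra_simps)
qed

lemma weighted_square_gap_real:
  fixes T e A B :: real
  assumes "A > 0" "B > 0"
  shows "T^2 / A + (T + e)^2 / B - e\<^sup>2 / (A + B) = (A + B) / (A * B) * (T + A / (A + B) * e)^2"
proof -
  have nz: "A \<noteq> 0" "B \<noteq> 0" "A + B \<noteq> 0" using assms by auto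
  show ?thesis
    using nz by (simp add: divide_simps) (simp add: power2_eq_square algebra_simps)
qed

lemma inverse_gap:
  fixes A B r :: real
  assumes "A > 0" "B > 0"
  shows "r / A - r / (A + B) = B / (A * (A + B)) * r"
  using assms by (simp add: divide_simps add_pos_pos) (simp add: algebra_simps)

text \<open>With \<open>N = u^2 + s^2\<close> and \<open>C = A + B\<close>, completing squares exhibits the form as a sum of
  squares; its null space is the line spanned by a vector with imaginary \<open>Y1\<close> component.\<close>

lemma quaternionic_quotient_form_definite:
  fixes X1 X2 Y1 Y2 :: complex and p u s A B T :: real
  defines "E \<equiv> of_real p * X1 - \<i> * of_real u * Y1 + of_real s * Y2"
    and "L \<equiv> of_real u * Y2 + \<i> * of_real s * Y1 + \<i> * of_real p * X2"
  assumes A: "A > 0" and B: "B > 0" and u: "u \<noteq> 0" and AB: "A + B = p^2 - u\<^sup>2 - s\<^sup>2" and Y1: "Im Y1 = 0"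
    and le: "((Im E)^2 + (cmod L)^2 + T^2) / A + (T + Re E)^2 / B - (cmod X1)\<^sup>2 - (cmod X2)\<^sup>2 + (cmod Y1)^2 + (cmod Y2)^2 \<le> 0"
  shows "X1 = 0 \<and> X2 = 0 \<and> Y1 = 0 \<and> Y2 = 0 \<and> T = 0"
proof -
  define C N where "C = A + B" and "N = u^2 + s^2"
  define M1 M2 where "M1 = \<i> * of_real u * Y1 - of_real s * Y2" and "M2 = of_real u * Y2 + \<i> * of_real s * Y1"
  have C: "C > 0" using A B by (simp add: C_def)
  have N: "N > 0" using u by (simp add: N_def add_pos_nonneg)
  have p2: "p^2 = C + N" using AB by (simp add: C_def N_def)
  have p0: "p \<noteq> 0" using p2 C N by auto
  \<comment> \<open>Here \<open>X1\<close> and \<open>X2\<close> are eliminated in favour of E, L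
    and the contributions \<open>M1\<close>, \<open>M2\<close> of \<open>Y1\<close>,
    \<open>Y2\<close>, using that the hypothesis \<open>AB\<close> reads p^2 = C + N.\<close>
  have X1: "(cmod X1)^2 = (cmod (E + M1))^2 / (C + N)"
  proof -
    have "E + M1 = of_real p * X1" by (simp add: E_def M1_def)
    thus ?thesis using p0 by (simp add: norm_mult power_mult_distrib p2[symmetric])
  qed
  have X2: "(cmod X2)^2 = (cmod (L + - M2))^2 / (C + N)"
  proof -
    have "L + - M2 = \<i> * of_real p * X2" by (simp add: L_def M2_def)
    thus ?thesis using p0 by (simp add: norm_mult power_mult_distrib p2[symmetric])
  qed
  \<comment> \<open>(\<open>M1\<close>, \<open>M2\<close>) is sqrt N times a unitary image of
    (\<open>Y1\<close>, \<open>Y2\<close>).\<close>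
  have Y: "(cmod Y1)^2 + (cmod Y2)^2 = (cmod M1)^2 / N + (cmod (- M2))^2 / N"
  proof -
    have "(cmod M1)^2 + (cmod (- M2))^2 = N * ((cmod Y1)^2 + (cmod Y2)^2)"
      unfolding cmod_power2 M1_def M2_def N_def by (simp add: power2_eq_square algebra_simps)
    thus ?thesis using N by (simp add: add_divide_distrib[symmetric])
  qed
  have EE: "(cmod E)^2 = (Re E)^2 + (Im E)^2" by (rule cmod_power2)
  let ?g1 = "(cmod (of_real N * E - of_real C * M1))^2 / (C * N * (C + N))"
  let ?g2 = "(cmod (of_real N * L - of_real C * (- M2)))^2 / (C * N * (C + N))"
  let ?g3 = "C / (A * B) * (T + A / C * Re E)^2"
  let ?g4 = "B / (A * C) * (Im E)^2" and ?g5 = "B / (A * C) * (cmod L)^2"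
  have nn: "?g1 \<ge> 0" "?g2 \<ge> 0" "?g3 \<ge> 0" "?g4 \<ge> 0" "?g5 \<ge> 0"
    using A B C N by auto
  \<comment> \<open>The left side of \<open>le\<close> is exactly the sum of the five gaps.\<close>
  have "?g1 + ?g2 + ?g3 + ?g4 + ?g5 \<le> 0"
    using le weighted_square_gap[OF C N, of E M1] weighted_square_gap[OF C N, of L "- M2"]
      weighted_square_gap_real[OF A B, of T "Re E", folded C_def]
      inverse_gap[OF A B, of "(Im E)^2", folded C_def] inverse_gap[OF A B, of "(cmod L)^2", folded C_def]
    unfolding X1 X2 using Y unfolding EE add_divide_distrib by linarith
  hence z: "?g1 = 0" "?g2 = 0" "?g3 = 0" "?g4 = 0" "?g5 = 0" using nn by linarith+
  have ImE: "Im E = 0" and L0: "L = 0" using z(4,5) A B C by auto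
  have M2: "M2 = 0" using z(2) L0 C N by auto
  have NE: "of_real N * E = of_real C * M1" using z(1) C N by auto
  have ImM1: "Im M1 = 0" using arg_cong[OF NE, of Im] ImE C by simp
  have Y2': "of_real u * Y2 = - \<i> * of_real s * Y1" using M2 by (simp add: M2_def eq_neg_iff_add_eq_0)
  have "of_real u * M1 = \<i> * of_real N * Y1"
  proof -
    have "of_real u * M1 = \<i> * of_real (u^2) * Y1 - of_real s * (of_real u * Y2)"
      by (simp add: M1_def power2_eq_square algebra_simps)
    also have "\<dots> = \<i> * of_real N * Y1" unfolding Y2' by (simp add: N_def power2_eq_square algebra_simps)
    finally show ?thesis .
  qed
  \<comment> \<open>The vanishing gaps make M1 real, hence Y1 imaginary. Only the assumption that Y1
    is real forces it to be zero.\<close>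
  from arg_cong[OF this, of Im] have "N * Re Y1 = 0" using ImM1 Y1 by simp
  hence Y10: "Y1 = 0" using N Y1 by (simp add: complex_eq_iff)
  hence Y20: "Y2 = 0" using Y2' u by simp
  have M10: "M1 = 0" by (simp add: M1_def Y10 Y20)
  hence E0: "E = 0" using NE N by simp
  have T0: "T = 0" using z(3) E0 A B C by simp
  have "X1 = 0" using X1 E0 M10 by simp
  moreover have "X2 = 0" using X2 L0 M2 by simp
  ultimately show ?thesis using Y10 Y20 T0 by simp
qed

text \<open>The numbers \<open>D\<close> and \<open>\<rho>\<close> below are \<open>- det T / t\<close> and the value of the instanton form
  \<open>W\<^sub>0\<close> on the vector field \<open>V\<close>.\<close>

lemma f_f3_signs:
  fixes x y t ch :: real
  defines "S \<equiv> lat_sum x y"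
  defines "c3 \<equiv> ch * zeta3 / (2 * pi) ^ 3"
  defines "D \<equiv> t ^ 3 / 3 + c3 + ch * inst_Gy x y / (4 * pi^2 * y)"
  defines "\<rho> \<equiv> ch * inst_Gx x y / (2 * pi^2)"
  defines "f \<equiv> 2 * pi * (y^2 * (2 * t ^ 3 / 3 - c3) - ch / (24 * pi) - ch * inst_G x y / (2 * pi^2))"
  defines "r1 \<equiv> t ^ 3 / 3 - ch / (4 * (2 * pi) ^ 3) * S"
  assumes y: "y > 0" and t: "t > 0" and ch: "ch > 0" and r1: "r1 > 0"
    and r2: "t ^ 3 / 3 - 3 * ch / (4 * (2 * pi) ^ 3) * S - (3 * ch)\<^sup>2 / (4 * pi) ^ 6 * S^2 * inverse r1 > 0"
  shows "D > 0" "f > 0" "f - pi * (4 * y^2 * (t ^ 3 - D) - \<rho>\<^sup>2 / D) < 0" (is ?th1) "2 * t ^ 3 / 3 - c3 > 0" "c3 \<ge> 0"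
proof -
  \<comment> \<open>In this unit the coefficients of S in \<open>r1\<close> and in the second
    condition become 1/2, 3/2 and 9/16.\<close>
  define \<kappa> where "\<kappa> = ch / (16 * pi ^ 3)"
  have \<kappa>: "\<kappa> > 0" using ch by (simp add: \<kappa>_def)
  have \<kappa>16: "ch = 16 * pi ^ 3 * \<kappa>" by (simp add: \<kappa>_def)
  obtain Sx Sy where Gx: "8 * pi * inst_Gx x y = y^2 * Sx"
    and Gy: "8 * pi * inst_Gy x y = 2 * y * S + y^2 * Sy - 4 * zeta3 * y"
    and Sy: "Sy \<le> 0" "y * Sy \<ge> - 3 * S" and Sx: "\<bar>y * Sx\<bar> \<le> 3 / 2 * S"
    using lattice_sum_derivative_bounds[OF y, of x] unfolding S_def by blast
  have S0: "S \<ge> 2 * zeta3" "S \<ge> 0" using lattice_sum_ge[OF y, of x] zeta3_nonneg by (auto simp: S_def)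
  have c3: "c3 = 2 * \<kappa> * zeta3" by (simp add: c3_def \<kappa>16 power3_eq_cube)
  show "c3 \<ge> 0" using \<kappa> zeta3_nonneg by (simp add: c3)
  have r1': "r1 = t ^ 3 / 3 - \<kappa> * S / 2" by (simp add: r1_def \<kappa>16 power3_eq_cube)
  have r2': "t ^ 3 / 3 - 3 / 2 * (\<kappa> * S) - 9 / 16 * (\<kappa> * S)^2 / r1 > 0"
  proof -
    have "3 * ch / (4 * (2 * pi) ^ 3) * S = 3 / 2 * (\<kappa> * S)" by (simp add: \<kappa>16 power3_eq_cube)
    moreover have "(3 * ch)^2 / (4 * pi) ^ 6 * S^2 * inverse r1 = 9 / 16 * (\<kappa> * S)^2 / r1"
    proof -
      have "(4 * pi) ^ 6 = 4096 * (pi ^ 3)^2" 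
        by (simp add: power_mult_distrib power_mult[of pi 3 2, simplified])
      moreover have "(3 * ch)^2 = 2304 * (pi ^ 3)^2 * \<kappa>^2"
        unfolding \<kappa>16 by (simp only: power_mult_distrib) simp
      ultimately have e: "(3 * ch)^2 / (4 * pi) ^ 6 = 9 / 16 * \<kappa>^2" by simp
      show ?thesis unfolding e by (simp add: power_mult_distrib inverse_eq_divide)
    qed
    ultimately show ?thesis using r2 by (simp only:)
  qed
  have "ch * inst_Gy x y / (4 * pi^2 * y) = \<kappa> * (2 * S + y * Sy - 4 * zeta3) / 2"
  proof -
    have "ch * inst_Gy x y / (4 * pi^2 * y) = 4 * \<kappa> * (pi * inst_Gy x y) / y"
      by (simp add: \<kappa>16 power2_eq_square power3_eq_cube)
    also have "pi * inst_Gy x y = y * (2 * S + y * Sy - 4 * zeta3) / 8"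
      using Gy by (simp add: power2_eq_square algebra_simps)
    also have "4 * \<kappa> * (y * (2 * S + y * Sy - 4 * zeta3) / 8) / y = \<kappa> * (2 * S + y * Sy - 4 * zeta3) / 2"
      using y by simp
    finally show ?thesis .
  qed
  hence D: "D = t ^ 3 / 3 + \<kappa> * S + \<kappa> * (y * Sy) / 2"
    by (simp add: D_def c3 algebra_simps)
  have \<rho>: "\<rho> = \<kappa> * y * (y * Sx)"
  proof -
    have "\<rho> = \<kappa> * (8 * pi * inst_Gx x y)" by (simp add: \<rho>_def \<kappa>16 power2_eq_square power3_eq_cube)
    thus ?thesis unfolding Gx by (simp add: power2_eq_square)
  qed
  have f: "f = 4 * pi * y^2 * r1"
  proof -
    have "ch * inst_G x y / (2 * pi^2) = \<kappa> * (8 * pi * inst_G x y)"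
      by (simp add: \<kappa>16 power2_eq_square power3_eq_cube)
    also have "\<dots> = \<kappa> * y^2 * S - c3 * y^2 - \<kappa> * (2 * pi^2 / 3)"
      unfolding inst_G_lattice_sum[OF y] S_def[symmetric] c3 by (simp add: algebra_simps)
    also have "\<kappa> * (2 * pi^2 / 3) = ch / (24 * pi)" by (simp add: \<kappa>16 power2_eq_square power3_eq_cube)
    finally show ?thesis unfolding f_def r1' by (simp add: algebra_simps)
  qed
  show "f > 0" unfolding f using y r1 by simp
  \<comment> \<open>The lower bound on y \<open>Sy\<close> keeps D above \<open>r1\<close>. This
    gives nondegeneracy of T and later the denominator in the estimate of \<open>\<rho>\<close>^2 /
    D.\<close>
  have "\<kappa> * (y * Sy) \<ge> \<kappa> * (- 3 * S)" using Sy \<kappa> by (intro mult_left_mono) auto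
  hence Dr: "D \<ge> r1" unfolding D r1' by simp
  thus D0: "D > 0" using r1 by simp
  have "\<kappa> * S \<ge> \<kappa> * (2 * zeta3)" using S0 \<kappa> by (intro mult_left_mono) auto
  moreover have "c3 = \<kappa> * (2 * zeta3)" unfolding c3 by simp
  ultimately have "c3 \<le> \<kappa> * S" by (simp only:)
  thus "2 * t ^ 3 / 3 - c3 > 0" using r1 unfolding r1' by simp
  have "\<rho>^2 / D \<le> (\<kappa> * y * (3 / 2 * S))\<^sup>2 / r1"
  proof (rule frac_le)
    have "\<bar>\<rho>\<bar> \<le> \<kappa> * y * (3 / 2 * S)"
      unfolding \<rho> abs_mult[of "\<kappa> * y"] using \<kappa> y Sx by (intro mult_mono) auto
    thus "\<rho>^2 \<le> (\<kappa> * y * (3 / 2 * S))\<^sup>2" by (metis abs_ge_zero power2_abs power_mono)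
  qed (use r1 Dr in auto)
  also have "\<dots> = 4 * y^2 * (9 / 16 * (\<kappa> * S)^2 / r1)" by (simp add: power_mult_distrib power2_eq_square)
  \<comment> \<open>This is the second positivity condition, multiplied by 4 y^2.\<close>
  also have "\<dots> < 4 * y^2 * (t ^ 3 / 3 - 3 / 2 * (\<kappa> * S))"
    using r2' y by (intro mult_strict_left_mono) auto
  also have "\<dots> \<le> 4 * y^2 * r1"
    unfolding r1' using \<kappa> S0 y by (intro mult_left_mono) auto
  finally have \<rho>D: "\<rho>^2 / D < 4 * y^2 * r1" .
  have "f - pi * (4 * y^2 * (t ^ 3 - D) - \<rho>\<^sup>2 / D) = pi * (4 * y^2 * (r1 - t ^ 3 + D) + \<rho>^2 / D)"
    unfolding f by (simp add: algebra_simps)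
  also have "r1 - t ^ 3 + D = - r1 + \<kappa> * (y * Sy) / 2" unfolding r1' D by simp
  also have "pi * (4 * y^2 * (- r1 + \<kappa> * (y * Sy) / 2) + \<rho>^2 / D) < 0"
  proof -
    \<comment> \<open>S decreases in y, so the remaining derivative term makes f_3 only more
      negative.\<close>
    have "\<kappa> * (y * Sy) \<le> 0" using \<kappa> y Sy by (simp add: mult_nonneg_nonpos)
    hence "4 * y^2 * (- r1 + \<kappa> * (y * Sy) / 2) \<le> 4 * y^2 * (- r1)" using y by (intro mult_left_mono) auto
    also have "4 * y^2 * (- r1) = - (4 * y^2 * r1)" by simp
    finally have "4 * y^2 * (- r1 + \<kappa> * (y * Sy) / 2) + \<rho>^2 / D < 0" using \<rho>D by linarith
    thus ?thesis by (rule mult_pos_neg[OF pi_gt_zero])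
  qed
  finally show ?th1 .
qed

subsection \<open>The geometric data\<close>

lemma two_eq_0: "(2::2) = 0" by simp

lemma sum_UNIV_2: "(\<Sum>i\<in>UNIV. f (i::2)) = f 0 + f 1"
  using sum_2[of f] by (simp add: two_eq_0 add.commute)

lemma forall_index_2: "(\<forall>i::2. P i) \<longleftrightarrow> P 0 \<and> P 1"
  using forall_2[of P] by (auto simp: two_eq_0)

lemma crd_add [simp]:
  "crdZ i (u + v) = crdZ i u + crdZ i v" "crd\<zeta> i (u + v) = crd\<zeta> i u + crd\<zeta> i v"
  "crd\<zeta>t i (u + v) = crd\<zeta>t i u + crd\<zeta>t i v" "crd\<sigma> (u + v) = crd\<sigma> u + crd\<sigma> v"
  by (simp_all add: crdZ_def crd\<zeta>_def crd\<zeta>t_def crd\<sigma>_def)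

lemma crd_scaleR [simp]:
  "crdZ i (r *\<^sub>R v) = of_real r * crdZ i v" "crd\<zeta> i (r *\<^sub>R v) = r * crd\<zeta> i v"
  "crd\<zeta>t i (r *\<^sub>R v) = r * crd\<zeta>t i v" "crd\<sigma> (r *\<^sub>R v) = r * crd\<sigma> v"
  by (simp_all add: crdZ_def crd\<zeta>_def crd\<zeta>t_def crd\<sigma>_def scaleR_conv_of_real[where 'a = complex])

lemma crd_V_field [simp]:
  "crdZ i (V_field p) = 2 * \<i> * crdZ i p" "crd\<zeta> i (V_field p) = 0" "crd\<zeta>t i (V_field p) = 0" "crd\<sigma> (V_field p) = 0"
  by (simp_all add: V_field_def crdZ_def crd\<zeta>_def crd\<zeta>t_def crd\<sigma>_def)

lemma dlog_diff_V_field: "crdZ 0 p \<noteq> 0 \<Longrightarrow> dlog_diff p (V_field p) = 4 * \<i>"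
  by (simp add: dlog_diff_def)

section \<open>The prepotential and its second derivatives\<close>

lemma laurent_derivatives:
  fixes a b w :: complex
  shows "w \<noteq> 0 \<Longrightarrow> ((\<lambda>w. a / w + b * w^2) has_field_derivative (- a / w^2 + 2 * b * w)) (at w)"
    and "w \<noteq> 0 \<Longrightarrow> ((\<lambda>w. a / w^2 + b * w) has_field_derivative (- 2 * a / w ^ 3 + b)) (at w)"
    and "((\<lambda>w. a * w ^ 3 + b) has_field_derivative (3 * a * w^2)) (at w)" (is ?th1)
    and "((\<lambda>w. a * w^2) has_field_derivative (2 * a * w)) (at w)"
    and "w \<noteq> 0 \<Longrightarrow> ((\<lambda>w. a / w) has_field_derivative (- a / w^2)) (at w)"
proof -
  show 1: "((\<lambda>w. a / w) has_field_derivative (- a / w^2)) (at w)" if "w \<noteq> 0" for a w :: complex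
    using DERIV_cmult[OF DERIV_inverse[OF that], of a]
    by (simp add: divide_inverse power2_eq_square power_inverse)
  show 2: "((\<lambda>w. a * w^2) has_field_derivative (2 * a * w)) (at w)" for a w :: complex
    by (auto intro!: derivative_eq_intros)
  show "((\<lambda>w. a / w + b * w^2) has_field_derivative (- a / w^2 + 2 * b * w)) (at w)" if "w \<noteq> 0"
    by (intro DERIV_add 1 2 that)
  show ?th1
    by (auto intro!: derivative_eq_intros)
  have "((\<lambda>w. a / w^2) has_field_derivative (- 2 * a / w ^ 3)) (at w)" if "w \<noteq> 0"
  proof -
    have "((\<lambda>w. w^2) has_field_derivative 2 * w) (at w)" using 2[of 1 w] by simp
    from DERIV_chain2[OF 1[of "w^2" a] this] that
    have "((\<lambda>w. a / w^2) has_field_derivative - a / (w^2)^2 * (2 * w)) (at w)" by simp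
    also have "- a / (w^2)^2 * (2 * w) = - 2 * a / w ^ 3"
      using that by (simp add: power2_eq_square power3_eq_cube mult.commute)
    finally show ?thesis .
  qed
  thus "((\<lambda>w. a / w^2 + b * w) has_field_derivative (- 2 * a / w ^ 3 + b)) (at w)" if "w \<noteq> 0"
    using DERIV_add[OF _ DERIV_cmult[OF DERIV_ident, of b]] that by fastforce
qed

lemma partial_prepotential:
  assumes "Z $ 0 \<noteq> 0"
  shows "partial 0 (prepotential c) Z = (Z $ 1) ^ 3 / (6 * (Z $ 0)^2) + of_int c * (Z $ 0 * of_real zeta3 / (2 * pi * \<i>) ^ 3)" (is ?th1)
    and "partial 1 (prepotential c) Z = - (Z $ 1)\<^sup>2 / (2 * Z $ 0)" (is ?th2)
proof -
  define K :: complex where "K = of_int c * of_real zeta3 / (2 * of_real pi * \<i>) ^ 3"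
  have F: "prepotential c Y = - (1 / 6) * (Y $ 1) ^ 3 / Y $ 0 + K * (Y $ 0)^2 / 2" for Y
    by (simp add: prepotential_def K_def mult_ac)
  have "((\<lambda>w. - (1 / 6) * (Z $ 1) ^ 3 / w + K * w^2 / 2) has_field_derivative
     ((Z $ 1) ^ 3 / (6 * (Z $ 0)^2) + K * Z $ 0)) (at (Z $ 0))"
    using laurent_derivatives(1)[OF assms, of "- (1 / 6) * (Z $ 1) ^ 3" "K / 2"] by simp
  thus ?th1
    unfolding partial_def F by (simp add: DERIV_imp_deriv K_def)
  have "((\<lambda>w. - (1 / 6) * w ^ 3 / Z $ 0 + K * (Z $ 0)^2 / 2) has_field_derivative
     (- (Z $ 1)\<^sup>2 / (2 * Z $ 0))) (at (Z $ 1))"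
    using laurent_derivatives(3)[of "- (1 / 6) / Z $ 0" "K * (Z $ 0)^2 / 2" "Z $ 1"] by simp
  thus ?th2
    unfolding partial_def F by (simp add: DERIV_imp_deriv)
qed

text \<open>Since (2 pi i)^3 = -i (2 pi)^3, the zeta(3) correction is purely imaginary and enters
  the entry 00 alone.\<close>

lemma tau_prepotential:
  assumes Z: "Z $ 0 \<noteq> 0"
  defines "z \<equiv> Z $ 1 / Z $ 0"
  shows "tau (prepotential c) Z $ 0 $ 0 = - (z ^ 3) / 3 + \<i> * of_real (of_int c * zeta3 / (2 * pi) ^ 3)" (is ?th1)
    and "tau (prepotential c) Z $ 0 $ 1 = z^2 / 2" (is ?th2)
    and "tau (prepotential c) Z $ 1 $ 0 = z^2 / 2" (is ?th3)
    and "tau (prepotential c) Z $ 1 $ 1 = - z"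
proof -
  define K :: complex where "K = of_int c * of_real zeta3 / (2 * of_real pi * \<i>) ^ 3"
  have K: "K = \<i> * of_real (of_int c * zeta3 / (2 * pi) ^ 3)"
  proof -
    have "(2 * complex_of_real pi * \<i>) ^ 3 = - \<i> * of_real ((2 * pi) ^ 3)"
      by (simp add: power_mult_distrib power3_eq_cube)
    moreover have "1 / (- \<i> * r) = \<i> * (1 / r)" for r :: complex
      by (cases "r = 0") (auto simp: divide_simps)
    ultimately show ?thesis unfolding K_def
      by (metis (no_types, lifting) of_real_divide of_real_mult of_real_of_int_eq mult.left_commute times_divide_eq_right mult.right_neutral)
  qed
  have op: "open (- {0::complex})" by (rule open_Compl) simp
  have P0: "partial 0 (prepotential c) Y = (Y $ 1) ^ 3 / (6 * (Y $ 0)^2) + K * Y $ 0"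
    and P1: "partial 1 (prepotential c) Y = - (Y $ 1)\<^sup>2 / (2 * Y $ 0)" if "Y $ 0 \<noteq> 0" for Y
    using partial_prepotential[OF that, of c] by (simp_all add: K_def)
  have "((\<lambda>w. (Z $ 1) ^ 3 / (6 * w^2) + K * w) has_field_derivative (- (z ^ 3) / 3 + K)) (at (Z $ 0))"
    using laurent_derivatives(2)[OF Z, of "(Z $ 1) ^ 3 / 6" K] by (simp add: z_def power_divide mult.commute)
  \<comment> \<open>The closed form of the inner derivative holds only for Z^0 \<noteq> 0, so the
    outer one is transferred on that open set.\<close>
  hence "((\<lambda>w. partial 0 (prepotential c) (\<chi> k. if k = 0 then w else Z $ k)) has_field_derivative (- (z ^ 3) / 3 + K)) (at (Z $ 0))"
    by (rule has_field_derivative_transform_within_open[OF _ op]) (use Z in \<open>auto simp: P0\<close>)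
  thus ?th1
    unfolding K[symmetric] by (simp add: tau_def partial_def[of 0 "partial 0 (prepotential c)"] DERIV_imp_deriv)
  have "((\<lambda>w. - (Z $ 1)\<^sup>2 / (2 * w)) has_field_derivative (z^2 / 2)) (at (Z $ 0))"
    using laurent_derivatives(5)[OF Z, of "- (Z $ 1)\<^sup>2 / 2"] by (simp add: z_def power_divide mult.commute)
  hence "((\<lambda>w. partial 1 (prepotential c) (\<chi> k. if k = 0 then w else Z $ k)) has_field_derivative (z^2 / 2)) (at (Z $ 0))"
    by (rule has_field_derivative_transform_within_open[OF _ op]) (use Z in \<open>auto simp: P1\<close>)
  thus ?th2
    by (simp add: tau_def partial_def[of 0 "partial 1 (prepotential c)"] DERIV_imp_deriv)
  have "((\<lambda>w. w ^ 3 / (6 * (Z $ 0)^2) + K * Z $ 0) has_field_derivative (z^2 / 2)) (at (Z $ 1))"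
    using laurent_derivatives(3)[of "1 / (6 * (Z $ 0)^2)" "K * Z $ 0" "Z $ 1"] by (simp add: z_def power_divide mult.commute)
  thus ?th3
    using Z by (simp add: tau_def partial_def[of 1 "partial 0 (prepotential c)"] P0 DERIV_imp_deriv)
  have "((\<lambda>w. - w\<^sup>2 / (2 * Z $ 0)) has_field_derivative (- z)) (at (Z $ 1))"
    using laurent_derivatives(4)[of "- 1 / (2 * Z $ 0)" "Z $ 1"] by (simp add: z_def)
  thus "tau (prepotential c) Z $ 1 $ 1 = - z"
    using Z by (simp add: tau_def partial_def[of 1 "partial 1 (prepotential c)"] P1 DERIV_imp_deriv)
qed

lemma Im_tau_prepotential:
  assumes Z: "Z $ 0 \<noteq> 0"
  defines "b \<equiv> Re (Z $ 1 / Z $ 0)" and "t \<equiv> Im (Z $ 1 / Z $ 0)"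
  shows "Im_tau (prepotential c) Z $ 0 $ 0 = t ^ 3 / 3 - b\<^sup>2 * t + of_int c * zeta3 / (2 * pi) ^ 3" (is ?th1)
    and "Im_tau (prepotential c) Z $ 0 $ 1 = b * t" (is ?th2)
    and "Im_tau (prepotential c) Z $ 1 $ 0 = b * t"
    and "Im_tau (prepotential c) Z $ 1 $ 1 = - t"
proof -
  have z: "Z $ 1 / Z $ 0 = Complex b t" by (simp add: b_def t_def)
  show ?th1
    by (simp add: Im_tau_def tau_prepotential[OF Z] z power2_eq_square power3_eq_cube Im_divide_numeral field_simps)
  show ?th2 "Im_tau (prepotential c) Z $ 1 $ 0 = b * t"
    "Im_tau (prepotential c) Z $ 1 $ 1 = - t"
    by (simp_all add: Im_tau_def tau_prepotential[OF Z] z power2_eq_square Im_divide_numeral)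
qed

text \<open>The dependence on b cancels: t^3/3 - b^2 t + 2 b^2 t - t (b^2 + t^2) = -2 t^3/3.\<close>

lemma r_sq_prepotential:
  assumes Z: "Z $ 0 \<noteq> 0"
  shows "r_sq (prepotential c) Z = of_real ((cmod (Z $ 0))^2 * (2 * Im (Z $ 1 / Z $ 0) ^ 3 / 3 - of_int c * zeta3 / (2 * pi) ^ 3))"
proof -
  define b t where "b = Re (Z $ 1 / Z $ 0)" and "t = Im (Z $ 1 / Z $ 0)"
  have Z1: "Z $ 1 = Complex b t * Z $ 0"
  proof -
    have "Z $ 1 / Z $ 0 = Complex b t" by (simp add: b_def t_def)
    thus ?thesis using Z by (simp add: field_simps)
  qed
  have *: "r_sq (prepotential c) Z = - (Z $ 0 * cnj (Z $ 0)) * (of_real (Im_tau (prepotential c) Z $ 0 $ 0)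
     + of_real (b * t) * (Complex b t + cnj (Complex b t)) - of_real t * (Complex b t * cnj (Complex b t)))"
    unfolding r_sq_def sum_UNIV_2 Im_tau_prepotential(2-4)[OF Z] b_def[symmetric] t_def[symmetric]
    unfolding Z1 by (simp add: algebra_simps)
  have e: "of_real (Im_tau (prepotential c) Z $ 0 $ 0)
     + of_real (b * t) * (Complex b t + cnj (Complex b t)) - of_real t * (Complex b t * cnj (Complex b t)) =
     complex_of_real (- (2 * t ^ 3 / 3 - of_int c * zeta3 / (2 * pi) ^ 3))"
    unfolding Im_tau_prepotential(1)[OF Z] b_def[symmetric] t_def[symmetric]
    by (simp add: complex_eq_iff power2_eq_square power3_eq_cube algebra_simps)
  have n: "Z $ 0 * cnj (Z $ 0) = of_real ((cmod (Z $ 0))^2)" by (rule complex_norm_square[symmetric])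
  show ?thesis unfolding * e n t_def[symmetric] by (simp only: of_real_minus of_real_mult minus_mult_minus)
qed

lemma f_fun_prepotential:
  assumes p: "crdZ 0 p \<noteq> 0"
  shows "f_fun (prepotential c) c a p = of_real (2 * pi * ((cmod (crdZ 0 p))^2 * (2 * Im (crdZ 1 p / crdZ 0 p) ^ 3 / 3 - of_int c * zeta3 / (2 * pi) ^ 3)
    - 8 * a - of_int c * inst_G (crd\<zeta> 0 p) (cmod (crdZ 0 p)) / (2 * pi^2)))"
proof -
  have "(\<Sum>\<^sub>\<infinity>q\<in>-{0::int}. \<eta>_inst q p (V_field p)) = \<i> / (8 * pi^2) * of_real (inst_G (crd\<zeta> 0 p) (cmod (crdZ 0 p))) * (4 * \<i>)"
    using infsumI[OF sum_\<eta>_inst[OF p]] dlog_diff_V_field[OF p] by simp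
  also have "\<dots> = of_real (- inst_G (crd\<zeta> 0 p) (cmod (crdZ 0 p)) / (2 * pi^2))" by simp
  finally show ?thesis
    using p by (simp add: f_fun_def r_sq_prepotential crdZ_def)
qed

section \<open>The differential of f\<close>

lemma cmod_component_has_derivative:
  assumes "Z $ i = of_real y" "y > 0"
  shows "((\<lambda>Z::complex^2. cmod (Z $ i)) has_derivative (\<lambda>v. Re (v $ i))) (at Z)"
proof -
  have 1: "((\<lambda>Z::complex^2. Z $ i) has_derivative (\<lambda>v. v $ i)) (at Z)"
    by (rule bounded_linear_imp_has_derivative) (rule bounded_linear_vec_nth)
  have "(norm has_derivative (\<lambda>h. h \<bullet> sgn (Z $ i))) (at (Z $ i))"
    using assms by (intro has_derivative_norm) auto
  from has_derivative_compose[OF 1 this]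
  show ?thesis using assms by (simp add: sgn_of_real inner_complex_def)
qed

lemma Im_ratio_has_derivative:
  assumes "Z $ 0 = of_real y" "y > 0"
  shows "((\<lambda>Z::complex^2. Im (Z $ 1 / Z $ 0)) has_derivative (\<lambda>v. Im (v $ 1 - Z $ 1 / Z $ 0 * v $ 0) / y)) (at Z)"
proof -
  have n: "((\<lambda>Z::complex^2. Z $ i) has_derivative (\<lambda>v. v $ i)) (at Z)" for i
    by (rule bounded_linear_imp_has_derivative) (rule bounded_linear_vec_nth)
  have "((\<lambda>Z::complex^2. Im (Z $ 1 / Z $ 0)) has_derivative
     (\<lambda>v. Im ((v $ 1 * Z $ 0 - Z $ 1 * v $ 0) / (Z $ 0 * Z $ 0)))) (at Z)"
    using assms by (intro bounded_linear.has_derivative[OF bounded_linear_Im] has_derivative_divide' n) auto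
  also have "(\<lambda>v::complex^2. Im ((v $ 1 * Z $ 0 - Z $ 1 * v $ 0) / (Z $ 0 * Z $ 0))) = (\<lambda>v. Im (v $ 1 - Z $ 1 / Z $ 0 * v $ 0) / y)"
  proof (rule ext)
    fix v :: "complex^2"
    have "(v $ 1 * Z $ 0 - Z $ 1 * v $ 0) / (Z $ 0 * Z $ 0) = (v $ 1 - Z $ 1 / Z $ 0 * v $ 0) / of_real y"
      using assms by (simp add: field_simps)
    thus "Im ((v $ 1 * Z $ 0 - Z $ 1 * v $ 0) / (Z $ 0 * Z $ 0)) = Im (v $ 1 - Z $ 1 / Z $ 0 * v $ 0) / y"
      by (simp add: Im_divide_of_real)
  qed
  finally show ?thesis .
qed

lemma r_sq_real_has_derivative:
  fixes Z :: "complex^2" and y k :: real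
  assumes Z: "Z $ 0 = of_real y" "y > 0"
  defines "t \<equiv> Im (Z $ 1 / Z $ 0)"
  shows "((\<lambda>Z. (cmod (Z $ 0))^2 * (2 * Im (Z $ 1 / Z $ 0) ^ 3 / 3 - k)) has_derivative
    (\<lambda>v. 2 * y * Re (v $ 0) * (2 * t ^ 3 / 3 - k) + y * (2 * t^2 * Im (v $ 1 - Z $ 1 / Z $ 0 * v $ 0)))) (at Z)"
proof -
  note d = cmod_component_has_derivative[OF Z] Im_ratio_has_derivative[OF Z]
  have 2: "((\<lambda>Z::complex^2. 2 * Im (Z $ 1 / Z $ 0) ^ 3 / 3 - k) has_derivative
     (\<lambda>v. 2 * t^2 * (Im (v $ 1 - Z $ 1 / Z $ 0 * v $ 0) / y))) (at Z)"
  proof -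
    have "((\<lambda>Z::complex^2. 2 / 3 * Im (Z $ 1 / Z $ 0) ^ 3 - k) has_derivative
     (\<lambda>v. 2 / 3 * (of_nat 3 * (Im (v $ 1 - Z $ 1 / Z $ 0 * v $ 0) / y) * t ^ (3 - 1)) - 0)) (at Z)"
      unfolding t_def by (intro has_derivative_diff has_derivative_mult_right has_derivative_power d has_derivative_const)
    moreover have "2 / 3 * (of_nat 3 * r * t ^ (3 - 1)) - 0 = 2 * t^2 * r" for r by simp
    ultimately show ?thesis by (simp only: times_divide_eq_left)
  qed
  have 1: "((\<lambda>Z::complex^2. (cmod (Z $ 0))^2) has_derivative (\<lambda>v. 2 * y * Re (v $ 0))) (at Z)"
    by (rule derivative_eq_intros d refl)+ (use Z in \<open>simp add: fun_eq_iff\<close>)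
  have "((\<lambda>Z::complex^2. (cmod (Z $ 0))^2 * (2 * Im (Z $ 1 / Z $ 0) ^ 3 / 3 - k)) has_derivative
    (\<lambda>v. (cmod (Z $ 0))^2 * (2 * t^2 * (Im (v $ 1 - Z $ 1 / Z $ 0 * v $ 0) / y)) + 2 * y * Re (v $ 0) * (2 * Im (Z $ 1 / Z $ 0) ^ 3 / 3 - k))) (at Z)"
    by (rule has_derivative_mult[OF 1 2])
  moreover have "(cmod (Z $ 0))^2 * (2 * t^2 * (r / y)) + s = s + y * (2 * t^2 * r)" for r s :: real
    using Z by (simp add: power2_eq_square)
  ultimately show ?thesis by (simp only: t_def[symmetric])
qed

text \<open>Taken in all ambient directions but only at points with Z^0 = y > 0, where d|Z^0| is Re
  dZ^0. The closed form of f is valid on the open set Z^0 \<noteq> 0, which suffices.\<close>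

lemma f_fun_has_derivative:
  fixes p :: point and a y :: real and c :: int
  assumes p: "crdZ 0 p = of_real y" and y: "y > 0"
  defines "z \<equiv> crdZ 1 p / crdZ 0 p" and "k \<equiv> of_int c * zeta3 / (2 * pi) ^ 3"
  shows "(f_fun (prepotential c) c a has_derivative (\<lambda>v. of_real (2 * pi * (2 * y * Re (crdZ 0 v) * (2 * Im z ^ 3 / 3 - k)
     + y * (2 * (Im z)^2 * Im (crdZ 1 v - z * crdZ 0 v))
     - of_int c / (2 * pi^2) * (inst_Gx (crd\<zeta> 0 p) y * crd\<zeta> 0 v + inst_Gy (crd\<zeta> 0 p) y * Re (crdZ 0 v)))))) (at p)" (is "(_ has_derivative ?D) _")
proof -
  have Z: "fst p $ 0 = of_real y" using p by (simp add: crdZ_def)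
  have fst: "(fst has_derivative fst) (at p)" by (rule bounded_linear_imp_has_derivative[OF bounded_linear_fst])
  have 1: "((\<lambda>p::point. (cmod (crdZ 0 p))^2 * (2 * Im (crdZ 1 p / crdZ 0 p) ^ 3 / 3 - k)) has_derivative
     (\<lambda>v. 2 * y * Re (crdZ 0 v) * (2 * Im z ^ 3 / 3 - k) + y * (2 * (Im z)^2 * Im (crdZ 1 v - z * crdZ 0 v)))) (at p)"
    using has_derivative_compose[OF fst r_sq_real_has_derivative[OF Z y, of k]] unfolding crdZ_def z_def .
  have N: "((\<lambda>p::point. cmod (crdZ 0 p)) has_derivative (\<lambda>v. Re (crdZ 0 v))) (at p)"
    using has_derivative_compose[OF fst cmod_component_has_derivative[OF Z y]] unfolding crdZ_def .
  have bl: "bounded_linear (crd\<zeta> 0)"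
    unfolding crd\<zeta>_def[abs_def]
    by (intro bounded_linear_compose[OF bounded_linear_vec_nth] bounded_linear_compose[OF bounded_linear_fst] bounded_linear_snd)
  have "((\<lambda>p::point. (crd\<zeta> 0 p, cmod (crdZ 0 p))) has_derivative (\<lambda>v. (crd\<zeta> 0 v, Re (crdZ 0 v)))) (at p)"
    by (intro has_derivative_Pair N bounded_linear_imp_has_derivative bl)
  moreover have "cmod (crdZ 0 p) = y" using p y by simp
  ultimately have 2: "((\<lambda>p::point. inst_G (crd\<zeta> 0 p) (cmod (crdZ 0 p))) has_derivative
     (\<lambda>v. inst_Gx (crd\<zeta> 0 p) y * crd\<zeta> 0 v + inst_Gy (crd\<zeta> 0 p) y * Re (crdZ 0 v))) (at p)"
    using has_derivative_compose[of "\<lambda>p::point. (crd\<zeta> 0 p, cmod (crdZ 0 p))" _ p UNIV "\<lambda>(x, y). inst_G x y"]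
      inst_G_has_derivative[OF y, of "crd\<zeta> 0 p"] by fastforce
  have "((\<lambda>p::point. complex_of_real (2 * pi * ((cmod (crdZ 0 p))^2 * (2 * Im (crdZ 1 p / crdZ 0 p) ^ 3 / 3 - k)
    - 8 * a - of_int c / (2 * pi^2) * inst_G (crd\<zeta> 0 p) (cmod (crdZ 0 p))))) has_derivative (\<lambda>v. of_real (2 * pi * (2 * y * Re (crdZ 0 v) * (2 * Im z ^ 3 / 3 - k)
     + y * (2 * (Im z)^2 * Im (crdZ 1 v - z * crdZ 0 v)) - 0
     - of_int c / (2 * pi^2) * (inst_Gx (crd\<zeta> 0 p) y * crd\<zeta> 0 v + inst_Gy (crd\<zeta> 0 p) y * Re (crdZ 0 v)))))) (at p)" (is "(?h has_derivative _) _")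
    by (intro bounded_linear.has_derivative[OF bounded_linear_of_real] has_derivative_mult_right has_derivative_diff 1 2 has_derivative_const)
  hence "(?h has_derivative ?D) (at p)"
    by (simp only: diff_0_right)
  thus ?thesis
  proof (rule has_derivative_transform_within_open)
    have "continuous_on UNIV (crdZ 0)" unfolding crdZ_def[abs_def] by (intro continuous_intros)
    thus "open {p. crdZ 0 p \<noteq> 0}" by (intro open_Collect_neq) auto
    show "p \<in> {p. crdZ 0 p \<noteq> 0}" using p y by simp
  qed (simp add: f_fun_prepotential k_def)
qed

section \<open>Bilinear forms\<close>

lemma bilinear_sym_prod: "linear \<alpha> \<Longrightarrow> linear \<beta> \<Longrightarrow> bilinear (sym_prod \<alpha> \<beta>)"
  unfolding bilinear_def sym_prod_def
  by (auto simp: linear_iff algebra_simps add_divide_distrib scaleR_conv_of_real)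

lemma bilinear_plus: "bilinear f \<Longrightarrow> bilinear g \<Longrightarrow> bilinear (\<lambda>u v. f u v + g u v)"
  unfolding bilinear_def by (auto intro: linear_compose_add)

lemma bilinear_minus: "bilinear f \<Longrightarrow> bilinear g \<Longrightarrow> bilinear (\<lambda>u v. f u v - g u v)"
  unfolding bilinear_def by (auto intro: linear_compose_sub)

lemma bilinear_cmult: "bilinear f \<Longrightarrow> bilinear (\<lambda>u v. (k::complex) * f u v)"
  unfolding bilinear_def by (auto simp: linear_iff algebra_simps)

lemma bilinear_comp_linear: "bilinear f \<Longrightarrow> linear L \<Longrightarrow> bilinear (\<lambda>u v. f (L u) (L v))"
  unfolding bilinear_def by (auto simp: linear_iff)

lemma sym_prod_commute: "sym_prod \<alpha> \<alpha> u v = sym_prod \<alpha> \<alpha> v u"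
  by (simp add: sym_prod_def add.commute mult.commute)

lemma sym_prod_Reals: "(\<And>v. \<alpha> v \<in> \<real>) \<Longrightarrow> sym_prod \<alpha> \<alpha> u v \<in> \<real>"
  by (simp add: sym_prod_def)

section \<open>The tensors at a point of the hypersurface\<close>

locale qmap_point =
  fixes c :: int and y b t :: real and p :: point
  assumes y: "y > 0" and t: "t > 0"
    and Z0: "crdZ 0 p = of_real y" and Z1: "crdZ 1 p = of_real y * Complex b t"
begin

abbreviation "F \<equiv> prepotential c"

definition "c3 = of_int c * zeta3 / (2 * pi) ^ 3"
definition "D = t ^ 3 / 3 + c3 + of_int c * inst_Gy (crd\<zeta> 0 p) y / (4 * pi^2 * y)"
definition "\<rho> = of_int c * inst_Gx (crd\<zeta> 0 p) y / (2 * pi^2)"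

lemma Z0_nz: "crdZ 0 p \<noteq> 0" "fst p $ 0 \<noteq> 0"
  using Z0 y by (auto simp: crdZ_def)

lemma ratio: "crdZ 1 p / crdZ 0 p = Complex b t" "fst p $ 1 / fst p $ 0 = Complex b t"
  using Z0 Z1 y by (auto simp: crdZ_def)

lemma cmod_Z0: "cmod (crdZ 0 p) = y" using Z0 y by simp

lemma T_mat_entries:
  "T_mat F c p $ 0 $ 0 = of_real (b^2 * t - D)" "T_mat F c p $ 0 $ 1 = of_real (- b * t)"
  "T_mat F c p $ 1 $ 0 = of_real (- b * t)" "T_mat F c p $ 1 $ 1 = of_real t"
  using infsumI[OF sum_V_inst[OF Z0_nz(1)]]
  by (simp_all add: T_mat_def Im_tau_prepotential[OF Z0_nz(2)] ratio cmod_Z0 D_def c3_def)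

text \<open>The A-part of the instanton form sees only the phase component Im dZ^0 / y. It vanishes
  on tangent vectors of the hypersurface but equals 2 on V, which is how \<open>\<rho>\<close>
  arises.\<close>

lemma W_tot_0: "W_tot F c 0 p v = of_real (crd\<zeta>t 0 v) - (- (Complex b t ^ 3) / 3 + \<i> * of_real c3) * of_real (crd\<zeta> 0 v)
   - (Complex b t)\<^sup>2 / 2 * of_real (crd\<zeta> 1 v) + of_real (\<rho> / 2 * (Im (crdZ 0 v) / y))
   - \<i> * of_real (of_int c * inst_Gy (crd\<zeta> 0 p) y / (4 * pi^2 * y) * crd\<zeta> 0 v)"
proof -
  have dl: "dlog_diff p v = 2 * \<i> * of_real (Im (crdZ 0 v) / y)"
    unfolding dlog_diff_def Z0 by (simp add: complex_eq_iff Re_divide_of_real Im_divide_of_real)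
  have "((\<lambda>q. of_int q * A_inst q p v + \<i> * of_real (crd\<zeta> 0 v) * ((of_int q)^2 * V_inst q p)) has_sum
     (- (\<i> / (8 * pi^2)) * of_real (inst_Gx (crd\<zeta> 0 p) y) * dlog_diff p v +
      \<i> * of_real (crd\<zeta> 0 v) * of_real (- inst_Gy (crd\<zeta> 0 p) y / (4 * pi^2 * y)))) (- {0::int})"
    using sum_A_inst[OF Z0_nz(1), of v] sum_V_inst[OF Z0_nz(1)] unfolding cmod_Z0
    by (intro has_sum_add has_sum_cmult_right)
  also have "(\<lambda>q. of_int q * A_inst q p v + \<i> * of_real (crd\<zeta> 0 v) * ((of_int q)^2 * V_inst q p)) =
     (\<lambda>q. of_int q * (A_inst q p v + \<i> * of_int q * V_inst q p * of_real (crd\<zeta> 0 v)))"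
    by (simp add: fun_eq_iff algebra_simps power2_eq_square)
  finally have "W_inst c 0 p v = of_int c * (- (\<i> / (8 * pi^2)) * of_real (inst_Gx (crd\<zeta> 0 p) y) * dlog_diff p v +
      \<i> * of_real (crd\<zeta> 0 v) * of_real (- inst_Gy (crd\<zeta> 0 p) y / (4 * pi^2 * y)))"
    unfolding W_inst_def by (simp add: infsumI)
  also have "\<dots> = of_real (\<rho> / 2 * (Im (crdZ 0 v) / y)) - \<i> * of_real (of_int c * inst_Gy (crd\<zeta> 0 p) y / (4 * pi^2 * y) * crd\<zeta> 0 v)"
    unfolding dl \<rho>_def by (simp add: algebra_simps)
  finally show ?thesis
    unfolding W_tot_def W_form_def sum_UNIV_2 tau_prepotential[OF Z0_nz(2)] ratio c3_def by (simp add: algebra_simps)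
qed

lemma W_tot_1: "W_tot F c 1 p v = of_real (crd\<zeta>t 1 v) - (Complex b t)\<^sup>2 / 2 * of_real (crd\<zeta> 0 v) + Complex b t * of_real (crd\<zeta> 1 v)"
  unfolding W_tot_def W_form_def W_inst_def sum_UNIV_2 tau_prepotential[OF Z0_nz(2)] ratio by simp

lemma linear_W_tot: "linear (W_tot F c i p)"
proof -
  have "linear (W_tot F c 0 p)" "linear (W_tot F c 1 p)"
    unfolding linear_iff W_tot_0 W_tot_1
    by (auto simp: algebra_simps add_divide_distrib scaleR_conv_of_real)
  thus ?thesis using forall_index_2[of "\<lambda>i. linear (W_tot F c i p)"] by blast
qed

lemma linear_crdZ: "linear (crdZ i)"
  by (auto simp: linear_iff scaleR_conv_of_real)

lemma linear_cnj_comp: "linear f \<Longrightarrow> linear (\<lambda>v. cnj (f v))"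
  by (auto simp: linear_iff scaleR_conv_of_real)

lemma W_tot_V_field: "W_tot F c 0 p (V_field p) = of_real \<rho>" "W_tot F c 1 p (V_field p) = 0"
  unfolding W_tot_0 W_tot_1 using y by (simp_all add: Z0)

text \<open>The components d zeta^0 and d zeta^1 are recovered from imaginary parts of W. This
  serves twice: to match df with the algebraic expression for \<open>\<theta>0\<close>, and to show
  that a vector annihilated by all forms is zero.\<close>

lemma Im_W_tot:
  "Im (W_tot F c 1 p v) = t * crd\<zeta> 1 v - b * t * crd\<zeta> 0 v"
  "Im (W_tot F c 0 p v) + b * Im (W_tot F c 1 p v) = - D * crd\<zeta> 0 v"
  unfolding W_tot_0 W_tot_1 D_def
  by (simp_all add: power2_eq_square power3_eq_cube Im_divide_numeral algebra_simps add_divide_distrib diff_divide_distrib)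

end

locale qmap_point_nondegenerate = qmap_point +
  assumes D: "D > 0"
begin

text \<open>The shear by b diagonalises T to diag(-D, t). Accordingly the W-part of the metric is
  |W_1|^2 / t - |W_0 + b W_1|^2 / D.\<close>

lemma T_mat_inverse:
  "matrix_inv (T_mat F c p) $ 0 $ 0 = of_real (- 1 / D)" (is ?th1) "matrix_inv (T_mat F c p) $ 0 $ 1 = of_real (- b / D)"
  "matrix_inv (T_mat F c p) $ 1 $ 0 = of_real (- b / D)" "matrix_inv (T_mat F c p) $ 1 $ 1 = of_real (1 / t - b\<^sup>2 / D)"
  and det_T_mat: "det (T_mat F c p) \<noteq> 0"
proof -
  define M :: "complex^2^2" where "M = (\<chi> i j. if i = 0 then (if j = 0 then of_real (- 1 / D) else of_real (- b / D))
     else (if j = 0 then of_real (- b / D) else of_real (1 / t - b\<^sup>2 / D)))"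
  have e: "(b^2 * t - D) * (- 1 / D) + (- b * t) * (- b / D) = 1" "(b^2 * t - D) * (- b / D) + (- b * t) * (1 / t - b\<^sup>2 / D) = 0"
    "(- b * t) * (- 1 / D) + t * (- b / D) = 0" "(- b * t) * (- b / D) + t * (1 / t - b\<^sup>2 / D) = 1"
    using D t by (simp_all add: field_simps power2_eq_square)
  have 1: "T_mat F c p ** M = mat 1"
    unfolding vec_eq_iff forall_index_2
    using e[THEN arg_cong[where f = complex_of_real]]
    by (simp add: matrix_matrix_mult_def mat_def sum_UNIV_2 M_def T_mat_entries) (simp add: add.commute)
  have 2: "M ** T_mat F c p = mat 1"
    using 1 by (simp add: matrix_left_right_inverse)
  have inv: "matrix_inv (T_mat F c p) = M"
  proof -
    have "T_mat F c p ** M = mat 1 \<and> M ** T_mat F c p = mat 1" using 1 2 by simp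
    hence "matrix_inv (T_mat F c p) ** T_mat F c p = mat 1"
      unfolding matrix_inv_def by (rule someI2) simp
    hence "(matrix_inv (T_mat F c p) ** T_mat F c p) ** M = M" by simp
    thus ?thesis by (simp add: matrix_mul_assoc[symmetric] 1)
  qed
  show ?th1 "matrix_inv (T_mat F c p) $ 0 $ 1 = of_real (- b / D)"
  "matrix_inv (T_mat F c p) $ 1 $ 0 = of_real (- b / D)" "matrix_inv (T_mat F c p) $ 1 $ 1 = of_real (1 / t - b\<^sup>2 / D)"
    unfolding inv M_def by simp_all
  have "det (T_mat F c p) * det M = 1" using 1 det_mul[of "T_mat F c p" M] by simp
  thus "det (T_mat F c p) \<noteq> 0" by auto
qed

lemma g_N_eq:
  "g_N F c p u v = of_real (2 * pi * (
      (b^2 * t - D) * Re (crdZ 0 u * cnj (crdZ 0 v)) - b * t * (Re (crdZ 0 u * cnj (crdZ 1 v)) + Re (crdZ 1 u * cnj (crdZ 0 v)))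
      + t * Re (crdZ 1 u * cnj (crdZ 1 v))
      - 1 / D * Re (W_tot F c 0 p u * cnj (W_tot F c 0 p v))
      - b / D * (Re (W_tot F c 0 p u * cnj (W_tot F c 1 p v)) + Re (W_tot F c 1 p u * cnj (W_tot F c 0 p v)))
      + (1 / t - b\<^sup>2 / D) * Re (W_tot F c 1 p u * cnj (W_tot F c 1 p v))))"
proof -
  let ?s = "\<lambda>\<alpha> \<beta>. sym_prod \<alpha> (\<lambda>w. cnj (\<beta> w)) u v" and ?r = "\<lambda>\<alpha> \<beta>. Re (\<alpha> u * cnj (\<beta> v))"
  have re: "sym_prod \<alpha> (\<lambda>w. cnj (\<alpha> w)) u v = of_real (Re (\<alpha> u * cnj (\<alpha> v)))" for \<alpha> :: "point \<Rightarrow> complex"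
    by (simp add: sym_prod_def complex_eq_iff)
  have re2: "sym_prod \<alpha> (\<lambda>w. cnj (\<beta> w)) u v + sym_prod \<beta> (\<lambda>w. cnj (\<alpha> w)) u v =
      of_real (Re (\<alpha> u * cnj (\<beta> v)) + Re (\<beta> u * cnj (\<alpha> v)))" for \<alpha> \<beta> :: "point \<Rightarrow> complex"
    by (simp add: sym_prod_def complex_eq_iff field_simps)
  have "g_N F c p u v = of_real (2 * pi) * (
      of_real (b^2 * t - D) * ?s (crdZ 0) (crdZ 0)
      + of_real (- b * t) * (?s (crdZ 0) (crdZ 1) + ?s (crdZ 1) (crdZ 0))
      + of_real t * ?s (crdZ 1) (crdZ 1)
      + of_real (- 1 / D) * ?s (W_tot F c 0 p) (W_tot F c 0 p)
      + of_real (- b / D) * (?s (W_tot F c 0 p) (W_tot F c 1 p) + ?s (W_tot F c 1 p) (W_tot F c 0 p))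
      + of_real (1 / t - b\<^sup>2 / D) * ?s (W_tot F c 1 p) (W_tot F c 1 p))"
    unfolding g_N_def sum_UNIV_2 T_mat_entries T_mat_inverse by (simp only: distrib_left add_ac)
  also have "\<dots> = of_real (2 * pi * (
      (b^2 * t - D) * ?r (crdZ 0) (crdZ 0) + (- b * t) * (?r (crdZ 0) (crdZ 1) + ?r (crdZ 1) (crdZ 0))
      + t * ?r (crdZ 1) (crdZ 1)
      + (- 1 / D) * ?r (W_tot F c 0 p) (W_tot F c 0 p)
      + (- b / D) * (?r (W_tot F c 0 p) (W_tot F c 1 p) + ?r (W_tot F c 1 p) (W_tot F c 0 p))
      + (1 / t - b\<^sup>2 / D) * ?r (W_tot F c 1 p) (W_tot F c 1 p)))"
    unfolding re re2 by (simp only: of_real_mult of_real_add of_real_numeral)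
  finally show ?thesis by (simp only: minus_mult_left[symmetric] minus_divide_left[symmetric] diff_conv_add_uminus[symmetric] mult_minus_left)
qed

lemma bilinear_g_N: "bilinear (g_N F c p)"
  unfolding g_N_def[abs_def] sum_UNIV_2
  by (intro bilinear_plus bilinear_cmult bilinear_sym_prod linear_cnj_comp linear_crdZ linear_W_tot)

lemma g_N_V_V: "g_N F c p (V_field p) (V_field p) = of_real (2 * pi * (4 * y^2 * (t ^ 3 - D) - \<rho>\<^sup>2 / D))"
  unfolding g_N_eq W_tot_V_field
  by (simp add: Z0 Z1 power2_eq_square power3_eq_cube algebra_simps)

lemma g_N_commute: "g_N F c p u v = g_N F c p v u"
  unfolding g_N_eq by (simp add: algebra_simps)

lemma has_signature_Im_tau: "has_signature (Im_tau F (fst p)) 1 1" if c3: "c3 \<ge> 0"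
proof -
  \<comment> \<open>The same shear by b, now diagonalising Im tau to diag(t^3/3 + c3, -t).\<close>
  define P :: "real^2^2" where "P = (\<chi> i j. if i = j then 1 else if i = 1 then b else 0)"
  define Q :: "real^2^2" where "Q = (\<chi> i j. if i = j then 1 else if i = 1 then - b else 0)"
  note I = Im_tau_prepotential[OF Z0_nz(2), of c, unfolded ratio complex.sel, folded c3_def]
  have PQ: "P ** Q = mat 1" unfolding vec_eq_iff forall_index_2
    by (simp add: matrix_matrix_mult_def mat_def sum_UNIV_2 P_def Q_def)
  hence inv: "invertible P" unfolding invertible_def using matrix_left_right_inverse by blast
  have D': "(transpose P ** Im_tau F (fst p) ** P) $ 0 $ 0 = t ^ 3 / 3 + c3"
    "(transpose P ** Im_tau F (fst p) ** P) $ 1 $ 1 = - t"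
    "(transpose P ** Im_tau F (fst p) ** P) $ 0 $ 1 = 0" "(transpose P ** Im_tau F (fst p) ** P) $ 1 $ 0 = 0"
    by (simp_all add: matrix_matrix_mult_def transpose_def sum_UNIV_2 P_def I power2_eq_square algebra_simps)
  have pos: "t ^ 3 / 3 + c3 > 0" using t c3 by (simp add: add_pos_nonneg)
  have "{i. (transpose P ** Im_tau F (fst p) ** P) $ i $ i > 0} = {0}" 
    using D' pos t forall_index_2[of "\<lambda>i. (transpose P ** Im_tau F (fst p) ** P) $ i $ i > 0 \<longleftrightarrow> i = 0"] by auto
  moreover have "{i. (transpose P ** Im_tau F (fst p) ** P) $ i $ i < 0} = {1}" 
    using D' pos t forall_index_2[of "\<lambda>i. (transpose P ** Im_tau F (fst p) ** P) $ i $ i < 0 \<longleftrightarrow> i = 1"] by auto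
  moreover have "\<forall>i j. i \<noteq> j \<longrightarrow> (transpose P ** Im_tau F (fst p) ** P) $ i $ j = 0"
    unfolding forall_index_2 using D' by simp
  moreover have "transpose (Im_tau F (fst p)) = Im_tau F (fst p)"
    unfolding vec_eq_iff forall_index_2 by (simp add: transpose_def I)
  ultimately show ?thesis unfolding has_signature_def using inv
    by (intro conjI exI[of _ P] exI[of _ "transpose P ** Im_tau F (fst p) ** P"]) auto
qed

end

section \<open>Reality, linearity and definiteness of the ambient tensor\<close>

context qmap_point_nondegenerate
begin

text \<open>For the reality of \<open>dc\<close>: although \<open>r_sq\<close> is complex-valued, it
  agrees with a real expression on the open set Z^0 \<noteq> 0, so its Frechet derivative is real as
  well.\<close>

lemma r_sq_derivative_real: "\<exists>R'. frechet_derivative (r_sq F) (at (fst p)) = (\<lambda>v. of_real (R' v))"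
proof -
  have Z: "fst p $ 0 = of_real y" using Z0 by (simp add: crdZ_def)
  obtain R' where R': "((\<lambda>Z. (cmod (Z $ 0))^2 * (2 * Im (Z $ 1 / Z $ 0) ^ 3 / 3 - of_int c * zeta3 / (2 * pi) ^ 3)) has_derivative R') (at (fst p))"
    using r_sq_real_has_derivative[OF Z y] by blast
  have "((\<lambda>Z::complex^2. complex_of_real ((cmod (Z $ 0))^2 * (2 * Im (Z $ 1 / Z $ 0) ^ 3 / 3 - of_int c * zeta3 / (2 * pi) ^ 3)))
      has_derivative (\<lambda>v. of_real (R' v))) (at (fst p))"
    by (rule bounded_linear.has_derivative[OF bounded_linear_of_real R'])
  hence "(r_sq F has_derivative (\<lambda>v. of_real (R' v))) (at (fst p))"
  proof (rule has_derivative_transform_within_open)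
    show "open {Z::complex^2. Z $ 0 \<noteq> 0}" by (intro open_Collect_neq continuous_intros)
    show "fst p \<in> {Z. Z $ 0 \<noteq> 0}" using Z0_nz by simp
  qed (simp add: r_sq_prepotential)
  thus ?thesis using frechet_derivative_at by metis
qed

lemma dc_r_sq_Reals: "dc (r_sq F) (fst p) w \<in> \<real>"
proof -
  obtain R' where R': "frechet_derivative (r_sq F) (at (fst p)) = (\<lambda>v. complex_of_real (R' v))"
    using r_sq_derivative_real by blast
  show ?thesis unfolding dc_def del_def delbar_def sum_UNIV_2 R'
    by (simp add: complex_is_Real_iff algebra_simps)
qed

lemma linear_dc: "linear (dc h Z)"
proof -
  have "linear (\<lambda>v::complex^2. \<i> * ((k0 * cnj (v $ 0) + k1 * cnj (v $ 1)) - (l0 * v $ 0 + l1 * v $ 1)))" for k0 k1 l0 l1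
    by (auto simp: linear_iff algebra_simps scaleR_conv_of_real[where 'a = complex])
  thus ?thesis unfolding dc_def[abs_def] del_def delbar_def sum_UNIV_2 .
qed

lemma \<theta>3_eq: "\<theta>3 F c p v = of_real (pi * (crd\<sigma> v + (\<Sum>i\<in>UNIV. crd\<zeta>t i p * crd\<zeta> i v - crd\<zeta> i p * crd\<zeta>t i v)))
    + of_real (pi / 2) * dc (r_sq F) (fst p) (fst v) - of_real (of_int c * inst_G (crd\<zeta> 0 p) y * Im (crdZ 0 v) / (2 * pi * y))"
proof -
  have dl: "dlog_diff p v = 2 * \<i> * of_real (Im (crdZ 0 v) / y)"
    unfolding dlog_diff_def Z0 by (simp add: complex_eq_iff Re_divide_of_real Im_divide_of_real)
  have "(\<Sum>\<^sub>\<infinity>q\<in>-{0::int}. \<eta>_inst q p v) = \<i> / (8 * pi^2) * of_real (inst_G (crd\<zeta> 0 p) y) * (2 * \<i> * of_real (Im (crdZ 0 v) / y))"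
    using infsumI[OF sum_\<eta>_inst[OF Z0_nz(1)], of v] unfolding cmod_Z0 dl .
  thus ?thesis unfolding \<theta>3_def by (simp add: power2_eq_square mult_ac)
qed

lemma \<theta>3_Reals: "\<theta>3 F c p v \<in> \<real>"
  unfolding \<theta>3_eq by (intro Reals_add Reals_diff Reals_mult dc_r_sq_Reals Reals_of_real)

lemma linear_\<theta>3: "linear (\<theta>3 F c p)"
proof -
  have "dc (r_sq F) (fst p) (u + v) = dc (r_sq F) (fst p) u + dc (r_sq F) (fst p) v"
    "dc (r_sq F) (fst p) (r *\<^sub>R v) = of_real r * dc (r_sq F) (fst p) v" for u v r
    using linear_dc[of "r_sq F" "fst p"] by (auto simp: linear_iff scaleR_conv_of_real)
  thus ?thesis unfolding linear_iff \<theta>3_eq sum_UNIV_2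
    by (auto simp: algebra_simps add_divide_distrib scaleR_conv_of_real)
qed

lemma \<theta>0_eq: "\<theta>0 F c a p v = of_real (- pi * (2 * y * Re (crdZ 0 v) * (2 * t ^ 3 / 3 - c3)
     + y * (2 * t^2 * Im (crdZ 1 v - Complex b t * crdZ 0 v))
     - of_int c / (2 * pi^2) * (inst_Gx (crd\<zeta> 0 p) y * crd\<zeta> 0 v + inst_Gy (crd\<zeta> 0 p) y * Re (crdZ 0 v))))"
  unfolding \<theta>0_def frechet_derivative_at[OF f_fun_has_derivative[OF Z0 y], symmetric] ratio c3_def by simp

lemma linear_\<theta>0: "linear (\<theta>0 F c a p)"
  unfolding linear_iff \<theta>0_eq by (auto simp: algebra_simps scaleR_conv_of_real add_divide_distrib)

lemma \<omega>12_V: "\<omega>12 F c p (V_field p) v = 2 * of_real pi * (2 * \<i> * of_real y * (W_tot F c 0 p v + Complex b t * W_tot F c 1 p v) - of_real \<rho> * crdZ 0 v)"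
  unfolding \<omega>12_def sum_UNIV_2 wedge_def W_tot_V_field by (simp add: Z0 Z1 algebra_simps)

lemma linear_\<omega>12_V: "linear (\<omega>12 F c p (V_field p))"
  using linear_W_tot[of 0] linear_W_tot[of 1] unfolding linear_iff \<omega>12_V
  by (auto simp: algebra_simps scaleR_conv_of_real)

lemma linear_\<theta>1: "linear (\<theta>1 F c p)" and linear_\<theta>2: "linear (\<theta>2 F c p)"
  using linear_\<omega>12_V unfolding linear_iff \<theta>1_def \<theta>2_def \<omega>1_def \<omega>2_def
  by (auto simp: algebra_simps scaleR_conv_of_real add_divide_distrib)

lemma linear_\<eta>_form: "linear (\<eta>_form F c p)"
  using linear_\<theta>3 bilinear_g_N unfolding linear_iff \<eta>_form_def
  by (auto simp: bilinear_radd bilinear_rmul algebra_simps add_divide_distrib scaleR_conv_of_real)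

lemma \<eta>_form_Reals: "\<eta>_form F c p v \<in> \<real>"
  unfolding \<eta>_form_def g_N_eq using \<theta>3_Reals[of v] by (intro Reals_diff Reals_divide) auto

lemma bilinear_ambient: "bilinear (ambient_tensor F c a p)"
  unfolding ambient_tensor_def[abs_def]
  by (intro bilinear_plus bilinear_minus bilinear_cmult bilinear_sym_prod bilinear_g_N
      linear_\<eta>_form linear_\<theta>0 linear_\<theta>1 linear_\<theta>2 linear_\<theta>3)

lemma ambient_commute: "ambient_tensor F c a p u v = ambient_tensor F c a p v u"
  unfolding ambient_tensor_def g_N_commute[of u v] by (simp only: sym_prod_commute[of _ u v])

lemma ambient_Reals:
  assumes "f_fun F c a p \<in> \<real>"
  shows "ambient_tensor F c a p u v \<in> \<real>"
proof -
  have "f3_fun F c a p \<in> \<real>" unfolding f3_fun_def g_N_V_V using assms by (intro Reals_diff Reals_divide) auto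
  moreover have "g_N F c p u v \<in> \<real>" unfolding g_N_eq by (rule Reals_of_real)
  moreover have "\<theta>0 F c a p w \<in> \<real>" "\<theta>1 F c p w \<in> \<real>" "\<theta>2 F c p w \<in> \<real>" for w
    unfolding \<theta>0_eq \<theta>1_def \<theta>2_def by auto
  ultimately show ?thesis unfolding ambient_tensor_def using assms \<theta>3_Reals \<eta>_form_Reals
    by (intro Reals_mult Reals_add Reals_diff Reals_divide Reals_minus sym_prod_Reals Reals_1 Reals_numeral)
qed

text \<open>In a unitary coframe X1, X2, Y1, Y2 the metric \<open>g_N\<close> is 2 pi times a form
  of signature (2, 2) over the complex numbers. Every other ingredient is a component of v relative
  to V or the independent form \<open>\<theta>3\<close>, so the tensor becomes 2 pi / f times the
  form of \<open>quaternionic_quotient_form_definite\<close>. Here \<open>\<alpha>\<close> is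
  d\<tau>2 / \<tau>2 and \<open>\<delta>\<close> is dz; that \<open>\<alpha>\<close> is real
  expresses tangency to Arg Z^0 = 0.\<close>

lemma ambient_definite:
  fixes \<alpha> :: real and \<delta> :: complex
  assumes f: "f_fun F c a p = of_real f" "f > 0" and f3: "f - pi * (4 * y^2 * (t ^ 3 - D) - \<rho>\<^sup>2 / D) < 0"
    and v0: "crdZ 0 v = of_real (y * \<alpha>)" and v1: "crdZ 1 v = Complex b t * of_real (y * \<alpha>) + of_real y * \<delta>"
    and le: "Re (ambient_tensor F c a p v v) \<le> 0"
  shows "\<alpha> = 0 \<and> \<delta> = 0 \<and> W_tot F c 0 p v = 0 \<and> W_tot F c 1 p v = 0 \<and> \<theta>3 F c p v = 0"
proof -
  define W0 W1 where "W0 = W_tot F c 0 p v" and "W1 = W_tot F c 1 p v"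
  define f3 where "f3 = f - pi * (4 * y^2 * (t ^ 3 - D) - \<rho>\<^sup>2 / D)"
  have f3neg: "f3 < 0" using f3 by (simp add: f3_def)
  have f3_fun: "f3_fun F c a p = of_real f3"
    unfolding f3_fun_def f(1) g_N_V_V f3_def by simp
  define X1 X2 Y1 Y2 where "X1 = of_real (y * sqrt t) * (\<delta> + \<i> * of_real (t * \<alpha>))" and "X2 = W1 / of_real (sqrt t)"
    and "Y1 = complex_of_real (y * sqrt D * \<alpha>)" and "Y2 = (W0 + of_real b * W1) / of_real (sqrt D)"
  \<comment> \<open>Up to phases these are the components of V: X1(V) = -pp, X2(V) = 0, Y1(V) = i
    uu, Y2(V) = ss. Thus -E is the Hermitian pairing of v with V, and L collects the pairing through
    the form \<open>\<omega>12\<close>.\<close>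
  define pp uu ss where "pp = 2 * y * t * sqrt t" and "uu = 2 * y * sqrt D" and "ss = \<rho> / sqrt D"
  define E where "E = of_real pp * X1 - \<i> * of_real uu * Y1 + of_real ss * Y2"
  define L where "L = of_real uu * Y2 + \<i> * of_real ss * Y1 + \<i> * of_real pp * X2"
  define T where "T = Re (\<theta>3 F c p v) / pi"
  have st: "sqrt t * sqrt t = t" "sqrt t > 0" and sD: "sqrt D * sqrt D = D" "sqrt D > 0" using t D by auto
  have st': "sqrt t * (sqrt t * r) = t * r" and sD': "sqrt D * (sqrt D * r) = D * r" for r
    using st(1) sD(1) by (metis mult.assoc)+
  have E: "E = of_real (2 * y^2 * t^2) * (\<delta> + \<i> * of_real (t * \<alpha>)) - \<i> * of_real (2 * y^2 * D * \<alpha>) + of_real (\<rho> / D) * (W0 + of_real b * W1)"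
  proof -
    have e1: "pp * (y * sqrt t) = 2 * y^2 * t^2" by (simp add: pp_def power2_eq_square st' mult_ac)
    have e2: "uu * (y * sqrt D * \<alpha>) = 2 * y^2 * D * \<alpha>" by (simp add: uu_def power2_eq_square sD' mult_ac abs_of_pos[OF D])
    have e3: "ss / sqrt D = \<rho> / D" by (simp add: ss_def abs_of_pos[OF D])
    have "of_real pp * X1 = of_real (pp * (y * sqrt t)) * (\<delta> + \<i> * of_real (t * \<alpha>))"
      by (simp only: X1_def of_real_mult mult.assoc)
    moreover have "\<i> * of_real uu * Y1 = \<i> * of_real (uu * (y * sqrt D * \<alpha>))"
      by (simp only: Y1_def of_real_mult mult.assoc)
    moreover have "of_real ss * Y2 = of_real (ss / sqrt D) * (W0 + of_real b * W1)"
      by (simp only: Y2_def of_real_divide times_divide_eq_left times_divide_eq_right)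
    ultimately show ?thesis unfolding E_def e1 e2 e3 by (simp only:)
  qed
  have L: "L = of_real (2 * y) * (W0 + of_real b * W1) + \<i> * of_real (\<rho> * y * \<alpha>) + \<i> * of_real (2 * y * t) * W1"
  proof -
    have "of_real uu * Y2 = of_real (2 * y) * (W0 + of_real b * W1)" using sD(2) by (simp add: uu_def Y2_def)
    moreover have "of_real ss * Y1 = of_real (\<rho> * y * \<alpha>)" using sD(2) by (simp add: ss_def Y1_def)
    moreover have "of_real pp * X2 = of_real (2 * y * t) * W1" using st(2) by (simp add: pp_def X2_def)
    ultimately show ?thesis unfolding L_def by (simp add: mult.assoc)
  qed
  have X1n: "(cmod X1)^2 = y^2 * t * ((Re \<delta>)^2 + (Im \<delta> + t * \<alpha>)^2)"
    using st t by (simp add: X1_def norm_mult power_mult_distrib cmod_power2)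
  have X2n: "(cmod X2)^2 = ((Re W1)^2 + (Im W1)^2) / t"
    using t by (simp add: X2_def norm_divide power_divide cmod_power2)
  have Y1n: "(cmod Y1)^2 = y^2 * D * \<alpha>^2"
  proof -
    have "(sqrt D)^2 = D" using D by simp
    thus ?thesis unfolding Y1_def norm_of_real power2_abs by (simp only: power_mult_distrib)
  qed
  have Y2n: "(cmod Y2)^2 = ((Re W0 + b * Re W1)^2 + (Im W0 + b * Im W1)^2) / D"
    using D by (simp add: Y2_def norm_divide power_divide cmod_power2)
  have g: "g_N F c p v v = of_real (2 * pi * ((cmod X1)^2 + (cmod X2)^2 - (cmod Y1)\<^sup>2 - (cmod Y2)\<^sup>2))"
  proof -
    have 1: "(b^2 * t - D) * Re (crdZ 0 v * cnj (crdZ 0 v)) - b * t * (Re (crdZ 0 v * cnj (crdZ 1 v)) + Re (crdZ 1 v * cnj (crdZ 0 v)))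
      + t * Re (crdZ 1 v * cnj (crdZ 1 v)) = (cmod X1)^2 - (cmod Y1)\<^sup>2"
      unfolding X1n Y1n v0 v1 by (simp add: power2_eq_square algebra_simps)
    have e: "- (1 / D * A00) - b / D * (A01 + A10) + (1 / t - b\<^sup>2 / D) * A11 = A11 / t - (A00 + b * (A01 + A10) + b^2 * A11) / D" for A00 A01 A10 A11 :: real
      by (simp add: algebra_simps add_divide_distrib)
    have 2: "- (1 / D * Re (W0 * cnj W0)) - b / D * (Re (W0 * cnj W1) + Re (W1 * cnj W0))
      + (1 / t - b\<^sup>2 / D) * Re (W1 * cnj W1) = (cmod X2)^2 - (cmod Y2)\<^sup>2"
      unfolding e X2n Y2n by (simp add: power2_eq_square algebra_simps)
    show ?thesis unfolding g_N_eq W0_def[symmetric] W1_def[symmetric] using 1 2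
      by (intro arg_cong[where f = of_real] arg_cong[where f = "\<lambda>r. 2 * pi * r"]) linarith
  qed
  have gV: "g_N F c p (V_field p) v = of_real (- 2 * pi * Re E)"
  proof -
    have "(b^2 * t - D) * Re (crdZ 0 (V_field p) * cnj (crdZ 0 v)) - b * t * (Re (crdZ 0 (V_field p) * cnj (crdZ 1 v)) + Re (crdZ 1 (V_field p) * cnj (crdZ 0 v)))
      + t * Re (crdZ 1 (V_field p) * cnj (crdZ 1 v)) = - 2 * y^2 * t^2 * Re \<delta>"
      unfolding v0 v1 by (simp add: Z0 Z1 power2_eq_square algebra_simps)
    moreover have "Re E = 2 * y^2 * t^2 * Re \<delta> + \<rho> / D * (Re W0 + b * Re W1)"
      unfolding E by simp
    moreover have "1 / D * Re (of_real \<rho> * cnj W0) + b / D * (Re (of_real \<rho> * cnj W1) + Re (0 * cnj W0)) = \<rho> / D * (Re W0 + b * Re W1)"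
      by (simp add: algebra_simps add_divide_distrib)
    moreover have "(1 / t - b\<^sup>2 / D) * Re (0 * cnj W1) = 0" by simp
    ultimately have e: "(b^2 * t - D) * Re (crdZ 0 (V_field p) * cnj (crdZ 0 v)) - b * t * (Re (crdZ 0 (V_field p) * cnj (crdZ 1 v)) + Re (crdZ 1 (V_field p) * cnj (crdZ 0 v)))
      + t * Re (crdZ 1 (V_field p) * cnj (crdZ 1 v)) - 1 / D * Re (of_real \<rho> * cnj W0)
      - b / D * (Re (of_real \<rho> * cnj W1) + Re (0 * cnj W0)) + (1 / t - b\<^sup>2 / D) * Re (0 * cnj W1) = - Re E"
      by linarith
    show ?thesis unfolding g_N_eq W0_def[symmetric] W1_def[symmetric] W_tot_V_field e by simp
  qed
  \<comment> \<open>Here the analytic derivative of f meets the algebra: df involves d zeta^0, which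
    is expressed through the imaginary parts of W, and the result is 2 pi Im E.\<close>
  have t0: "\<theta>0 F c a p v = of_real (- pi * Im E)"
  proof -
    have \<zeta>0: "crd\<zeta> 0 v = - (Im W0 + b * Im W1) / D" using Im_W_tot(2)[of v] D by (simp add: W0_def W1_def)
    have "Im E = 2 * y^2 * t^2 * (Im \<delta> + t * \<alpha>) - 2 * y^2 * D * \<alpha> + \<rho> / D * (Im W0 + b * Im W1)"
      unfolding E by simp
    also have "\<rho> / D * (Im W0 + b * Im W1) = - \<rho> * crd\<zeta> 0 v"
      unfolding \<zeta>0 by (simp add: minus_divide_left[symmetric] del: minus_add_distrib)
    finally have ImE: "Im E = 2 * y^2 * t^2 * (Im \<delta> + t * \<alpha>) - 2 * y^2 * D * \<alpha> - \<rho> * crd\<zeta> 0 v" by simp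
    have e1: "crdZ 1 v - Complex b t * crdZ 0 v = of_real y * \<delta>" unfolding v0 v1 by simp
    have e2: "of_int c / (2 * pi^2) * (inst_Gx (crd\<zeta> 0 p) y * crd\<zeta> 0 v + inst_Gy (crd\<zeta> 0 p) y * Re (crdZ 0 v))
       = \<rho> * crd\<zeta> 0 v + 2 * y^2 * \<alpha> * (D - t ^ 3 / 3 - c3)"
    proof -
      have "D - t ^ 3 / 3 - c3 = of_int c * inst_Gy (crd\<zeta> 0 p) y / (4 * pi^2 * y)" by (simp add: D_def)
      hence "2 * y^2 * \<alpha> * (D - t ^ 3 / 3 - c3) = of_int c / (2 * pi^2) * (inst_Gy (crd\<zeta> 0 p) y * (y * \<alpha>))"
        using y by (simp add: power2_eq_square)
      thus ?thesis unfolding v0 \<rho>_def by (simp add: algebra_simps)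
    qed
    have e3: "2 * y * Re (crdZ 0 v) * (2 * t ^ 3 / 3 - c3) + y * (2 * t^2 * Im (of_real y * \<delta>))
       - (\<rho> * crd\<zeta> 0 v + 2 * y^2 * \<alpha> * (D - t ^ 3 / 3 - c3)) = Im E"
      unfolding ImE v0 by (simp add: power2_eq_square power3_eq_cube algebra_simps)
    show ?thesis unfolding \<theta>0_eq e1 e2 e3 ..
  qed
  have om: "\<omega>12 F c p (V_field p) v = 2 * of_real pi * \<i> * L"
  proof -
    have z: "Complex b t = of_real b + \<i> * of_real t" by (simp add: complex_eq_iff)
    have i2: "\<i> * (\<i> * r) = - r" for r by (simp flip: mult.assoc)
    show ?thesis unfolding \<omega>12_V L W0_def[symmetric] W1_def[symmetric] v0 z by (simp add: algebra_simps i2)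
  qed
  have t1: "\<theta>1 F c p v = of_real (pi * Re L)" and t2: "\<theta>2 F c p v = of_real (pi * Im L)"
    unfolding \<theta>1_def \<theta>2_def \<omega>1_def \<omega>2_def om by simp_all
  have t3: "\<theta>3 F c p v = of_real (pi * T)"
    using \<theta>3_Reals[of v] by (simp add: T_def)
  have eta: "\<eta>_form F c p v = of_real (pi * (T + Re E))"
    unfolding \<eta>_form_def t3 gV by (simp add: algebra_simps)
  have sp: "sym_prod \<beta> \<beta> v v = (\<beta> v)^2" for \<beta> :: "point \<Rightarrow> complex"
    by (simp add: sym_prod_def power2_eq_square)
  \<comment> \<open>Both are positive because f > 0 > f_3, and their sum (f - f_3) / pi is g_N(V, V)
    / (2 pi), the squared length of V in the frame above.\<close>
  define A B where "A = f / pi" and "B = - f3 / pi"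
  have A: "A > 0" and B: "B > 0" using f(2) f3neg by (simp_all add: A_def B_def divide_neg_pos)
  have fA: "f = pi * A" and f3B: "f3 = - pi * B" by (simp_all add: A_def B_def)
  define q where "q = ((Im E)^2 + (cmod L)^2 + T^2) / A + (T + Re E)^2 / B - (cmod X1)\<^sup>2 - (cmod X2)\<^sup>2 + (cmod Y1)^2 + (cmod Y2)^2"
  have "ambient_tensor F c a p v v = of_real (- 1 / f * (2 / f3 * (pi * (T + Re E))^2
      + 2 * pi * ((cmod X1)^2 + (cmod X2)^2 - (cmod Y1)\<^sup>2 - (cmod Y2)\<^sup>2)
      - 2 / f * ((- pi * Im E)^2 + (pi * Re L)^2 + (pi * Im L)^2 + (pi * T)^2)))"
    unfolding ambient_tensor_def f(1) f3_fun sp g t0 t1 t2 t3 eta by simp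
  also have "2 / f3 * (pi * (T + Re E))^2 = - 2 * pi * ((T + Re E)^2 / B)"
    unfolding f3B using B by (simp add: power2_eq_square)
  also have "2 / f * ((- pi * Im E)^2 + (pi * Re L)^2 + (pi * Im L)^2 + (pi * T)^2) = 2 * pi * (((Im E)^2 + (cmod L)^2 + T^2) / A)"
  proof -
    have "(- pi * Im E)^2 + (pi * Re L)^2 + (pi * Im L)^2 + (pi * T)^2 = pi * (pi * ((Im E)^2 + (cmod L)^2 + T^2))"
      unfolding cmod_power2 by (simp add: power2_eq_square algebra_simps)
    thus ?thesis unfolding fA using A by simp
  qed
  also have "- 1 / f * (- 2 * pi * ((T + Re E)^2 / B) + 2 * pi * ((cmod X1)^2 + (cmod X2)^2 - (cmod Y1)\<^sup>2 - (cmod Y2)\<^sup>2)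
      - 2 * pi * (((Im E)^2 + (cmod L)^2 + T^2) / A)) = 2 * pi / f * q"
    unfolding q_def using f(2) by (simp add: algebra_simps add_divide_distrib diff_divide_distrib)
  finally have "2 * pi / f * q \<le> 0" using le by simp
  moreover have "2 * pi / f > 0" using f(2) by simp
  ultimately have q: "q \<le> 0" by (meson mult_pos_pos not_le)
  have AB: "A + B = pp^2 - uu\<^sup>2 - ss\<^sup>2"
  proof -
    have "A + B = 4 * y^2 * (t ^ 3 - D) - \<rho>\<^sup>2 / D" unfolding A_def B_def f3_def by (simp add: field_simps)
    moreover have "pp^2 = 4 * y^2 * t ^ 3" using t by (simp add: pp_def power_mult_distrib power2_eq_square power3_eq_cube)
    moreover have "uu^2 = 4 * y^2 * D" "ss^2 = \<rho>^2 / D" using D by (simp_all add: uu_def ss_def power_mult_distrib power_divide)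
    ultimately show ?thesis by (simp add: algebra_simps)
  qed
  have "X1 = 0 \<and> X2 = 0 \<and> Y1 = 0 \<and> Y2 = 0 \<and> T = 0"
  proof (rule quaternionic_quotient_form_definite[OF A B _ AB])
    show "uu \<noteq> 0" using y sD by (simp add: uu_def)
    show "Im Y1 = 0" by (simp add: Y1_def)
    show "((Im (of_real pp * X1 - \<i> * of_real uu * Y1 + of_real ss * Y2))^2 +
      (cmod (of_real uu * Y2 + \<i> * of_real ss * Y1 + \<i> * of_real pp * X2))^2 + T^2) / A +
      (T + Re (of_real pp * X1 - \<i> * of_real uu * Y1 + of_real ss * Y2))^2 / B - (cmod X1)\<^sup>2 - (cmod X2)\<^sup>2 + (cmod Y1)^2 + (cmod Y2)^2 \<le> 0"
      using q unfolding q_def E_def L_def .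
  qed
  hence z: "X1 = 0" "X2 = 0" "Y1 = 0" "Y2 = 0" "T = 0" by auto
  have \<alpha>: "\<alpha> = 0" using z(3) y sD by (simp add: Y1_def)
  moreover have "\<delta> = 0" using z(1) y st \<alpha> by (simp add: X1_def)
  moreover have W1: "W1 = 0" using z(2) st by (simp add: X2_def)
  moreover have "W0 = 0" using z(4) sD W1 by (simp add: Y2_def)
  moreover have "\<theta>3 F c p v = 0" using z(5) t3 by simp
  ultimately show ?thesis by (simp add: W0_def W1_def)
qed

end

section \<open>Restriction to the hypersurface\<close>

lemma incl_has_derivative:
  "(incl has_derivative (\<lambda>(d\<tau>2, dz, d\<tau>1, d\<zeta>1, d\<zeta>t0, d\<zeta>t1, d\<sigma>).
     (\<chi> i. if i = 0 then of_real d\<tau>2 else of_real d\<tau>2 * z + of_real \<tau>2 * dz,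
      \<chi> i. if i = 0 then d\<tau>1 else d\<zeta>1, \<chi> i. if i = 0 then d\<zeta>t0 else d\<zeta>t1, d\<sigma>))) (at (\<tau>2, z, \<tau>1, \<zeta>1, \<zeta>t0, \<zeta>t1, \<sigma>))"
proof -
  define vc where "vc = (\<lambda>ab::complex \<times> complex. (\<chi> i. if i = 0 then fst ab else snd ab) :: complex^2)"
  define vr where "vr = (\<lambda>ab::real \<times> real. (\<chi> i. if i = 0 then fst ab else snd ab) :: real^2)"
  have "linear vc" "linear vr" by (auto simp: linear_iff vc_def vr_def vec_eq_iff)
  hence bl: "bounded_linear vc" "bounded_linear vr" by (simp_all add: linear_conv_bounded_linear)
  have e: "incl = (\<lambda>h. (vc (of_real (fst h), of_real (fst h) * fst (snd h)), vr (fst (snd (snd h)), fst (snd (snd (snd h)))),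
      vr (fst (snd (snd (snd (snd h)))), fst (snd (snd (snd (snd (snd h)))))), snd (snd (snd (snd (snd (snd h)))))))"
    by (auto simp: incl_def fun_eq_iff vc_def vr_def)
  have s: "((\<lambda>h::hpoint. snd (snd (snd (snd (snd (snd h)))))) has_derivative (\<lambda>h. snd (snd (snd (snd (snd (snd h))))))) (at x)" for x
    by (intro has_derivative_snd has_derivative_ident)
  have r1: "((\<lambda>h::hpoint. (fst (snd (snd h)), fst (snd (snd (snd h))))) has_derivative (\<lambda>h. (fst (snd (snd h)), fst (snd (snd (snd h)))))) (at x)" for x
    by (intro has_derivative_Pair has_derivative_fst has_derivative_snd has_derivative_ident)
  have r2: "((\<lambda>h::hpoint. (fst (snd (snd (snd (snd h)))), fst (snd (snd (snd (snd (snd h))))))) has_derivative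
      (\<lambda>h. (fst (snd (snd (snd (snd h)))), fst (snd (snd (snd (snd (snd h)))))))) (at x)" for x
    by (intro has_derivative_Pair has_derivative_fst has_derivative_snd has_derivative_ident)
  have c: "((\<lambda>h::hpoint. (complex_of_real (fst h), of_real (fst h) * fst (snd h))) has_derivative
      (\<lambda>h. (of_real (fst h), of_real (fst h) * z + of_real \<tau>2 * fst (snd h)))) (at (\<tau>2, z, \<tau>1, \<zeta>1, \<zeta>t0, \<zeta>t1, \<sigma>))"
    by (auto intro!: derivative_eq_intros)
  show ?thesis unfolding e
    by (rule has_derivative_eq_rhs[OF has_derivative_Pair[OF bounded_linear.has_derivative[OF bl(1) c]
          has_derivative_Pair[OF bounded_linear.has_derivative[OF bl(2) r1]
          has_derivative_Pair[OF bounded_linear.has_derivative[OF bl(2) r2] s]]]])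
       (auto simp: fun_eq_iff vc_def vr_def vec_eq_iff)
qed

theorem corollary5p3:
  fixes c\<chi> :: int
  assumes "c\<chi> > 0"
  shows "\<forall>x \<in> N_tilde c\<chi>.
           metric_defined_at (prepotential c\<chi>) c\<chi> (of_int c\<chi> / (192 * pi)) (incl x) \<and>
           positive_definite_form (qmap_metric (prepotential c\<chi>) c\<chi> (of_int c\<chi> / (192 * pi)) x)"
proof
  fix x assume "x \<in> N_tilde c\<chi>"
  then obtain \<tau>2 z \<tau>1 \<zeta>1 \<zeta>t0 \<zeta>t1 \<sigma> where x: "x = (\<tau>2, z, \<tau>1, \<zeta>1, \<zeta>t0, \<zeta>t1, \<sigma>)"
    and y: "\<tau>2 > 0" and t: "Im z > 0"
    and R1: "R1 c\<chi> (Im z) (Complex \<tau>1 \<tau>2) > 0" and R2: "R2 c\<chi> (Im z) (Complex \<tau>1 \<tau>2) > 0"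
    by (auto simp: N_tilde_def)
  let ?F = "prepotential c\<chi>" and ?a = "of_int c\<chi> / (192 * pi) :: real"
  define p where "p = incl x"
  have crd: "crdZ 0 p = of_real \<tau>2" "crdZ 1 p = of_real \<tau>2 * z" "crd\<zeta> 0 p = \<tau>1"
    by (simp_all add: p_def x incl_def crdZ_def crd\<zeta>_def)
  interpret P: qmap_point c\<chi> \<tau>2 "Re z" "Im z" p
    by unfold_locales (use y t crd in simp_all)
  \<comment> \<open>The constant chi / (24 pi) is 8 c_l.\<close>
  define f where "f = 2 * pi * (\<tau>2\<^sup>2 * (2 * Im z ^ 3 / 3 - P.c3) - of_int c\<chi> / (24 * pi) - of_int c\<chi> * inst_G \<tau>1 \<tau>2 / (2 * pi^2))"
  note signs = f_f3_signs[OF y t, of "of_int c\<chi>" \<tau>1]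
  have S: "P.D > 0" "f > 0" "f - pi * (4 * \<tau>2\<^sup>2 * (Im z ^ 3 - P.D) - P.\<rho>^2 / P.D) < 0" "2 * Im z ^ 3 / 3 - P.c3 > 0" "P.c3 \<ge> 0"
    using signs assms R1 R2 unfolding P.D_def P.\<rho>_def P.c3_def f_def R1_def R2_def crd by auto
  interpret Q: qmap_point_nondegenerate c\<chi> \<tau>2 "Re z" "Im z" p
    by unfold_locales (rule S)
  have f: "f_fun ?F c\<chi> ?a p = of_real f"
    unfolding f_fun_prepotential[OF P.Z0_nz(1)] P.cmod_Z0 P.ratio f_def P.c3_def crd(3) by simp
  have f3: "f3_fun ?F c\<chi> ?a p = of_real (f - pi * (4 * \<tau>2\<^sup>2 * (Im z ^ 3 - P.D) - P.\<rho>^2 / P.D))"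
    unfolding f3_fun_def f Q.g_N_V_V by simp
  have r: "r_sq ?F (fst p) = of_real (\<tau>2\<^sup>2 * (2 * Im z ^ 3 / 3 - P.c3))"
    unfolding r_sq_prepotential[OF P.Z0_nz(2)] P.ratio P.c3_def using P.cmod_Z0 by (simp add: crdZ_def)
  have "metric_defined_at ?F c\<chi> ?a p"
    unfolding metric_defined_at_def
  proof (intro conjI)
    show "fst p \<in> M_cl" using P.Z0_nz P.ratio t by (simp add: M_cl_def)
    show "r_sq ?F (fst p) \<in> \<real>" "Re (r_sq ?F (fst p)) > 0" unfolding r using y S(4) by (auto simp del: of_real_mult)
    show "has_signature (Im_tau ?F (fst p)) 1 1" by (rule Q.has_signature_Im_tau[OF S(5)])
    show "det (T_mat ?F c\<chi> p) \<noteq> 0" by (rule Q.det_T_mat)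
    show "f_fun ?F c\<chi> ?a p \<noteq> 0" "f3_fun ?F c\<chi> ?a p \<noteq> 0" unfolding f f3 of_real_eq_0_iff using S by auto
    show "g_N ?F c\<chi> p (V_field p) (V_field p) \<noteq> 0" unfolding Q.g_N_V_V of_real_eq_0_iff using S(2,3) by auto
  qed
  moreover have "positive_definite_form (qmap_metric ?F c\<chi> ?a x)"
  proof -
    define L where "L = frechet_derivative incl (at x)"
    have L: "L (d\<tau>2, dz, d\<tau>1, d\<zeta>1, d\<zeta>t0, d\<zeta>t1, d\<sigma>) =
       (\<chi> i. if i = 0 then of_real d\<tau>2 else of_real d\<tau>2 * z + of_real \<tau>2 * dz,
        \<chi> i. if i = 0 then d\<tau>1 else d\<zeta>1, \<chi> i. if i = 0 then d\<zeta>t0 else d\<zeta>t1, d\<sigma>)" for d\<tau>2 dz d\<tau>1 d\<zeta>1 d\<zeta>t0 d\<zeta>t1 d\<sigma>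
      unfolding L_def x frechet_derivative_at[OF incl_has_derivative, symmetric] by simp
    have linL: "linear L"
      unfolding L_def x by (rule linear_frechet_derivative[OF differentiableI[OF incl_has_derivative]])
    have m: "qmap_metric ?F c\<chi> ?a x = (\<lambda>u v. ambient_tensor ?F c\<chi> ?a p (L u) (L v))"
      by (simp add: fun_eq_iff qmap_metric_def p_def L_def)
    have fR: "f_fun ?F c\<chi> ?a p \<in> \<real>" unfolding f by simp
    have pos: "Re (ambient_tensor ?F c\<chi> ?a p (L v) (L v)) > 0" if "v \<noteq> 0" for v
    proof (rule ccontr)
      assume "\<not> Re (ambient_tensor ?F c\<chi> ?a p (L v) (L v)) > 0"
      hence le: "Re (ambient_tensor ?F c\<chi> ?a p (L v) (L v)) \<le> 0" by simp
      obtain d\<tau>2 dz d\<tau>1 d\<zeta>1 d\<zeta>t0 d\<zeta>t1 d\<sigma> where v: "v = (d\<tau>2, dz, d\<tau>1, d\<zeta>1, d\<zeta>t0, d\<zeta>t1, d\<sigma>)" by (cases v)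
      have c: "crdZ 0 (L v) = of_real d\<tau>2" "crdZ 1 (L v) = of_real d\<tau>2 * z + of_real \<tau>2 * dz" "crd\<zeta> 0 (L v) = d\<tau>1" "crd\<zeta> 1 (L v) = d\<zeta>1"
        "crd\<zeta>t 0 (L v) = d\<zeta>t0" "crd\<zeta>t 1 (L v) = d\<zeta>t1" "crd\<sigma> (L v) = d\<sigma>"
        unfolding v L by (simp_all add: crdZ_def crd\<zeta>_def crd\<zeta>t_def crd\<sigma>_def)
      have "d\<tau>2 / \<tau>2 = 0 \<and> dz = 0 \<and> W_tot ?F c\<chi> 0 p (L v) = 0 \<and> W_tot ?F c\<chi> 1 p (L v) = 0 \<and> \<theta>3 ?F c\<chi> p (L v) = 0"
        by (rule Q.ambient_definite[OF f S(2,3) _ _ le]) (use y c in \<open>simp_all add: mult.commute\<close>)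
      hence d: "d\<tau>2 = 0" "dz = 0" and W: "W_tot ?F c\<chi> 0 p (L v) = 0" "W_tot ?F c\<chi> 1 p (L v) = 0" and th: "\<theta>3 ?F c\<chi> p (L v) = 0"
        using y by auto
      \<comment> \<open>The imaginary parts of W give the components of zeta; with these zero, the
        real parts give those of zeta tilde.\<close>
      have 0: "d\<tau>1 = 0" using P.Im_W_tot(2)[of "L v"] W S(1) c by simp
      have 1: "d\<zeta>1 = 0" using P.Im_W_tot(1)[of "L v"] W t c 0 by simp
      have 2: "d\<zeta>t0 = 0" using W(1) unfolding P.W_tot_0 c d 0 1 by simp
      have 3: "d\<zeta>t1 = 0" using W(2) unfolding P.W_tot_1 c d 0 1 by simp
      \<comment> \<open>With all other components zero, \<open>\<theta>3\<close> reduces to pi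
        d\<sigma>.\<close>
      have "fst (L v) = 0" unfolding v L d by (simp add: vec_eq_iff)
      hence "dc (r_sq ?F) (fst p) (fst (L v)) = 0" using linear_0[OF Q.linear_dc] by simp
      hence "d\<sigma> = 0" using th unfolding Q.\<theta>3_eq sum_UNIV_2 c d 0 1 2 3 by simp
      thus False using that unfolding v d 0 1 2 3 by (simp add: zero_prod_def)
    qed
    show ?thesis unfolding positive_definite_form_def m
      using bilinear_comp_linear[OF Q.bilinear_ambient linL] Q.ambient_commute Q.ambient_Reals[OF fR] pos by blast
  qed
  ultimately show "metric_defined_at ?F c\<chi> ?a (incl x) \<and> positive_definite_form (qmap_metric ?F c\<chi> ?a x)"
    by (simp add: p_def)
qed

end
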